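(* Let $\widetilde{\mathfrak L}=\widetilde{\mathfrak{sl}_2(\mathbb C_q)}$ be the Lie algebra described in the context, $U=\mathcal U(\widetilde{\mathfrak L})$, and let $\mathbf n=(n_1,n_2)\in\mathbb Z^2$. In each of the situations (1), (2), (3) below there exists a noncommutative and noncocommutative Hopf algebra structure $(U[[t]],\mu,\tau,\Delta,\epsilon,S)$ on $U[[t]]$ over $\mathbb C[[t]]$ which preserves the product and the counit of $U[[t]]$, and whose coproduct $\Delta$ and antipode $S$ are given on the basis elements of $\widetilde{\mathfrak L}$ by the listed formulas. Here $\mathbf m=(m_1,m_2)$ ranges over $\mathbb Z^2$ for $e_{\mathbf m},f_{\mathbf m}$ and over $\mathbb Z^2\setminus\{\mathbf 0\}$ for $g_{\mathbf m},h_{\mathbf m}$, and $i=1,2$. (1) $T=x_1d_1+x_2d_2$ with $x_1,x_2\in\mathbb C$, $E=g_{\mathbf n}$ with $[T,E]=E$, $r=x_1m_1+x_2m_2$; for $y=e,f,g,h$: $$\Delta(y_{\mathbf m})=y_{\mathbf m}\otimes(1-Et)^r+\sum_{j=0}^\infty\frac{\gamma^y_{j,\mathbf m}}{j!}T^{<j>}\otimes(1-Et)^{-j}y_{\mathbf m+j\mathbf n}t^j,$$ $$S(y_{\mathbf m})=\sum_{j=0}^\infty\frac{(-1)^{j+1}\gamma^y_{j,\mathbf m}}{j!}(1-Et)^{-r}y_{\mathbf m+j\mathbf n}T_1^{<j>}t^j,$$ $$\Delta(d_i)=d_i\otimes1+1\otimes d_i-n_iT\otimes1+n_iT\otimes(1-Et)^{-1},\qquad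 S(d_i)=-d_i+n_iTEt,$$ $$\Delta(d)=d\otimes1+1\otimes d,\qquad S(d)=-d.$$ (2) $T=x_1d_1+x_2d_2$ with $x_1,x_2\in\mathbb C$, $E=e_{\mathbf n}$ with $[T,E]=E$, $r=x_1m_1+x_2m_2$; for $y=e,g,h$: $$\Delta(y_{\mathbf m})=y_{\mathbf m}\otimes(1-Et)^r+1\otimes y_{\mathbf m}+\alpha_{y_{\mathbf m}}T\otimes(1-Et)^{-1}e_{\mathbf m+\mathbf n}t,$$ $$S(y_{\mathbf m})=-(1-Et)^{r}y_{\mathbf m}+\alpha_{y_{\mathbf m}}(1-Et)^{r}e_{\mathbf m+\mathbf n}T_1t;$$ if $\mathbf m+\mathbf n\ne\mathbf 0$, $$\Delta(f_{\mathbf m})=f_{\mathbf m}\otimes(1-Et)^r+1\otimes f_{\mathbf m}+q^{m_2n_1}T\otimes(1-Et)^{-1}h_{\mathbf m+\mathbf n}t-q^{m_1n_2}T\otimes(1-Et)^{-1}g_{\mathbf m+\mathbf n}t-s_{\mathbf m}T^{<2>}\otimes(1-Et)^{-2}e_{\mathbf m+2\mathbf n}t^2,$$ $$S(f_{\mathbf m})=q^{m_2n_1}(1-Et)^{r}h_{\mathbf m+\mathbf n}T_1t-q^{m_1n_2}(1-Et)^{r}g_{\mathbf m+\mathbf n}T_1t-(1-Et)^{r}f_{\mathbf m}+s_{\mathbf m}(1-Et)^{r}e_{\mathbf m+2\mathbf n}T_1^{<2>}t^2;$$ for $\mathbf m=-\mathbf n$, $$\Delta(f_{-\mathbf n})=f_{-\mathbf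 n}\otimes(1-Et)^{-1}+1\otimes f_{-\mathbf n}-q^{-n_1n_2}T\otimes(1-Et)^{-1}d\,t-q^{-n_1n_2}T^{<2>}\otimes(1-Et)^{-2}Et^2,$$ $$S(f_{-\mathbf n})=q^{-n_1n_2}(1-Et)^{-1}ET_1^{<2>}t^2-(1-Et)^{-1}f_{-\mathbf n}-q^{-n_1n_2}(1-Et)^{-1}d\,T_1t;$$ and $$\Delta(d)=d\otimes1+1\otimes d+2T\otimes(1-Et)^{-1}Et,\qquad S(d)=-d+2ET_1t,$$ $$\Delta(d_i)=d_i\otimes1+1\otimes d_i-n_iT\otimes1+n_iT\otimes(1-Et)^{-1},\qquad S(d_i)=-d_i+n_iTEt.$$ (3) $T=\frac12d$, $E=e_{\mathbf n}$; for $y=e,g,h$, with $\delta_{y,e}=1$ if $y=e$ and $0$ otherwise: $$\Delta(y_{\mathbf m})=y_{\mathbf m}\otimes(1-Et)^{\delta_{y,e}}+1\otimes y_{\mathbf m}+\alpha_{y_{\mathbf m}}T\otimes(1-Et)^{-1}e_{\mathbf m+\mathbf n}t,$$ $$S(y_{\mathbf m})=-(1-Et)^{\delta_{y,e}}y_{\mathbf m}+\alpha_{y_{\mathbf m}}e_{\mathbf m+\mathbf n}T_1t;$$ if $\mathbf m+\mathbf n\neq\mathbf 0$, $$\Delta(f_{\mathbf m})=f_{\mathbf m}\otimes(1-Et)^{-1}+1\otimes f_{\mathbf m}+q^{m_2n_1}T\otimes(1-Et)^{-1}h_{\mathbf m+\mathbf n}t-q^{m_1n_2}T\otimes(1-Et)^{-1}g_{\mathbf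 m+\mathbf n}t-s_{\mathbf m}T^{<2>}\otimes(1-Et)^{-2}e_{\mathbf m+2\mathbf n}t^2,$$ $$S(f_{\mathbf m})=q^{m_2n_1}(1-Et)^{-1}h_{\mathbf m+\mathbf n}T_1t-q^{m_1n_2}(1-Et)^{-1}T_1g_{\mathbf m+\mathbf n}t-(1-Et)^{-1}f_{\mathbf m}+s_{\mathbf m}(1-Et)^{-1}e_{\mathbf m+2\mathbf n}T_1^{<2>}t^2;$$ for $\mathbf m=-\mathbf n$, $$\Delta(f_{-\mathbf n})=f_{-\mathbf n}\otimes(1-Et)^{-1}+1\otimes f_{-\mathbf n}-q^{-n_1n_2}T\otimes(1-Et)^{-1}d\,t-q^{-n_1n_2}T^{<2>}\otimes(1-Et)^{-2}Et^2,$$ $$S(f_{-\mathbf n})=q^{-n_1n_2}(1-Et)^{-1}ET_1^{<2>}t^2-(1-Et)^{-1}f_{-\mathbf n}-q^{-n_1n_2}(1-Et)^{-1}d\,T_1t;$$ and $$\Delta(d)=d\otimes1+1\otimes d+2T\otimes(1-Et)^{-1}Et,\qquad S(d)=-d+2ET_1t,$$ $$\Delta(d_i)=d_i\otimes1+1\otimes d_i+n_iT\otimes(1-Et)^{-1}-n_iT\otimes1,\qquad S(d_i)=-d_i+n_iTEt.$$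
   Context: **The Lie algebra.** Let $q$ be a fixed nonzero complex number. $\mathfrak L=\mathfrak{sl}_2(\mathbb C_q)$ is the complex Lie algebra with basis $e_{\mathbf m},f_{\mathbf m}$ ($\mathbf m\in\mathbb Z^2$), $g_{\mathbf k},h_{\mathbf k}$ ($\mathbf k\in\mathbb Z^2\setminus\{\mathbf 0\}$), $d$; these are the matrices $E_{12}x^{m_1}y^{m_2}$, $E_{21}x^{m_1}y^{m_2}$, $E_{11}x^{k_1}y^{k_2}$, $E_{22}x^{k_1}y^{k_2}$, $E_{11}-E_{22}$ over the quantum torus $\mathbb C_q=\mathbb C_q[x^{\pm1},y^{\pm1}]$, $yx=qxy$. The brackets are $[e_{\mathbf m},e_{\mathbf m'}]=[f_{\mathbf m},f_{\mathbf m'}]=[d,h_{\mathbf k}]=[d,g_{\mathbf k}]=[g_{\mathbf k},h_{\mathbf k'}]=0$; $[g_{\mathbf k},e_{\mathbf m}]=q^{k_2m_1}e_{\mathbf k+\mathbf m}$, $[h_{\mathbf k},e_{\mathbf m}]=-q^{k_1m_2}e_{\mathbf k+\mathbf m}$, $[d,e_{\mathbf m}]=2e_{\mathbf m}$; $[h_{\mathbf k},f_{\mathbf m}]=q^{k_2m_1}f_{\mathbf k+\mathbf m}$, $[g_{\mathbf k},f_{\mathbf m}]=-q^{k_1m_2}f_{\mathbf k+\mathbf m}$, $[d,f_{\mathbf m}]=-2f_{\mathbf m}$; $[e_{\mathbf m},f_{\mathbf m'}]=q^{m_2m_1'}g_{\mathbf m+\mathbf m'}-q^{m_2'm_1}h_{\mathbf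 m+\mathbf m'}$ if $\mathbf m+\mathbf m'\ne\mathbf 0$, and $=q^{m_2m_1'}d$ if $\mathbf m+\mathbf m'=\mathbf 0$; $[g_{\mathbf k},g_{\mathbf k'}]=(q^{k_2k_1'}-q^{k_2'k_1})g_{\mathbf k+\mathbf k'}$ and $[h_{\mathbf k},h_{\mathbf k'}]=(q^{k_2k_1'}-q^{k_2'k_1})h_{\mathbf k+\mathbf k'}$ if $\mathbf k+\mathbf k'\neq\mathbf 0$, and both are $0$ if $\mathbf k+\mathbf k'=\mathbf 0$. $\mathfrak L$ is $\mathbb Z^2$-graded: $e_{\mathbf m},f_{\mathbf m},g_{\mathbf m},h_{\mathbf m}$ have degree $\mathbf m$ and $d$ has degree $\mathbf 0$. $\widetilde{\mathfrak L}=\widetilde{\mathfrak{sl}_2(\mathbb C_q)}=\mathfrak L\oplus\mathbb Cd_1\oplus\mathbb Cd_2$ with $[d_i,L]=m_iL$ for $L\in\mathfrak L$ of degree $\mathbf m$, and $[d_1,d_2]=[d,d_1]=[d,d_2]=0$. Convention: undefined terms are zero, e.g. $g_{\mathbf 0}=h_{\mathbf 0}=0$. **Hopf algebras.** $U=\mathcal U(\widetilde{\mathfrak L})$ has the standard Hopf structure with product $\mu$, unit $\tau$, and $\Delta_0(L)=L\otimes1+1\otimes L$, $S_0(L)=-L$, $\epsilon_0(L)=0$ for $L\in\widetilde{\mathfrak L}$; it induces a Hopf algebra structure on $U[[t]]$ over $\mathbb C[[t]]$, where $t$ is a formal variable and $U[[t]]$ is the algebra of formal power series with coefficients in $U$ (tensor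 products over $\mathbb C[[t]]$ are understood as completed). **Notation.** For $x$ in a unital $\mathbb C$-algebra, $a\in\mathbb C$, $j\ge0$: $x_a^{<j>}=(x+a)(x+a+1)\cdots(x+a+j-1)$, $x_a^{<0>}=1$, $x^{<j>}=x_0^{<j>}$, $x_a=x_a^{<1>}=x+a$. For $a\in\mathbb C$, $(1-Et)^a=\sum_{k\ge0}(-1)^k\binom akE^kt^k$ with $\binom ak=a(a-1)\cdots(a-k+1)/k!$. $\gamma^y_{0,\mathbf m}=1$ for $y=e,f,g,h$, and for $j>0$: $\gamma^h_{j,\mathbf m}=0$, $\gamma^g_{j,\mathbf m}=(-1)^j\prod_{p=1}^j\big(q^{n_2(m_1+(p-1)n_1)}-q^{n_1(m_2+(p-1)n_2)}\big)$, $\gamma^f_{j,\mathbf m}=\prod_{p=1}^jq^{n_1(m_2+(p-1)n_2)}$, $\gamma^e_{j,\mathbf m}=(-1)^j\prod_{p=1}^jq^{n_2(m_1+(p-1)n_1)}$. $\alpha_{e_{\mathbf m}}=0$, $\alpha_{g_{\mathbf m}}=q^{m_2n_1}$, $\alpha_{h_{\mathbf m}}=-q^{m_1n_2}$. $s_{\mathbf m}=q^{n_2m_1+n_1m_2+n_1n_2}$.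
   Formalization: In (2) and (3) the exponents of (1-Et) in S(y_m), S(f_m) and S(f_{-n}) are replaced by their negatives, since the printed signs contradict the antipode axiom (already at e_n); in (1) n≠0 is assumed so that g_n is a basis element. *)

theory Defs
  imports
    Complex_Main
    "HOL-Library.Poly_Mapping"
    "HOL-Library.Product_Plus"
    "HOL-Computational_Algebra.Formal_Power_Series"
begin

unbundle fps_syntax

section \<open>Complex vector spaces, algebras and Lie algebras\<close>

class scaleC =
  fixes scaleC :: "complex \<Rightarrow> 'a \<Rightarrow> 'a"  (infixr \<open>*\<^sub>C\<close> 75)

class complex_vector = scaleC + ab_group_add +
  assumes scaleC_add_right: "a *\<^sub>C (x + y) = a *\<^sub>C x + a *\<^sub>C y"
    and scaleC_add_left: "(a + b) *\<^sub>C x = a *\<^sub>C x + b *\<^sub>C x"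
    and scaleC_scaleC: "a *\<^sub>C (b *\<^sub>C x) = (a * b) *\<^sub>C x"
    and scaleC_one: "1 *\<^sub>C x = x"

class complex_algebra_1 = complex_vector + ring_1 +
  assumes mult_scaleC_left: "(a *\<^sub>C x) * y = a *\<^sub>C (x * y)"
    and mult_scaleC_right: "x * (a *\<^sub>C y) = a *\<^sub>C (x * y)"

class complex_lie_algebra = complex_vector +
  fixes lie :: "'a \<Rightarrow> 'a \<Rightarrow> 'a"
  assumes lie_add_left: "lie (x + y) z = lie x z + lie y z"
    and lie_add_right: "lie x (y + z) = lie x y + lie x z"
    and lie_scaleC_left: "lie (a *\<^sub>C x) y = a *\<^sub>C lie x y"
    and lie_scaleC_right: "lie x (a *\<^sub>C y) = a *\<^sub>C lie x y"
    and lie_self: "lie x x = 0"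
    and lie_jacobi: "lie x (lie y z) + lie y (lie z x) + lie z (lie x y) = 0"

global_interpretation cvec: vector_space "scaleC :: complex \<Rightarrow> 'a \<Rightarrow> 'a::complex_vector"
  by unfold_locales (auto simp: scaleC_add_right scaleC_add_left scaleC_scaleC scaleC_one)

instantiation complex :: complex_algebra_1
begin
definition scaleC_complex :: "complex \<Rightarrow> complex \<Rightarrow> complex" where "scaleC_complex = (*)"
instance by standard (auto simp: scaleC_complex_def algebra_simps)
end

instantiation poly_mapping :: (type, complex_vector) complex_vector
begin
lift_definition scaleC_poly_mapping :: "complex \<Rightarrow> ('a \<Rightarrow>\<^sub>0 'b) \<Rightarrow> 'a \<Rightarrow>\<^sub>0 'b"
  is "\<lambda>c f k. c *\<^sub>C f k"
  by (rule finite_subset[rotated]) auto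
instance
  by (standard; transfer) (auto simp: fun_eq_iff algebra_simps scaleC_add_right scaleC_add_left scaleC_scaleC scaleC_one)
end

instantiation fps :: (complex_vector) complex_vector
begin
definition scaleC_fps :: "complex \<Rightarrow> 'a fps \<Rightarrow> 'a fps" where
  "scaleC_fps c f = Abs_fps (\<lambda>n. c *\<^sub>C (f $ n))"
instance
  by standard (auto simp: scaleC_fps_def fps_eq_iff scaleC_add_right scaleC_add_left scaleC_scaleC scaleC_one)
end

instance fps :: (complex_algebra_1) complex_algebra_1
  by standard (auto simp: scaleC_fps_def fps_eq_iff fps_mult_nth cvec.scale_sum_right mult_scaleC_left mult_scaleC_right)

definition basis_family :: "'i set \<Rightarrow> ('i \<Rightarrow> 'v::complex_vector) \<Rightarrow> bool" where
  "basis_family I v \<longleftrightarrow> inj_on v I \<and> cvec.independent (v ` I) \<and> cvec.span (v ` I) = UNIV"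

text \<open>The elements of \<open>'k \<Rightarrow>\<^sub>0 complex\<close> are the formal linear combinations of elements of \<open>'k\<close>.
  A map on the generators extends linearly:\<close>

definition lin_ext :: "('k \<Rightarrow> 'v::complex_vector) \<Rightarrow> ('k \<Rightarrow>\<^sub>0 complex) \<Rightarrow> 'v" where
  "lin_ext h p = (\<Sum>k\<in>Poly_Mapping.keys p. Poly_Mapping.lookup p k *\<^sub>C h k)"

abbreviation gen :: "'k \<Rightarrow> 'k \<Rightarrow>\<^sub>0 complex" where
  "gen k \<equiv> Poly_Mapping.single k 1"

lemma lookup_scaleC [simp]: "Poly_Mapping.lookup (c *\<^sub>C p) k = c *\<^sub>C Poly_Mapping.lookup p k"
  by transfer simp

lemma lin_ext_superset:
  assumes "finite A" "Poly_Mapping.keys p \<subseteq> A"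
  shows "lin_ext h p = (\<Sum>k\<in>A. Poly_Mapping.lookup p k *\<^sub>C h k)"
  unfolding lin_ext_def
  by (rule sum.mono_neutral_left) (use assms in \<open>auto simp: in_keys_iff\<close>)

lemma lin_ext_add: "lin_ext h (p + p') = lin_ext h p + lin_ext h p'"
proof -
  let ?A = "Poly_Mapping.keys p \<union> Poly_Mapping.keys p'"
  have "Poly_Mapping.keys (p + p') \<subseteq> ?A" by (rule keys_add)
  then show ?thesis
    by (simp add: lin_ext_superset[of ?A] lookup_add scaleC_add_left sum.distrib)
qed

lemma lin_ext_scaleC: "lin_ext h (c *\<^sub>C p) = c *\<^sub>C lin_ext h p"
proof -
  have "Poly_Mapping.keys (c *\<^sub>C p) \<subseteq> Poly_Mapping.keys p" by (auto simp: in_keys_iff scaleC_complex_def)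
  then show ?thesis
    by (simp add: lin_ext_superset[of "Poly_Mapping.keys p"] cvec.scale_sum_right scaleC_complex_def scaleC_scaleC)
qed

lemma lin_ext_gen [simp]: "lin_ext h (gen k) = h k"
  by (simp add: lin_ext_def scaleC_one)

lemma lin_ext_linear: "Vector_Spaces.linear scaleC scaleC (lin_ext h)"
  by unfold_locales (auto simp: lin_ext_add lin_ext_scaleC)

lemma lin_ext_diff: "lin_ext h (p - p') = lin_ext h p - lin_ext h p'"
  by (metis add_diff_cancel diff_add_cancel lin_ext_add)

lemma lin_ext_zero [simp]: "lin_ext h 0 = 0"
  by (simp add: lin_ext_def)

lemma free_induct [case_names zero gen add scale]:
  fixes p :: "'k \<Rightarrow>\<^sub>0 complex"
  assumes "P 0" "\<And>k. P (gen k)" "\<And>p p'. P p \<Longrightarrow> P p' \<Longrightarrow> P (p + p')" "\<And>c p. P p \<Longrightarrow> P (c *\<^sub>C p)"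
  shows "P p"
proof -
  have single: "P (Poly_Mapping.single k c)" for k c
  proof -
    have "Poly_Mapping.single k c = c *\<^sub>C gen k"
      by (rule poly_mapping_eqI) (simp add: lookup_single when_def scaleC_complex_def)
    then show ?thesis using assms by simp
  qed
  have "P p" if "finite A" "Poly_Mapping.keys p = A" for A p
    using that
  proof (induction A arbitrary: p rule: finite_induct)
    case empty then show ?case using assms(1) by simp
  next
    case (insert k A)
    let ?p = "p - Poly_Mapping.single k (Poly_Mapping.lookup p k)"
    have "Poly_Mapping.keys ?p = Poly_Mapping.keys p - {k}"
      by (auto simp: in_keys_iff lookup_minus lookup_single when_def split: if_splits)
    with insert.prems insert.hyps have "Poly_Mapping.keys ?p = A" by simp
    then have "P (?p + Poly_Mapping.single k (Poly_Mapping.lookup p k))"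
      using insert.IH single assms(3) by blast
    then show ?case by simp
  qed
  from this[OF finite_keys refl] show ?thesis .
qed

section \<open>Tensor products over the complex numbers\<close>

text \<open>The free vector space on \<open>'a \<times> 'b\<close> modulo the bilinearity relations.\<close>

definition tensor_null :: "('a::complex_vector \<times> 'b::complex_vector \<Rightarrow>\<^sub>0 complex) set" where
  "tensor_null = cvec.span (
     {gen (x + x', y) - gen (x, y) - gen (x', y) | x x' y. True} \<union>
     {gen (x, y + y') - gen (x, y) - gen (x, y') | x y y'. True} \<union>
     {gen (c *\<^sub>C x, y) - c *\<^sub>C gen (x, y) | c x y. True} \<union>
     {gen (x, c *\<^sub>C y) - c *\<^sub>C gen (x, y) | c x y. True})"

definition tensor_rel :: "('a::complex_vector \<times> 'b::complex_vector \<Rightarrow>\<^sub>0 complex) \<Rightarrow> ('a \<times> 'b \<Rightarrow>\<^sub>0 complex) \<Rightarrow> bool"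
  where "tensor_rel p p' \<longleftrightarrow> p - p' \<in> tensor_null"

lemma quotient_equivp:
  fixes R :: "'a::complex_vector set"
  shows "equivp (\<lambda>p p'. p - p' \<in> cvec.span R)"
proof (rule equivpI)
  show "reflp (\<lambda>p p'. p - p' \<in> cvec.span R)"
    by (auto intro!: reflpI cvec.span_zero)
  show "symp (\<lambda>p p'. p - p' \<in> cvec.span R)"
    proof (rule sympI)
    fix x y :: 'a
    assume "x - y \<in> cvec.span R"
    from cvec.span_neg[OF this] show "y - x \<in> cvec.span R" by simp
  qed
  show "transp (\<lambda>p p'. p - p' \<in> cvec.span R)"
    proof (rule transpI)
    fix x y z :: 'a
    assume "x - y \<in> cvec.span R" "y - z \<in> cvec.span R"
    from cvec.span_add[OF this] show "x - z \<in> cvec.span R" by simp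
  qed
qed

lemma quotient_add: "p + s - (p' + s') \<in> cvec.span R"
  and quotient_diff: "p - s - (p' - s') \<in> cvec.span R"
  if "p - p' \<in> cvec.span R" "s - s' \<in> cvec.span R"
  using cvec.span_add[OF that] cvec.span_diff[OF that] by (simp_all add: algebra_simps)

lemma quotient_uminus: "- p - - p' \<in> cvec.span R"
  and quotient_scaleC: "c *\<^sub>C p - c *\<^sub>C p' \<in> cvec.span R"
  if "p - p' \<in> cvec.span R"
  using cvec.span_neg[OF that] cvec.span_scale[OF that, of c]
  by (simp_all add: cvec.scale_right_diff_distrib)

quotient_type (overloaded) ('a, 'b) tensor =
  "'a::complex_vector \<times> 'b::complex_vector \<Rightarrow>\<^sub>0 complex" / tensor_rel
  unfolding tensor_rel_def tensor_null_def by (rule quotient_equivp)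

instantiation tensor :: (complex_vector, complex_vector) complex_vector
begin

lift_definition zero_tensor :: "('a, 'b) tensor" is 0 .

lift_definition plus_tensor :: "('a, 'b) tensor \<Rightarrow> ('a, 'b) tensor \<Rightarrow> ('a, 'b) tensor" is "(+)"
  unfolding tensor_rel_def tensor_null_def by (rule quotient_add)

lift_definition minus_tensor :: "('a, 'b) tensor \<Rightarrow> ('a, 'b) tensor \<Rightarrow> ('a, 'b) tensor" is "(-)"
  unfolding tensor_rel_def tensor_null_def by (rule quotient_diff)

lift_definition uminus_tensor :: "('a, 'b) tensor \<Rightarrow> ('a, 'b) tensor" is uminus
  unfolding tensor_rel_def tensor_null_def by (rule quotient_uminus)

lift_definition scaleC_tensor :: "complex \<Rightarrow> ('a, 'b) tensor \<Rightarrow> ('a, 'b) tensor" is scaleC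
  unfolding tensor_rel_def tensor_null_def by (rule quotient_scaleC)

instance
  by (standard; transfer)
     (auto simp: tensor_rel_def tensor_null_def cvec.span_zero algebra_simps
        scaleC_add_right scaleC_add_left scaleC_scaleC scaleC_one)

end

lift_definition tens :: "'a::complex_vector \<Rightarrow> 'b::complex_vector \<Rightarrow> ('a, 'b) tensor" (infixr \<open>\<otimes>\<close> 72)
  is "\<lambda>x y. gen (x, y)" .

text \<open>For bilinear \<open>\<beta>\<close>, the linear map sending \<open>x \<otimes> y\<close> to \<open>\<beta> x y\<close>.  It is computed on an
  arbitrary representative; the value is meaningful only for bilinear \<open>\<beta>\<close>.\<close>

definition tensor_lift :: "('a::complex_vector \<Rightarrow> 'b::complex_vector \<Rightarrow> 'c::complex_vector)
    \<Rightarrow> ('a, 'b) tensor \<Rightarrow> 'c" where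
  "tensor_lift \<beta> X = lin_ext (\<lambda>(x, y). \<beta> x y) (rep_tensor X)"

definition bilinearC :: "('a::complex_vector \<Rightarrow> 'b::complex_vector \<Rightarrow> 'c::complex_vector) \<Rightarrow> bool" where
  "bilinearC \<beta> \<longleftrightarrow> (\<forall>x x' y. \<beta> (x + x') y = \<beta> x y + \<beta> x' y) \<and> (\<forall>x y y'. \<beta> x (y + y') = \<beta> x y + \<beta> x y')
     \<and> (\<forall>c x y. \<beta> (c *\<^sub>C x) y = c *\<^sub>C \<beta> x y) \<and> (\<forall>c x y. \<beta> x (c *\<^sub>C y) = c *\<^sub>C \<beta> x y)"

lemma lin_ext_vanish:
  assumes "p \<in> cvec.span R" "\<And>r. r \<in> R \<Longrightarrow> lin_ext h r = 0"
  shows "lin_ext h p = 0"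
  using assms(1)
  by (induction rule: cvec.span_induct_alt) (auto simp: lin_ext_add lin_ext_scaleC assms(2))

lemma tensor_lift_abs:
  assumes "bilinearC \<beta>"
  shows "tensor_lift \<beta> (abs_tensor p) = lin_ext (\<lambda>(x, y). \<beta> x y) p"
proof -
  have "tensor_rel (rep_tensor (abs_tensor p)) p"
    by (meson Quotient_rep_abs Quotient_tensor tensor.abs_eq_iff equivp_reflp tensor_equivp)
  then have "rep_tensor (abs_tensor p) - p \<in> tensor_null" by (simp add: tensor_rel_def)
  then have "lin_ext (\<lambda>(x, y). \<beta> x y) (rep_tensor (abs_tensor p) - p) = 0"
    unfolding tensor_null_def
    by (rule lin_ext_vanish) (use assms in \<open>auto simp: bilinearC_def lin_ext_diff lin_ext_scaleC\<close>)
  then show ?thesis by (simp add: tensor_lift_def lin_ext_diff)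
qed

lemma tensor_lift_tens: "bilinearC \<beta> \<Longrightarrow> tensor_lift \<beta> (x \<otimes> y) = \<beta> x y"
  by (simp add: tens.abs_eq tensor_lift_abs)

lemma tensor_lift_add: "bilinearC \<beta> \<Longrightarrow> tensor_lift \<beta> (X + Y) = tensor_lift \<beta> X + tensor_lift \<beta> Y"
  by (induct X rule: tensor.abs_induct, induct Y rule: tensor.abs_induct)
     (simp add: plus_tensor.abs_eq tensor_lift_abs lin_ext_add)

lemma tensor_lift_scaleC: "bilinearC \<beta> \<Longrightarrow> tensor_lift \<beta> (c *\<^sub>C X) = c *\<^sub>C tensor_lift \<beta> X"
  by (induct X rule: tensor.abs_induct) (simp add: scaleC_tensor.abs_eq tensor_lift_abs lin_ext_scaleC)

lemma tensor_lift_zero: "bilinearC \<beta> \<Longrightarrow> tensor_lift \<beta> 0 = 0"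
  using tensor_lift_scaleC[of \<beta> 0 0] by simp

lemma tensor_induct [case_names zero tens add scale]:
  assumes "P 0" "\<And>x y. P (x \<otimes> y)" "\<And>X Y. P X \<Longrightarrow> P Y \<Longrightarrow> P (X + Y)" "\<And>c X. P X \<Longrightarrow> P (c *\<^sub>C X)"
  shows "P X"
proof (induct X rule: tensor.abs_induct)
  case (1 p)
  show ?case
  proof (induction p rule: free_induct)
    case zero then show ?case using assms(1) by (simp add: zero_tensor_def)
  next
    case (gen k) then show ?case using assms(2)[of "fst k" "snd k"] by (simp add: tens.abs_eq)
  next
    case (add p p') then show ?case using assms(3) by (simp flip: plus_tensor.abs_eq)
  next
    case (scale c p) then show ?case using assms(4) by (simp flip: scaleC_tensor.abs_eq)
  qed
qed

lemma abs_tensor_eqI: "p - p' \<in> tensor_null \<Longrightarrow> abs_tensor p = abs_tensor p'"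
  by (simp add: tensor.abs_eq_iff tensor_rel_def)

lemma bilinearC_tens: "bilinearC (\<otimes>)"
  unfolding bilinearC_def tens.abs_eq plus_tensor.abs_eq scaleC_tensor.abs_eq
  by (intro conjI allI; rule abs_tensor_eqI; unfold tensor_null_def; rule cvec.span_base)
     (simp only: diff_diff_eq[symmetric] Un_iff mem_Collect_eq; blast)+

lemma
  fixes x x' :: "'a::complex_vector" and y y' :: "'b::complex_vector"
  shows tens_add_left: "(x + x') \<otimes> y = x \<otimes> y + x' \<otimes> y"
  and tens_add_right: "x \<otimes> (y + y') = x \<otimes> y + x \<otimes> y'"
  and tens_scaleC_left: "(c *\<^sub>C x) \<otimes> y = c *\<^sub>C (x \<otimes> y)"
  and tens_scaleC_right: "x \<otimes> (c *\<^sub>C y) = c *\<^sub>C (x \<otimes> y)"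
  using bilinearC_tens[where 'a = 'a and 'b = 'b] by (auto simp: bilinearC_def)

lemma tens_zero_left: "0 \<otimes> y = 0" and tens_zero_right: "x \<otimes> 0 = 0"
  using tens_scaleC_left[of 0 0 y] tens_scaleC_right[of x 0 0] by simp_all

text \<open>Left multiplication by \<open>x \<otimes> y\<close>, that is \<open>z \<otimes> w \<mapsto> (x * z) \<otimes> (y * w)\<close>.\<close>

definition tens_mult :: "'a::complex_algebra_1 \<Rightarrow> 'b::complex_algebra_1 \<Rightarrow> ('a, 'b) tensor \<Rightarrow> ('a, 'b) tensor" where
  "tens_mult x y = tensor_lift (\<lambda>z w. (x * z) \<otimes> (y * w))"

lemma bilinearC_tens_mult_inner:
  "bilinearC (\<lambda>z w. ((x::'a::complex_algebra_1) * z) \<otimes> ((y::'b::complex_algebra_1) * w))"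
  by (auto simp: bilinearC_def distrib_left mult_scaleC_right tens_add_left tens_add_right
      tens_scaleC_left tens_scaleC_right)

lemma tens_mult_simps:
  "tens_mult x y (z \<otimes> w) = (x * z) \<otimes> (y * w)"
  "tens_mult x y (X + Y) = tens_mult x y X + tens_mult x y Y"
  "tens_mult x y (c *\<^sub>C X) = c *\<^sub>C tens_mult x y X"
  "tens_mult x y 0 = 0"
  by (simp_all add: tens_mult_def bilinearC_tens_mult_inner tensor_lift_zero tensor_lift_tens
      tensor_lift_add tensor_lift_scaleC)

lemma bilinearC_tens_mult: "bilinearC (\<lambda>x y. tens_mult x y Y)"
  by (induction Y rule: tensor_induct)
     (auto simp: bilinearC_def tens_mult_simps distrib_right mult_scaleC_left tens_add_left
      tens_add_right tens_scaleC_left tens_scaleC_right scaleC_add_right scaleC_scaleC mult.commute add_ac)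

lemma exists_functional:
  fixes x :: "'a::complex_vector"
  assumes "x \<noteq> 0"
  obtains \<phi> :: "'a \<Rightarrow> complex" where "Vector_Spaces.linear scaleC scaleC \<phi>" "\<phi> x = 1"
proof -
  interpret vector_space_pair "scaleC :: complex \<Rightarrow> 'a \<Rightarrow> 'a" "scaleC :: complex \<Rightarrow> complex \<Rightarrow> complex" ..
  have "cvec.independent {x}" using assms by simp
  from linear_independent_extend[OF this, of "\<lambda>_. 1"] that show ?thesis by auto
qed

instantiation tensor :: (complex_algebra_1, complex_algebra_1) complex_algebra_1
begin

definition one_tensor :: "('a, 'b) tensor" where "one_tensor = 1 \<otimes> 1"

definition times_tensor :: "('a, 'b) tensor \<Rightarrow> ('a, 'b) tensor \<Rightarrow> ('a, 'b) tensor" where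
  "times_tensor X Y = tensor_lift (\<lambda>x y. tens_mult x y Y) X"

instance
proof
  fix X Y Z :: "('a, 'b) tensor" and c :: complex
  note b = bilinearC_tens_mult
  show dr: "(X + Y) * Z = X * Z + Y * Z" for X Y Z :: "('a, 'b) tensor"
    by (simp add: times_tensor_def tensor_lift_add b)
  show sl: "(c *\<^sub>C X) * Y = c *\<^sub>C (X * Y)" for c and X Y :: "('a, 'b) tensor"
    by (simp add: times_tensor_def tensor_lift_scaleC b)
  have zl: "0 * Y = 0" for Y :: "('a, 'b) tensor"
    by (simp add: times_tensor_def tensor_lift_zero b)
  have t1: "(x \<otimes> y) * Y = tens_mult x y Y" for x :: 'a and y :: 'b and Y
    by (simp add: times_tensor_def tensor_lift_tens b)
  have tt: "(x \<otimes> y) * (z \<otimes> w) = (x * z) \<otimes> (y * w)" for x z :: 'a and y w :: 'b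
    by (simp add: t1 tens_mult_simps)
  have zr: "X * 0 = 0" for X :: "('a, 'b) tensor"
    by (induction X rule: tensor_induct) (auto simp: zl t1 dr sl tens_mult_simps)
  show dl: "X * (Y + Z) = X * Y + X * Z" for X Y Z :: "('a, 'b) tensor"
    by (induction X rule: tensor_induct)
       (auto simp: zl t1 dr sl tens_mult_simps scaleC_add_right add_ac)
  show sr: "X * (c *\<^sub>C Y) = c *\<^sub>C (X * Y)" for c and X Y :: "('a, 'b) tensor"
    by (induction X rule: tensor_induct)
       (auto simp: zl t1 dr sl tens_mult_simps scaleC_add_right scaleC_scaleC mult.commute)
  have 1: "(x \<otimes> y) * (z \<otimes> w) * Z = (x \<otimes> y) * ((z \<otimes> w) * Z)" for x z :: 'a and y w :: 'b and Z
    by (induction Z rule: tensor_induct) (auto simp: zr tt dl sr mult.assoc)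
  have 2: "(x \<otimes> y) * Y * Z = (x \<otimes> y) * (Y * Z)" for x :: 'a and y :: 'b and Y Z
    by (induction Y rule: tensor_induct) (auto simp: zl zr 1 dl dr sr sl)
  show "X * Y * Z = X * (Y * Z)"
    by (induction X rule: tensor_induct) (auto simp: zl 2 dr sl)
  show "1 * X = X"
    by (induction X rule: tensor_induct) (auto simp: one_tensor_def zr tt dl sr)
  show "X * 1 = X"
    by (induction X rule: tensor_induct) (auto simp: one_tensor_def zl tt dr sl)
  show "(0 :: ('a, 'b) tensor) \<noteq> 1"
  proof
    assume 0: "(0 :: ('a, 'b) tensor) = 1"
    obtain \<phi> :: "'a \<Rightarrow> complex" where \<phi>: "Vector_Spaces.linear scaleC scaleC \<phi>" "\<phi> 1 = 1"
      using exists_functional[of "1 :: 'a"] by auto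
    obtain \<psi> :: "'b \<Rightarrow> complex" where \<psi>: "Vector_Spaces.linear scaleC scaleC \<psi>" "\<psi> 1 = 1"
      using exists_functional[of "1 :: 'b"] by auto
    interpret \<phi>: Vector_Spaces.linear scaleC scaleC \<phi> by fact
    interpret \<psi>: Vector_Spaces.linear scaleC scaleC \<psi> by fact
    have bil: "bilinearC (\<lambda>x y. \<phi> x * \<psi> y)"
      by (auto simp: bilinearC_def \<phi>.add \<psi>.add \<phi>.scale \<psi>.scale scaleC_complex_def algebra_simps)
    have "tensor_lift (\<lambda>x y. \<phi> x * \<psi> y) (1 \<otimes> 1) = 1"
      using tensor_lift_tens[OF bil, of 1 1] \<phi> \<psi> by simp
    moreover have "tensor_lift (\<lambda>x y. \<phi> x * \<psi> y) 0 = 0" by (rule tensor_lift_zero[OF bil])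
    ultimately show False using 0 by (simp add: one_tensor_def)
  qed
qed

end

section \<open>Universal enveloping algebras\<close>

text \<open>Words under concatenation, so that \<open>'a list \<Rightarrow>\<^sub>0 complex\<close> is the free associative unital
  algebra on the set \<open>'a\<close>.\<close>

instantiation list :: (type) monoid_add
begin
definition zero_list :: "'a list" where "zero_list = []"
definition plus_list :: "'a list \<Rightarrow> 'a list \<Rightarrow> 'a list" where "plus_list = (@)"
instance by standard (auto simp: zero_list_def plus_list_def)
end

lemma scaleC_conv_mult:
  fixes p :: "'k::monoid_add \<Rightarrow>\<^sub>0 complex"
  shows "c *\<^sub>C p = Poly_Mapping.single 0 c * p"
proof -
  have "c *\<^sub>C p = Poly_Mapping.map ((*) c) p"
    by transfer (auto simp: fun_eq_iff scaleC_complex_def when_def)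
  then show ?thesis by (simp add: mult_map_scale_conv_mult)
qed

lemma gen_mult: "gen u * gen v = gen (u + v)"
  by (simp add: mult_single)

lemma free_mult_scaleC_left:
  fixes p s :: "'k::monoid_add \<Rightarrow>\<^sub>0 complex"
  shows "(c *\<^sub>C p) * s = c *\<^sub>C (p * s)"
  by (simp add: scaleC_conv_mult mult.assoc)

lemma free_mult_scaleC_right:
  fixes p s :: "'k::monoid_add \<Rightarrow>\<^sub>0 complex"
  shows "p * (c *\<^sub>C s) = c *\<^sub>C (p * s)"
proof -
  have "p * Poly_Mapping.single 0 c = Poly_Mapping.single 0 c * p"
    by (induction p rule: free_induct)
       (simp_all add: distrib_left distrib_right mult_single scaleC_conv_mult mult.assoc,
        simp add: mult.assoc[symmetric] mult_single mult.commute)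
  then show ?thesis by (simp add: scaleC_conv_mult mult.assoc[symmetric])
qed

text \<open>The first two families of relators turn the free algebra on the underlying set of a Lie
  algebra into its tensor algebra.\<close>

definition uea_relators :: "('l::complex_lie_algebra list \<Rightarrow>\<^sub>0 complex) set" where
  "uea_relators =
     {gen [x + y] - gen [x] - gen [y] | x y. True} \<union>
     {gen [c *\<^sub>C x] - c *\<^sub>C gen [x] | c x. True} \<union>
     {gen [x] * gen [y] - gen [y] * gen [x] - gen [lie x y] | x y. True}"

text \<open>The two-sided ideal generated by the relators.\<close>

definition uea_null :: "('l::complex_lie_algebra list \<Rightarrow>\<^sub>0 complex) set" where
  "uea_null = cvec.span {p * r * p' | p r p'. r \<in> uea_relators}"

definition uea_rel :: "('l::complex_lie_algebra list \<Rightarrow>\<^sub>0 complex) \<Rightarrow> ('l list \<Rightarrow>\<^sub>0 complex) \<Rightarrow> bool"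
  where "uea_rel p p' \<longleftrightarrow> p - p' \<in> uea_null"

quotient_type (overloaded) 'l uea = "'l::complex_lie_algebra list \<Rightarrow>\<^sub>0 complex" / uea_rel
  unfolding uea_rel_def uea_null_def by (rule quotient_equivp)

lemma uea_null_mult:
  assumes "p \<in> uea_null"
  shows "p * s \<in> uea_null" "s * p \<in> uea_null"
proof -
  let ?G = "{p * r * p' | p r p'. r \<in> uea_relators}"
  have base: "g * s \<in> ?G \<and> s * g \<in> ?G" if "g \<in> ?G" for g
    using that by (auto simp: mult.assoc) (metis mult.assoc)+
  have "p * s \<in> cvec.span ?G \<and> s * p \<in> cvec.span ?G"
    using assms unfolding uea_null_def
  proof (induction rule: cvec.span_induct_alt)
    case base
    then show ?case by (simp add: cvec.span_zero)
  next
    case (step c x y)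
    have "x * s \<in> cvec.span ?G" "s * x \<in> cvec.span ?G"
      using base[OF step.hyps] by (auto intro: cvec.span_base simp del: mem_Collect_eq)
    then show ?case
      using step.IH unfolding distrib_left distrib_right free_mult_scaleC_left free_mult_scaleC_right
      by (intro conjI cvec.span_add cvec.span_scale) auto
  qed
  then show "p * s \<in> uea_null" "s * p \<in> uea_null" by (auto simp: uea_null_def)
qed

lemma uea_null_add: "p \<in> uea_null \<Longrightarrow> p' \<in> uea_null \<Longrightarrow> p + p' \<in> uea_null"
  unfolding uea_null_def by (rule cvec.span_add)

lemma lookup_mult_Nil:
  fixes p s :: "'a list \<Rightarrow>\<^sub>0 complex"
  shows "Poly_Mapping.lookup (p * s) [] = Poly_Mapping.lookup p [] * Poly_Mapping.lookup s []"
proof (induction p rule: free_induct)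
  case (gen u)
  show ?case
    by (induction s rule: free_induct)
       (auto simp: gen_mult lookup_single when_def plus_list_def distrib_left lookup_add
         free_mult_scaleC_right scaleC_complex_def)
qed (auto simp: distrib_right lookup_add free_mult_scaleC_left scaleC_complex_def)

lemma uea_null_Nil:
  assumes "p \<in> uea_null"
  shows "Poly_Mapping.lookup p [] = 0"
  using assms unfolding uea_null_def
  by (induction rule: cvec.span_induct_alt)
     (auto simp: uea_relators_def lookup_add lookup_mult_Nil lookup_minus lookup_single when_def scaleC_complex_def)

instantiation uea :: (complex_lie_algebra) complex_algebra_1
begin

lift_definition zero_uea :: "'a uea" is 0 .
lift_definition one_uea :: "'a uea" is 1 .

lift_definition plus_uea :: "'a uea \<Rightarrow> 'a uea \<Rightarrow> 'a uea" is "(+)"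
  unfolding uea_rel_def uea_null_def by (rule quotient_add)

lift_definition minus_uea :: "'a uea \<Rightarrow> 'a uea \<Rightarrow> 'a uea" is "(-)"
  unfolding uea_rel_def uea_null_def by (rule quotient_diff)

lift_definition uminus_uea :: "'a uea \<Rightarrow> 'a uea" is uminus
  unfolding uea_rel_def uea_null_def by (rule quotient_uminus)

lift_definition scaleC_uea :: "complex \<Rightarrow> 'a uea \<Rightarrow> 'a uea" is scaleC
  unfolding uea_rel_def uea_null_def by (rule quotient_scaleC)

lift_definition times_uea :: "'a uea \<Rightarrow> 'a uea \<Rightarrow> 'a uea" is "(*)"
proof -
  fix p p' s s' :: "'a list \<Rightarrow>\<^sub>0 complex"
  assume "uea_rel p p'" "uea_rel s s'"
  then have "(p - p') * s + p' * (s - s') \<in> uea_null"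
    unfolding uea_rel_def by (intro uea_null_add uea_null_mult)
  then show "uea_rel (p * s) (p' * s')" by (simp add: uea_rel_def algebra_simps)
qed

instance
proof
  show "(0 :: 'a uea) \<noteq> 1"
    by transfer (use uea_null_Nil in \<open>force simp: uea_rel_def lookup_one zero_list_def when_def\<close>)
qed (transfer; simp add: uea_rel_def uea_null_def cvec.span_zero algebra_simps
      scaleC_add_right scaleC_add_left scaleC_scaleC scaleC_one free_mult_scaleC_left
      free_mult_scaleC_right)+

end

lift_definition uea_of :: "'l::complex_lie_algebra \<Rightarrow> 'l uea" is "\<lambda>x. gen [x]" .

text \<open>The counit, that is, the unital algebra homomorphism vanishing on the Lie algebra: the
  coefficient of the empty word.\<close>

lift_definition uea_counit :: "'l::complex_lie_algebra uea \<Rightarrow> complex"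
  is "\<lambda>p. Poly_Mapping.lookup p []"
  using uea_null_Nil by (force simp: uea_rel_def lookup_minus)

lemma uea_counit_simps:
  "uea_counit (uea_of x) = 0" "uea_counit 1 = 1" "uea_counit (X * Y) = uea_counit X * uea_counit Y"
  "uea_counit (X + Y) = uea_counit X + uea_counit Y" "uea_counit (c *\<^sub>C X) = c * uea_counit X"
  by (transfer; simp add: lookup_single lookup_one zero_list_def when_def lookup_mult_Nil lookup_add
      scaleC_complex_def)+

definition uea_counit_fps :: "'l::complex_lie_algebra uea fps \<Rightarrow> complex fps" where
  "uea_counit_fps f = Abs_fps (\<lambda>n. uea_counit (f $ n))"

section \<open>Hopf algebras over \<open>\<complex>[[t]]\<close> with completed tensor products\<close>

text \<open>The action of \<open>\<complex>[[t]]\<close> on \<open>V[[t]]\<close>.\<close>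

definition fps_scale :: "complex fps \<Rightarrow> 'v::complex_vector fps \<Rightarrow> 'v fps" (infixr \<open>*\<^sub>t\<close> 75) where
  "c *\<^sub>t x = Abs_fps (\<lambda>n. \<Sum>i\<le>n. (c $ i) *\<^sub>C (x $ (n - i)))"

text \<open>The completed tensor product of \<open>V[[t]]\<close> and \<open>W[[t]]\<close> over \<open>\<complex>[[t]]\<close> is
  \<open>(V \<otimes> W)[[t]]\<close>, with the following elementary tensors.\<close>

definition fps_tens :: "'a::complex_vector fps \<Rightarrow> 'b::complex_vector fps \<Rightarrow> ('a, 'b) tensor fps"
    (infixr \<open>\<otimes>\<^sub>t\<close> 72) where
  "x \<otimes>\<^sub>t y = Abs_fps (\<lambda>n. \<Sum>i\<le>n. (x $ i) \<otimes> (y $ (n - i)))"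

text \<open>For \<open>\<complex>[[t]]\<close>-bilinear \<open>\<beta>\<close>, the \<open>\<complex>[[t]]\<close>-linear map sending \<open>x \<otimes>\<^sub>t y\<close> to \<open>\<beta> x y\<close>.\<close>

definition fps_tensor_lift :: "('a::complex_vector fps \<Rightarrow> 'b::complex_vector fps \<Rightarrow> 'c::complex_vector fps)
    \<Rightarrow> ('a, 'b) tensor fps \<Rightarrow> 'c fps" where
  "fps_tensor_lift \<beta> X =
     Abs_fps (\<lambda>N. \<Sum>n\<le>N. tensor_lift (\<lambda>a b. \<beta> (fps_const a) (fps_const b)) (X $ n) $ (N - n))"

definition fps_linear :: "('a::complex_vector fps \<Rightarrow> 'b::complex_vector fps) \<Rightarrow> bool" where
  "fps_linear \<phi> \<longleftrightarrow> (\<forall>x y. \<phi> (x + y) = \<phi> x + \<phi> y) \<and> (\<forall>c x. \<phi> (c *\<^sub>t x) = c *\<^sub>t \<phi> x)"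

lemma fps_const_scale: "fps_const c *\<^sub>t x = c *\<^sub>C x"
proof (rule fps_ext)
  fix n
  have "(fps_const c *\<^sub>t x) $ n = (\<Sum>i\<le>n. if i = 0 then c *\<^sub>C (x $ n) else 0)"
    unfolding fps_scale_def fps_nth_Abs_fps by (rule sum.cong) auto
  then show "(fps_const c *\<^sub>t x) $ n = (c *\<^sub>C x) $ n" by (simp add: scaleC_fps_def)
qed

lemma fps_const_scaleC: "fps_const (c *\<^sub>C a) = fps_const c *\<^sub>t fps_const a"
  by (simp add: fps_const_scale) (simp add: scaleC_fps_def fps_eq_iff)

lemma fps_X_scale_nth:
  "((fps_X :: complex fps) *\<^sub>t x) $ 0 = 0"
  "((fps_X :: complex fps) *\<^sub>t x) $ Suc n = x $ n"
proof -
  have "(\<Sum>i\<le>Suc n. (fps_X $ i) *\<^sub>C (x $ (Suc n - i))) = (\<Sum>i\<le>Suc n. if i = 1 then x $ n else 0)"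
    by (intro sum.cong) (auto simp: scaleC_one)
  then show "((fps_X :: complex fps) *\<^sub>t x) $ Suc n = x $ n" by (simp add: fps_scale_def)
qed (simp add: fps_scale_def)

lemma fps_linear_nth:
  assumes "fps_linear \<phi>"
  shows "\<phi> x $ N = (\<Sum>i\<le>N. \<phi> (fps_const (x $ i)) $ (N - i))"
proof (induction N arbitrary: x)
  have split: "x = fps_const (x $ 0) + fps_X *\<^sub>t fps_shift 1 x" for x :: "'a fps"
  proof (rule fps_ext)
    fix n show "x $ n = (fps_const (x $ 0) + fps_X *\<^sub>t fps_shift 1 x) $ n"
      by (cases n) (auto simp: fps_X_scale_nth)
  qed
  have *: "\<phi> x = \<phi> (fps_const (x $ 0)) + fps_X *\<^sub>t \<phi> (fps_shift 1 x)" for x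
    using assms split[of x] unfolding fps_linear_def by metis
  case 0
  then show ?case by (subst *) (simp add: fps_X_scale_nth)
  case (Suc N)
  show ?case
    by (subst *) (simp add: fps_X_scale_nth Suc sum.atMost_Suc_shift del: sum.atMost_Suc)
qed

lemma fps_tensor_lift_tens:
  assumes "\<And>y. fps_linear (\<lambda>x. \<beta> x y)" "\<And>x. fps_linear (\<lambda>y. \<beta> x y)"
  shows "fps_tensor_lift \<beta> (x \<otimes>\<^sub>t y) = \<beta> x y"
proof (rule fps_ext)
  fix N
  let ?B = "\<lambda>a b. \<beta> (fps_const a) (fps_const b)"
  have bil: "bilinearC ?B"
    using assms unfolding bilinearC_def fps_linear_def
    by (simp add: fps_const_scaleC flip: fps_const_add) (simp add: fps_const_scale)
  have sum: "tensor_lift ?B (\<Sum>i\<in>A. X i) = (\<Sum>i\<in>A. tensor_lift ?B (X i))" for A :: "nat set" and X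
    by (induction A rule: infinite_finite_induct) (auto simp: tensor_lift_zero[OF bil] tensor_lift_add[OF bil])
  let ?g = "\<lambda>i j. ?B (x $ i) (y $ j) $ (N - (i + j))"
  have "fps_tensor_lift \<beta> (x \<otimes>\<^sub>t y) $ N = (\<Sum>n\<le>N. \<Sum>i\<le>n. ?g i (n - i))"
    by (simp add: fps_tensor_lift_def fps_tens_def sum tensor_lift_tens[OF bil] fps_sum_nth)
  also have "\<dots> = (\<Sum>(i, j)\<in>{(i, j). i + j \<le> N}. ?g i j)"
    by (rule sum.triangle_reindex_eq[symmetric])
  also have "{(i, j). i + j \<le> N} = Sigma {..N} (\<lambda>i. {..N - i})" by auto
  also have "(\<Sum>(i, j)\<in>\<dots>. ?g i j) = (\<Sum>i\<le>N. \<Sum>j\<le>N - i. ?g i j)"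
    by (rule sum.Sigma[symmetric]) auto
  also have "\<dots> = (\<Sum>i\<le>N. \<beta> (fps_const (x $ i)) y $ (N - i))"
    by (rule sum.cong) (auto simp: fps_linear_nth[OF assms(2), of _ y])
  also have "\<dots> = \<beta> x y $ N" by (rule fps_linear_nth[OF assms(1), symmetric])
  finally show "fps_tensor_lift \<beta> (x \<otimes>\<^sub>t y) $ N = \<beta> x y $ N" .
qed

lemma fps_tensor_lift_add:
  assumes "\<And>y. fps_linear (\<lambda>x. \<beta> x y)" "\<And>x. fps_linear (\<lambda>y. \<beta> x y)"
  shows "fps_tensor_lift \<beta> (X + Y) = fps_tensor_lift \<beta> X + fps_tensor_lift \<beta> Y"
proof -
  have "bilinearC (\<lambda>a b. \<beta> (fps_const a) (fps_const b))"
    using assms unfolding bilinearC_def fps_linear_def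
    by (simp add: fps_const_scaleC flip: fps_const_add) (simp add: fps_const_scale)
  then show ?thesis
    by (simp add: fps_eq_iff fps_tensor_lift_def tensor_lift_add sum.distrib)
qed

definition fps_tensor_map ::
  "('a::complex_vector fps \<Rightarrow> 'c::complex_vector fps) \<Rightarrow> ('b::complex_vector fps \<Rightarrow> 'd::complex_vector fps)
    \<Rightarrow> ('a, 'b) tensor fps \<Rightarrow> ('c, 'd) tensor fps" where
  "fps_tensor_map \<phi> \<psi> = fps_tensor_lift (\<lambda>x y. \<phi> x \<otimes>\<^sub>t \<psi> y)"

definition fps_tensor_assoc ::
  "(('a::complex_vector, 'b::complex_vector) tensor, 'c::complex_vector) tensor fps
    \<Rightarrow> ('a, ('b, 'c) tensor) tensor fps" where
  "fps_tensor_assoc = fps_tensor_lift (\<lambda>X z. fps_tensor_lift (\<lambda>x y. x \<otimes>\<^sub>t (y \<otimes>\<^sub>t z)) X)"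

definition fps_tensor_flip ::
  "('a::complex_vector, 'b::complex_vector) tensor fps \<Rightarrow> ('b, 'a) tensor fps" where
  "fps_tensor_flip = fps_tensor_lift (\<lambda>x y. y \<otimes>\<^sub>t x)"

text \<open>Product and unit are those of \<open>'a fps\<close>.\<close>

locale formal_hopf_algebra =
  fixes \<Delta> :: "'a::complex_algebra_1 fps \<Rightarrow> ('a, 'a) tensor fps"
    and \<epsilon> :: "'a fps \<Rightarrow> complex fps"
    and S :: "'a fps \<Rightarrow> 'a fps"
  assumes comult_linear: "fps_linear \<Delta>"
    and comult_mult: "\<Delta> (x * y) = \<Delta> x * \<Delta> y"
    and comult_one: "\<Delta> 1 = 1"
    and counit_linear: "fps_linear \<epsilon>"
    and counit_mult: "\<epsilon> (x * y) = \<epsilon> x * \<epsilon> y"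
    and counit_one: "\<epsilon> 1 = 1"
    and antipode_linear: "fps_linear S"
    and coassoc: "fps_tensor_assoc (fps_tensor_map \<Delta> id (\<Delta> x)) = fps_tensor_map id \<Delta> (\<Delta> x)"
    and counit_left: "fps_tensor_lift (\<lambda>x y. \<epsilon> x *\<^sub>t y) (\<Delta> x) = x"
    and counit_right: "fps_tensor_lift (\<lambda>x y. \<epsilon> y *\<^sub>t x) (\<Delta> x) = x"
    and antipode_left: "fps_tensor_lift (\<lambda>x y. S x * y) (\<Delta> x) = \<epsilon> x *\<^sub>t 1"
    and antipode_right: "fps_tensor_lift (\<lambda>x y. x * S y) (\<Delta> x) = \<epsilon> x *\<^sub>t 1"

lemma fps_scale_mult_left: "(c *\<^sub>t x) * y = c *\<^sub>t (x * (y :: 'a::complex_algebra_1 fps))"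
  and fps_scale_mult_right: "x * (c *\<^sub>t y) = c *\<^sub>t (x * (y :: 'a::complex_algebra_1 fps))"
proof -
  let ?e = "Abs_fps (\<lambda>n. (c $ n) *\<^sub>C (1 :: 'a))"
  have left: "c *\<^sub>t z = ?e * z" for z :: "'a fps"
    by (simp add: fps_eq_iff fps_scale_def fps_mult_nth mult_scaleC_left atLeast0AtMost)
  have right: "z * ?e = ?e * z" for z :: "'a fps"
  proof (rule fps_ext)
    fix n
    have "(\<Sum>i\<le>n. (c $ (n - i)) *\<^sub>C (z $ i)) = (\<Sum>i\<le>n. (c $ i) *\<^sub>C (z $ (n - i)))"
      by (rule sum.reindex_bij_witness[of _ "\<lambda>i. n - i" "\<lambda>i. n - i"]) auto
    then show "(z * ?e) $ n = (?e * z) $ n"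
      by (simp add: fps_mult_nth mult_scaleC_left mult_scaleC_right atLeast0AtMost)
  qed
  show "(c *\<^sub>t x) * y = c *\<^sub>t (x * y)" by (simp only: left mult.assoc)
  show "x * (c *\<^sub>t y) = c *\<^sub>t (x * y)"
    by (simp only: left mult.assoc[symmetric]) (simp only: right)
qed

text \<open>The antipode on a skew-primitive element.  With \<open>v = (1 - E t)\<^sup>r\<close> it shows that an element
  with \<open>\<Delta> y = y \<otimes> (1 - E t)\<^sup>r + 1 \<otimes> y\<close> has \<open>S y = - y (1 - E t)\<^sup>-\<^sup>r\<close>: the exponents in \<open>\<Delta>\<close> and \<open>S\<close>
  are opposite.\<close>

lemma (in formal_hopf_algebra) antipode_skew_primitive:
  assumes "\<Delta> y = y \<otimes>\<^sub>t v + 1 \<otimes>\<^sub>t y" "\<epsilon> y = 0"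
  shows "S y * v = - y"
proof -
  have "fps_linear (\<lambda>x. S x * z)" "fps_linear (\<lambda>z. S x * z)" for x z
    using antipode_linear unfolding fps_linear_def
    by (auto simp: distrib_left distrib_right fps_scale_mult_left fps_scale_mult_right)
  note lift = fps_tensor_lift_tens[OF this] fps_tensor_lift_add[OF this]
  have one: "S 1 = 1"
  proof -
    have "(1 :: ('a, 'a) tensor fps) = 1 \<otimes>\<^sub>t 1"
      by (auto simp: fps_eq_iff fps_tens_def fps_one_def tens_zero_left tens_zero_right
          intro!: sum.neutral) (simp add: one_tensor_def)
    then have "S 1 * 1 = \<epsilon> 1 *\<^sub>t 1" using antipode_left[of 1] lift(1)[of 1 1] by (simp add: comult_one)
    then show ?thesis using fps_const_scale[of 1 "1 :: 'a fps"] by (simp add: counit_one scaleC_one)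
  qed
  have "S y * v + S 1 * y = 0 *\<^sub>t 1" using antipode_left[of y] assms by (simp add: lift)
  then show ?thesis using fps_const_scale[of 0 "1 :: 'a fps"] by (simp add: one eq_neg_iff_add_eq_0)
qed

definition noncommutative_noncocommutative ::
  "('a::complex_algebra_1 fps \<Rightarrow> ('a, 'a) tensor fps) \<Rightarrow> bool" where
  "noncommutative_noncocommutative \<Delta> \<longleftrightarrow>
     (\<exists>x y :: 'a fps. x * y \<noteq> y * x) \<and> (\<exists>x. fps_tensor_flip (\<Delta> x) \<noteq> \<Delta> x)"

section \<open>The Lie algebra\<close>

text \<open>The letter \<open>y\<close> in \<open>y\<^sub>m\<close>; the matrix units \<open>E\<^sub>1\<^sub>2\<close>, \<open>E\<^sub>2\<^sub>1\<close>, \<open>E\<^sub>1\<^sub>1\<close>, \<open>E\<^sub>2\<^sub>2\<close>.\<close>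

datatype sl2_kind = \<ee> | \<ff> | \<gg> | \<hh>

datatype sl2_index = Root sl2_kind "int \<times> int" | Cartan | Deg1 | Deg2

definition sl2_indices :: "sl2_index set" where
  "sl2_indices = {Root y m | y m. y \<in> {\<gg>, \<hh>} \<longrightarrow> m \<noteq> 0} \<union> {Cartan, Deg1, Deg2}"

locale sl2_quantum_torus =
  fixes q :: complex
    and b :: "sl2_kind \<Rightarrow> int \<times> int \<Rightarrow> 'l::complex_lie_algebra"
    and d d1 d2 :: 'l
  assumes q_nonzero: "q \<noteq> 0"
    and basis: "basis_family sl2_indices
      (\<lambda>i. case i of Root y m \<Rightarrow> b y m | Cartan \<Rightarrow> d | Deg1 \<Rightarrow> d1 | Deg2 \<Rightarrow> d2)"
    and g_zero: "b \<gg> 0 = 0"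
    and h_zero: "b \<hh> 0 = 0"
    and e_e: "lie (b \<ee> m) (b \<ee> m') = 0"
    and f_f: "lie (b \<ff> m) (b \<ff> m') = 0"
    and d_h: "lie d (b \<hh> k) = 0"
    and d_g: "lie d (b \<gg> k) = 0"
    and g_h: "lie (b \<gg> k) (b \<hh> k') = 0"
    and g_e: "k \<noteq> 0 \<Longrightarrow> lie (b \<gg> k) (b \<ee> m) = q powi (snd k * fst m) *\<^sub>C b \<ee> (k + m)"
    and h_e: "k \<noteq> 0 \<Longrightarrow> lie (b \<hh> k) (b \<ee> m) = - (q powi (fst k * snd m) *\<^sub>C b \<ee> (k + m))"
    and d_e: "lie d (b \<ee> m) = 2 *\<^sub>C b \<ee> m"
    and h_f: "k \<noteq> 0 \<Longrightarrow> lie (b \<hh> k) (b \<ff> m) = q powi (snd k * fst m) *\<^sub>C b \<ff> (k + m)"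
    and g_f: "k \<noteq> 0 \<Longrightarrow> lie (b \<gg> k) (b \<ff> m) = - (q powi (fst k * snd m) *\<^sub>C b \<ff> (k + m))"
    and d_f: "lie d (b \<ff> m) = - (2 *\<^sub>C b \<ff> m)"
    and e_f: "m + m' \<noteq> 0 \<Longrightarrow> lie (b \<ee> m) (b \<ff> m') =
      q powi (snd m * fst m') *\<^sub>C b \<gg> (m + m') - q powi (snd m' * fst m) *\<^sub>C b \<hh> (m + m')"
    and e_f_zero: "m + m' = 0 \<Longrightarrow> lie (b \<ee> m) (b \<ff> m') = q powi (snd m * fst m') *\<^sub>C d"
    and g_g: "k \<noteq> 0 \<Longrightarrow> k' \<noteq> 0 \<Longrightarrow> k + k' \<noteq> 0 \<Longrightarrow> lie (b \<gg> k) (b \<gg> k') =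
      (q powi (snd k * fst k') - q powi (snd k' * fst k)) *\<^sub>C b \<gg> (k + k')"
    and g_g_zero: "k + k' = 0 \<Longrightarrow> lie (b \<gg> k) (b \<gg> k') = 0"
    and h_h: "k \<noteq> 0 \<Longrightarrow> k' \<noteq> 0 \<Longrightarrow> k + k' \<noteq> 0 \<Longrightarrow> lie (b \<hh> k) (b \<hh> k') =
      (q powi (snd k * fst k') - q powi (snd k' * fst k)) *\<^sub>C b \<hh> (k + k')"
    and h_h_zero: "k + k' = 0 \<Longrightarrow> lie (b \<hh> k) (b \<hh> k') = 0"
    and d1_root: "lie d1 (b y m) = of_int (fst m) *\<^sub>C b y m"
    and d2_root: "lie d2 (b y m) = of_int (snd m) *\<^sub>C b y m"
    and d1_d2: "lie d1 d2 = 0"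
    and d_d1: "lie d d1 = 0"
    and d_d2: "lie d d2 = 0"

section \<open>Notation of the formulas\<close>

definition emb :: "'l::complex_lie_algebra \<Rightarrow> 'l uea fps" (\<open>\<iota>\<close>) where
  "\<iota> x = fps_const (uea_of x)"

text \<open>\<open>x\<^sub>a\<^sup><\<^sup>j\<^sup>>\<close>\<close>

fun rising :: "'a::complex_algebra_1 \<Rightarrow> complex \<Rightarrow> nat \<Rightarrow> 'a" where
  "rising x a 0 = 1"
| "rising x a (Suc j) = rising x a j * (x + (a + of_nat j) *\<^sub>C 1)"

text \<open>\<open>(1 - E t)\<^sup>a\<close>\<close>

definition one_minus_t_pow :: "'a::complex_algebra_1 \<Rightarrow> complex \<Rightarrow> 'a fps" where
  "one_minus_t_pow E a = Abs_fps (\<lambda>k. ((- 1) ^ k * (a gchoose k)) *\<^sub>C E ^ k)"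

text \<open>The \<open>t\<close>-adic sum \<open>\<Sum>\<^sub>j a\<^sub>j t\<^sup>j\<close>.\<close>

definition fps_series :: "(nat \<Rightarrow> 'a::comm_monoid_add fps) \<Rightarrow> 'a fps" where
  "fps_series a = Abs_fps (\<lambda>N. \<Sum>j\<le>N. a j $ (N - j))"

fun gamma :: "complex \<Rightarrow> int \<times> int \<Rightarrow> sl2_kind \<Rightarrow> nat \<Rightarrow> int \<times> int \<Rightarrow> complex" where
  "gamma q (n1, n2) \<hh> j (m1, m2) = (if j = 0 then 1 else 0)"
| "gamma q (n1, n2) \<gg> j (m1, m2) = (- 1) ^ j *
     (\<Prod>p=1..j. q powi (n2 * (m1 + (int p - 1) * n1)) - q powi (n1 * (m2 + (int p - 1) * n2)))"
| "gamma q (n1, n2) \<ff> j (m1, m2) = (\<Prod>p=1..j. q powi (n1 * (m2 + (int p - 1) * n2)))"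
| "gamma q (n1, n2) \<ee> j (m1, m2) = (- 1) ^ j * (\<Prod>p=1..j. q powi (n2 * (m1 + (int p - 1) * n1)))"

text \<open>Only used for \<open>\<ee>\<close>, \<open>\<gg>\<close>, \<open>\<hh>\<close>; the value at \<open>\<ff>\<close> is a dummy.\<close>

fun alpha :: "complex \<Rightarrow> int \<times> int \<Rightarrow> sl2_kind \<Rightarrow> int \<times> int \<Rightarrow> complex" where
  "alpha q (n1, n2) \<gg> (m1, m2) = q powi (m2 * n1)"
| "alpha q (n1, n2) \<hh> (m1, m2) = - (q powi (m1 * n2))"
| "alpha q (n1, n2) _ (m1, m2) = 0"

fun s_coeff :: "complex \<Rightarrow> int \<times> int \<Rightarrow> int \<times> int \<Rightarrow> complex" where
  "s_coeff q (n1, n2) (m1, m2) = q powi (n2 * m1 + n1 * m2 + n1 * n2)"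

definition nmult :: "nat \<Rightarrow> int \<times> int \<Rightarrow> int \<times> int" where
  "nmult j n = (int j * fst n, int j * snd n)"

end

theory Submission
  imports Defs
begin

text \<open>
The three structures are Drinfeld twists of the standard Hopf algebra \<open>U[[t]]\<close>, and they arise from
one construction. Let \<open>T\<close> and \<open>E\<close> be elements of any complex Lie algebra with \<open>[T, E] = E \<noteq> 0\<close>. Put
\<open>F = (1 - (1 \<otimes> E) t)\<^sup>a\<close> with \<open>a = T \<otimes> 1\<close>, expanded by the binomial series. Then \<open>\<Delta> = F \<Delta>\<^sub>0 F\<^sup>-\<^sup>1\<close> is a
coproduct with antipode \<open>S = w S\<^sub>0 w\<^sup>-\<^sup>1\<close>, where \<open>w = \<Sum> F\<^sub>1 S\<^sub>0(F\<^sub>2)\<close> if \<open>F = \<Sum> F\<^sub>1 \<otimes> F\<^sub>2\<close>. The product and the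
counit do not change.

That this is a Hopf algebra is the general twisting theorem \<open>twisted_hopf_algebra\<close>. Its hypothesis
is the cocycle identity \<open>F\<^sub>1\<^sub>2 (\<Delta>\<^sub>0 \<otimes> id) F = F\<^sub>2\<^sub>3 (id \<otimes> \<Delta>\<^sub>0) F\<close>. In the triple tensor product this is an
identity between powers of \<open>1 - E t\<close> in different slots, \<open>neg_power_cocycle\<close>; it holds because
\<open>1 - E t\<close> is group-like for the twisted coproduct, and it comes down to the Chu--Vandermonde
identity for commuting elements, \<open>divrising_add\<close>. The same identity gives the inverses of \<open>F\<close> and the exponent
laws; the inverse of \<open>w\<close>, where exponent and base do not commute, comes from
\<open>neg_power_alternating\<close>.

The explicit formulas hold for every eigenvector \<open>[T, y] = r y\<close>. The binomial theorem for
\<open>ad E\<close>, which is the difference of the commuting operators of left and right multiplication, gives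
\<open>F (1 \<otimes> y) F\<^sup>-\<^sup>1 = \<Sum>\<^sub>j (-1)\<^sup>j / j! T\<^sup><\<^sup>j\<^sup>> \<otimes> (1 - E t)\<^sup>-\<^sup>j (ad E)\<^sup>j(y) t\<^sup>j\<close>,
while \<open>F (y \<otimes> 1) F\<^sup>-\<^sup>1 = y \<otimes> (1 - E t)\<^sup>r\<close>; this is \<open>comult_formula\<close>. The analogous computation with \<open>w\<close> is
\<open>antipode_formula\<close>. Such a structure is never cocommutative, since the coefficient of \<open>t\<close>
in \<open>\<Delta> T\<close> is \<open>T \<otimes> E\<close>.

For \<open>sl\<^sub>2\<close> over the quantum torus it remains to evaluate \<open>(ad E)\<^sup>j\<close> on the basis. For \<open>E = g\<^sub>n\<close> this
produces the products \<open>\<gamma>\<close>, and for \<open>E = e\<^sub>n\<close> it stops after two steps and produces \<open>\<alpha>\<close> and \<open>s\<close>.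
\<close>

section \<open>Linear maps over \<open>\<complex>[[t]]\<close>\<close>

lemma fps_linearD:
  assumes "fps_linear \<phi>"
  shows fps_linear_add: "\<phi> (x + y) = \<phi> x + \<phi> y"
    and fps_linear_scale: "\<phi> (c *\<^sub>t x) = c *\<^sub>t \<phi> x"
    and fps_linear_scaleC: "\<phi> (a *\<^sub>C x) = a *\<^sub>C \<phi> x"
    and fps_linear_zero: "\<phi> 0 = 0"
    and fps_linear_minus: "\<phi> (- x) = - \<phi> x"
    and fps_linear_diff: "\<phi> (x - y) = \<phi> x - \<phi> y"
    and fps_linear_sum: "\<phi> (\<Sum>i\<in>I. f i) = (\<Sum>i\<in>I. \<phi> (f i))"
proof -
  show add: "\<phi> (x + y) = \<phi> x + \<phi> y" for x y using assms by (simp add: fps_linear_def)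
  show "\<phi> (c *\<^sub>t x) = c *\<^sub>t \<phi> x" for c x using assms by (simp add: fps_linear_def)
  from this[of "fps_const a" x for a x] show scale: "\<phi> (a *\<^sub>C x) = a *\<^sub>C \<phi> x" for a x
    by (simp add: fps_const_scale)
  from add[of 0 0] show zero: "\<phi> 0 = 0" by simp
  from add[of x "- x" for x] show minus: "\<phi> (- x) = - \<phi> x" for x
    by (metis add.right_inverse add_eq_0_iff zero)
  show "\<phi> (x - y) = \<phi> x - \<phi> y" by (metis add diff_conv_add_uminus minus)
  show "\<phi> (\<Sum>i\<in>I. f i) = (\<Sum>i\<in>I. \<phi> (f i))"
    by (induction I rule: infinite_finite_induct) (auto simp: zero add)
qed

text \<open>Every product of series below reduces to this exchange of the two ways to run through the pairs
\<open>(i, j)\<close> with \<open>i + j \<le> N\<close>.\<close>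

lemma fps_sum_triangle:
  fixes g :: "nat \<Rightarrow> nat \<Rightarrow> 'a::comm_monoid_add"
  shows "(\<Sum>n\<le>N. \<Sum>i\<le>n. g i (n - i)) = (\<Sum>i\<le>N. \<Sum>j\<le>N - i. g i j)"
proof -
  have "(\<Sum>n\<le>N. \<Sum>i\<le>n. g i (n - i)) = (\<Sum>(i, j)\<in>{(i, j). i + j \<le> N}. g i j)"
    by (rule sum.triangle_reindex_eq[symmetric])
  also have "{(i, j). i + j \<le> N} = Sigma {..N} (\<lambda>i. {..N - i})" by auto
  also have "(\<Sum>(i, j)\<in>\<dots>. g i j) = (\<Sum>i\<le>N. \<Sum>j\<le>N - i. g i j)"
    by (rule sum.Sigma[symmetric]) auto
  finally show ?thesis .
qed

lemma fps_scale_add_right: "c *\<^sub>t (x + y) = c *\<^sub>t x + c *\<^sub>t y"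
  by (simp add: fps_eq_iff fps_scale_def scaleC_add_right sum.distrib)

lemma fps_scale_assoc: "c *\<^sub>t (e *\<^sub>t x) = (c * e) *\<^sub>t x"
proof (rule fps_ext)
  fix n
  have "(c *\<^sub>t (e *\<^sub>t x)) $ n = (\<Sum>i\<le>n. \<Sum>j\<le>n - i. (c $ i * e $ j) *\<^sub>C (x $ (n - (i + j))))"
    by (simp add: fps_scale_def cvec.scale_sum_right scaleC_scaleC)
  also have "\<dots> = (\<Sum>k\<le>n. \<Sum>i\<le>k. (c $ i * e $ (k - i)) *\<^sub>C (x $ (n - (i + (k - i)))))"
    by (rule fps_sum_triangle[symmetric])
  also have "\<dots> = ((c * e) *\<^sub>t x) $ n"
    by (simp add: fps_scale_def fps_mult_nth cvec.scale_sum_left atLeast0AtMost)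
  finally show "(c *\<^sub>t (e *\<^sub>t x)) $ n = ((c * e) *\<^sub>t x) $ n" .
qed

lemma fps_scale_commute: "c *\<^sub>t (e *\<^sub>t x) = e *\<^sub>t (c *\<^sub>t x)"
  by (simp add: fps_scale_assoc mult.commute)

lemma fps_linear_id: "fps_linear id" "fps_linear (\<lambda>x. x)"
  by (auto simp: fps_linear_def)

lemma fps_linear_comp: "fps_linear \<phi> \<Longrightarrow> fps_linear \<psi> \<Longrightarrow> fps_linear (\<lambda>x. \<phi> (\<psi> x))"
  by (auto simp: fps_linear_def)

lemma fps_linear_fps_scale: "fps_linear \<phi> \<Longrightarrow> fps_linear (\<lambda>x. c *\<^sub>t \<phi> x)"
  by (auto simp: fps_linear_def fps_scale_add_right fps_scale_commute)

lemma fps_linear_scaleC_fun: "fps_linear (\<lambda>x. a *\<^sub>C x)"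
  using fps_linear_fps_scale[OF fps_linear_id(2), of "fps_const a"] by (simp add: fps_const_scale)

lemma fps_linear_plus: "fps_linear \<phi> \<Longrightarrow> fps_linear \<psi> \<Longrightarrow> fps_linear (\<lambda>x. \<phi> x + \<psi> x)"
  by (auto simp: fps_linear_def fps_scale_add_right add_ac)

lemma fps_linear_mult:
  fixes y :: "'a::complex_algebra_1 fps"
  assumes "fps_linear \<phi>"
  shows "fps_linear (\<lambda>x. \<phi> x * y)" and "fps_linear (\<lambda>x. y * \<phi> x)"
  using assms
  by (auto simp: fps_linear_def distrib_left distrib_right fps_scale_mult_left fps_scale_mult_right)

text \<open>A \<open>\<complex>[[t]]\<close>-linear map is automatically \<open>t\<close>-adically continuous, so it is known from its values on
constant series. Together with its analogues for tensor products and enveloping algebras this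
reduces the Hopf algebra axioms to elementary tensors and products of generators.\<close>

lemma fps_linear_eqI:
  assumes "fps_linear \<phi>" "fps_linear \<psi>" "\<And>a. \<phi> (fps_const a) = \<psi> (fps_const a)"
  shows "\<phi> x = \<psi> x"
  using assms by (auto simp: fps_eq_iff fps_linear_nth[of \<phi> x] fps_linear_nth[of \<psi> x])

text \<open>The \<open>\<complex>[[t]]\<close>-linear map on \<open>V[[t]]\<close> with prescribed values on \<open>V\<close>.\<close>

definition fps_extend :: "('a::complex_vector \<Rightarrow> 'b::complex_vector fps) \<Rightarrow> 'a fps \<Rightarrow> 'b fps" where
  "fps_extend f x = Abs_fps (\<lambda>N. \<Sum>i\<le>N. f (x $ i) $ (N - i))"

lemma fps_scaleC_nth: "(c *\<^sub>C x) $ n = c *\<^sub>C (x $ n)"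
  by (simp add: scaleC_fps_def)

locale linearC =
  fixes f :: "'a::complex_vector \<Rightarrow> 'b::complex_vector"
  assumes add: "f (x + y) = f x + f y" and scale: "f (c *\<^sub>C x) = c *\<^sub>C f x"
begin

lemma zero: "f 0 = 0"
  using scale[of 0 0] by simp

lemma sum: "f (\<Sum>i\<in>I. g i) = (\<Sum>i\<in>I. f (g i))"
  by (induction I rule: infinite_finite_induct) (auto simp: zero add)

end

lemma fps_extend_linear:
  fixes f :: "'a::complex_vector \<Rightarrow> 'b::complex_vector fps"
  assumes "linearC f"
  shows "fps_linear (fps_extend f)"
  unfolding fps_linear_def
proof (intro conjI allI)
  interpret linearC f by fact
  show "fps_extend f (x + y) = fps_extend f x + fps_extend f y" for x y
    by (simp add: fps_eq_iff fps_extend_def add sum.distrib)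
  show "fps_extend f (c *\<^sub>t x) = c *\<^sub>t fps_extend f x" for c x
  proof (rule fps_ext)
    fix N
    let ?g = "\<lambda>i k. (c $ i) *\<^sub>C (f (x $ k) $ (N - (i + k)))"
    have "fps_extend f (c *\<^sub>t x) $ N = (\<Sum>n\<le>N. \<Sum>i\<le>n. ?g i (n - i))"
      by (simp add: fps_extend_def fps_scale_def sum scale fps_sum_nth fps_scaleC_nth)
    also have "\<dots> = (\<Sum>i\<le>N. \<Sum>j\<le>N - i. ?g i j)" by (rule fps_sum_triangle)
    also have "\<dots> = (c *\<^sub>t fps_extend f x) $ N"
      by (simp add: fps_extend_def fps_scale_def cvec.scale_sum_right)
    finally show "fps_extend f (c *\<^sub>t x) $ N = (c *\<^sub>t fps_extend f x) $ N" .
  qed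
qed

lemma fps_extend_const: "linearC f \<Longrightarrow> fps_extend f (fps_const a) = f a"
proof (rule fps_ext)
  fix N
  assume "linearC f"
  then interpret linearC f .
  have "(\<Sum>i\<le>N. f (fps_const a $ i) $ (N - i)) = (\<Sum>i\<le>N. if i = 0 then f a $ N else 0)"
    by (rule sum.cong) (auto simp: zero)
  then show "fps_extend f (fps_const a) $ N = f a $ N" by (simp add: fps_extend_def)
qed

lemma fps_one_scale: "1 *\<^sub>t x = x"
  using fps_const_scale[of 1 x] by (simp add: scaleC_one)

section \<open>Completed tensor products\<close>

lemma fps_tens_linear_left:
  fixes y :: "'b::complex_vector fps"
  shows "fps_linear (\<lambda>x::'a::complex_vector fps. x \<otimes>\<^sub>t y)"
proof -
  have eq: "(\<lambda>x::'a fps. x \<otimes>\<^sub>t y) = fps_extend (\<lambda>a. Abs_fps (\<lambda>n. a \<otimes> (y $ n)))"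
    by (auto simp: fun_eq_iff fps_eq_iff fps_tens_def fps_extend_def)
  show ?thesis
    by (subst eq, rule fps_extend_linear,
        auto simp: linearC_def fps_eq_iff tens_add_left tens_scaleC_left fps_scaleC_nth)
qed

lemma fps_tens_linear_right:
  fixes x :: "'a::complex_vector fps"
  shows "fps_linear (\<lambda>y::'b::complex_vector fps. x \<otimes>\<^sub>t y)"
proof -
  have "(x \<otimes>\<^sub>t y) $ n = (\<Sum>i\<le>n. (x $ (n - i)) \<otimes> (y $ i))" for y :: "'b fps" and n
    unfolding fps_tens_def fps_nth_Abs_fps
    by (rule sum.reindex_bij_witness[of _ "\<lambda>i. n - i" "\<lambda>i. n - i"]) auto
  then have eq: "(\<lambda>y::'b fps. x \<otimes>\<^sub>t y) = fps_extend (\<lambda>a. Abs_fps (\<lambda>n. (x $ n) \<otimes> a))"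
    by (auto simp: fun_eq_iff fps_eq_iff fps_extend_def)
  show ?thesis
    by (subst eq, rule fps_extend_linear,
        auto simp: linearC_def fps_eq_iff tens_add_right tens_scaleC_right fps_scaleC_nth)
qed

lemmas fps_tens_linear = fps_linear_comp[OF fps_tens_linear_left] fps_linear_comp[OF fps_tens_linear_right]

lemmas fps_tens_left = fps_linearD[OF fps_tens_linear(1)[OF fps_linear_id(2)]]
lemmas fps_tens_right = fps_linearD[OF fps_tens_linear(2)[OF fps_linear_id(2)]]

lemma fps_tens_const: "fps_const a \<otimes>\<^sub>t fps_const c = fps_const (a \<otimes> c)"
proof (rule fps_ext)
  fix n
  have "(\<Sum>i\<le>n. (fps_const a $ i) \<otimes> (fps_const c $ (n - i))) = (\<Sum>i\<le>n. if i = 0 then a \<otimes> (fps_const c $ n) else 0)"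
    by (rule sum.cong) (auto simp: tens_zero_left)
  then show "(fps_const a \<otimes>\<^sub>t fps_const c) $ n = fps_const (a \<otimes> c) $ n"
    by (simp add: fps_tens_def tens_zero_right)
qed

lemma fps_one_eq_const: "(1 :: 'a::complex_algebra_1 fps) = fps_const 1"
  by (simp add: fps_eq_iff)

lemma fps_tens_one: "1 \<otimes>\<^sub>t 1 = 1"
  unfolding fps_one_eq_const fps_tens_const one_tensor_def ..

lemma tensor_fps_eqI:
  assumes "fps_linear \<phi>" "fps_linear \<psi>" "\<And>x y. \<phi> (x \<otimes>\<^sub>t y) = \<psi> (x \<otimes>\<^sub>t y)"
  shows "\<phi> X = \<psi> X"
proof (rule fps_linear_eqI[OF assms(1,2)])
  fix A
  have const_scale: "fps_const (c *\<^sub>C X) = c *\<^sub>C fps_const X" for c and X :: "('a, 'b) tensor"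
    by (simp add: fps_eq_iff fps_scaleC_nth)
  note \<phi> = fps_linearD[OF assms(1)] and \<psi> = fps_linearD[OF assms(2)]
  show "\<phi> (fps_const A) = \<psi> (fps_const A)"
  proof (induction A rule: tensor_induct)
    case zero
    then show ?case by (simp add: \<phi> \<psi>)
  next
    case (tens x y)
    then show ?case using assms(3)[of "fps_const x" "fps_const y"] by (simp add: fps_tens_const)
  next
    case (add X Y)
    then show ?case by (simp add: \<phi> \<psi> flip: fps_const_add)
  next
    case (scale c X)
    then show ?case by (simp add: \<phi> \<psi> const_scale)
  qed
qed

lemma fps_tens_mult:
  fixes x x' :: "'a::complex_algebra_1 fps" and y y' :: "'b::complex_algebra_1 fps"
  shows "(x \<otimes>\<^sub>t y) * (x' \<otimes>\<^sub>t y') = (x * x') \<otimes>\<^sub>t (y * y')"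
proof -
  have tt: "(a \<otimes> c) * (a' \<otimes> c') = (a * a') \<otimes> (c * c')" for a a' :: 'a and c c' :: 'b
    unfolding times_tensor_def tensor_lift_tens[OF bilinearC_tens_mult] by (rule tens_mult_simps(1))
  have 0: "(fps_const a \<otimes>\<^sub>t fps_const c) * (fps_const a' \<otimes>\<^sub>t fps_const c')
      = (fps_const a * fps_const a') \<otimes>\<^sub>t (fps_const c * fps_const c')" for a a' :: 'a and c c' :: 'b
    by (simp add: fps_tens_const tt)
  note lin = fps_linear_id fps_tens_linear fps_linear_mult
  have 1: "(fps_const a \<otimes>\<^sub>t fps_const c) * (fps_const a' \<otimes>\<^sub>t y')
      = (fps_const a * fps_const a') \<otimes>\<^sub>t (fps_const c * y')" for a a' :: 'a and c :: 'b
    by (rule fps_linear_eqI[where x = y'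
          and \<phi> = "\<lambda>u. (fps_const a \<otimes>\<^sub>t fps_const c) * (fps_const a' \<otimes>\<^sub>t u)" and \<psi> = "\<lambda>u. (fps_const a * fps_const a') \<otimes>\<^sub>t (fps_const c * u)"])
      (intro lin 0)+
  have 2: "(fps_const a \<otimes>\<^sub>t fps_const c) * (x' \<otimes>\<^sub>t y')
      = (fps_const a * x') \<otimes>\<^sub>t (fps_const c * y')" for a :: 'a and c :: 'b
    by (rule fps_linear_eqI[where x = x'
          and \<phi> = "\<lambda>u. (fps_const a \<otimes>\<^sub>t fps_const c) * (u \<otimes>\<^sub>t y')" and \<psi> = "\<lambda>u. (fps_const a * u) \<otimes>\<^sub>t (fps_const c * y')"])
      (intro lin 1)+
  have 3: "(fps_const a \<otimes>\<^sub>t y) * (x' \<otimes>\<^sub>t y') = (fps_const a * x') \<otimes>\<^sub>t (y * y')" for a :: 'a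
    by (rule fps_linear_eqI[where x = y
          and \<phi> = "\<lambda>u. (fps_const a \<otimes>\<^sub>t u) * (x' \<otimes>\<^sub>t y')" and \<psi> = "\<lambda>u. (fps_const a * x') \<otimes>\<^sub>t (u * y')"])
      (intro lin 2)+
  show ?thesis
    by (rule fps_linear_eqI[where x = x
          and \<phi> = "\<lambda>u. (u \<otimes>\<^sub>t y) * (x' \<otimes>\<^sub>t y')" and \<psi> = "\<lambda>u. (u * x') \<otimes>\<^sub>t (y * y')"])
      (intro lin 3)+
qed

text \<open>The criterion by which all the structure maps of tensor products are seen to be algebra maps.\<close>

lemma tensor_fps_mult_eqI:
  fixes \<phi> :: "('a::complex_algebra_1, 'b::complex_algebra_1) tensor fps \<Rightarrow> 'c::complex_algebra_1 fps"
  assumes "fps_linear \<phi>"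
    "\<And>x y x' y'. \<phi> ((x * x') \<otimes>\<^sub>t (y * y')) = \<phi> (x \<otimes>\<^sub>t y) * \<phi> (x' \<otimes>\<^sub>t y')"
  shows "\<phi> (X * Y) = \<phi> X * \<phi> Y"
proof -
  note lin = fps_linear_comp[OF assms(1)] fps_linear_mult fps_linear_id assms(1)
  have 1: "\<phi> ((x \<otimes>\<^sub>t y) * Y) = \<phi> (x \<otimes>\<^sub>t y) * \<phi> Y" for x y
    by (rule tensor_fps_eqI[where X = Y and \<phi> = "\<lambda>Y. \<phi> ((x \<otimes>\<^sub>t y) * Y)" and \<psi> = "\<lambda>Y. \<phi> (x \<otimes>\<^sub>t y) * \<phi> Y"])
      (intro lin, intro lin, simp add: fps_tens_mult assms(2))
  show ?thesis
    by (rule tensor_fps_eqI[where X = X and \<phi> = "\<lambda>X. \<phi> (X * Y)" and \<psi> = "\<lambda>X. \<phi> X * \<phi> Y"])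
      (intro lin 1)+
qed

definition fps_bilinear ::
  "('a::complex_vector fps \<Rightarrow> 'b::complex_vector fps \<Rightarrow> 'c::complex_vector fps) \<Rightarrow> bool" where
  "fps_bilinear \<beta> \<longleftrightarrow> (\<forall>y. fps_linear (\<lambda>x. \<beta> x y)) \<and> (\<forall>x. fps_linear (\<lambda>y. \<beta> x y))"

lemma fps_bilinear_lift:
  assumes "fps_bilinear \<beta>"
  shows fps_tensor_lift_linear: "fps_linear (fps_tensor_lift \<beta>)"
    and fps_tensor_lift_eval: "fps_tensor_lift \<beta> (x \<otimes>\<^sub>t y) = \<beta> x y"
proof -
  have l: "fps_linear (\<lambda>x. \<beta> x y)" and r: "fps_linear (\<lambda>y. \<beta> x y)" for x y
    using assms by (auto simp: fps_bilinear_def)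
  have bil: "bilinearC (\<lambda>a b. \<beta> (fps_const a) (fps_const b))"
    unfolding bilinearC_def fps_const_add[symmetric] fps_const_scaleC fps_const_scale
    using fps_linearD(1,3)[OF l] fps_linearD(1,3)[OF r] by blast
  have eq: "fps_tensor_lift \<beta> = fps_extend (tensor_lift (\<lambda>a b. \<beta> (fps_const a) (fps_const b)))"
    by (simp add: fun_eq_iff fps_tensor_lift_def fps_extend_def)
  show "fps_linear (fps_tensor_lift \<beta>)"
    by (subst eq, rule fps_extend_linear,
      simp add: linearC_def tensor_lift_add[OF bil] tensor_lift_scaleC[OF bil])
  show "fps_tensor_lift \<beta> (x \<otimes>\<^sub>t y) = \<beta> x y"
    using assms by (intro fps_tensor_lift_tens) (auto simp: fps_bilinear_def)
qed

lemma fps_bilinear_map: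
  "fps_linear \<phi> \<Longrightarrow> fps_linear \<psi> \<Longrightarrow> fps_bilinear (\<lambda>x y. \<phi> x \<otimes>\<^sub>t \<psi> y)"
  by (auto simp: fps_bilinear_def intro: fps_tens_linear)

lemma fps_bilinear_mult:
  fixes \<phi> :: "_ \<Rightarrow> 'a::complex_algebra_1 fps"
  shows "fps_linear \<phi> \<Longrightarrow> fps_linear \<psi> \<Longrightarrow> fps_bilinear (\<lambda>x y. \<phi> x * \<psi> y)"
  by (auto simp: fps_bilinear_def intro: fps_linear_mult)

lemma fps_tensor_map:
  assumes "fps_linear \<phi>" "fps_linear \<psi>"
  shows fps_tensor_map_linear: "fps_linear (fps_tensor_map \<phi> \<psi>)"
    and fps_tensor_map_tens: "fps_tensor_map \<phi> \<psi> (x \<otimes>\<^sub>t y) = \<phi> x \<otimes>\<^sub>t \<psi> y"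
  unfolding fps_tensor_map_def
  using fps_bilinear_lift[OF fps_bilinear_map[OF assms]] by auto

lemma fps_tensor_assoc_inner: "fps_bilinear (\<lambda>x y. x \<otimes>\<^sub>t (y \<otimes>\<^sub>t z))"
  by (auto simp: fps_bilinear_def intro!: fps_tens_linear fps_linear_id)

text \<open>The reassociation is a lift of a lift; linearity in the inner parameter \<open>z\<close> has to be transported
through the inner lift before the outer one can be evaluated on elementary tensors.\<close>

lemma fps_tensor_assoc_bilinear:
  "fps_bilinear (\<lambda>(X :: ('a::complex_vector, 'b::complex_vector) tensor fps) (z :: 'c::complex_vector fps). fps_tensor_lift (\<lambda>x y. x \<otimes>\<^sub>t (y \<otimes>\<^sub>t z)) X)"
proof -
  note lift = fps_bilinear_lift[OF fps_tensor_assoc_inner]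
  have add: "fps_tensor_lift (\<lambda>x y. x \<otimes>\<^sub>t (y \<otimes>\<^sub>t (z + z'))) X =
      fps_tensor_lift (\<lambda>x y. x \<otimes>\<^sub>t (y \<otimes>\<^sub>t z)) X + fps_tensor_lift (\<lambda>x y. x \<otimes>\<^sub>t (y \<otimes>\<^sub>t z')) X"
    for z z' :: "'c fps" and X :: "('a, 'b) tensor fps"
    by (rule tensor_fps_eqI[where X = X])
       (intro lift(1), intro fps_linear_plus lift(1), simp only: lift(2), simp only: fps_tens_right(1))
  have scale: "fps_tensor_lift (\<lambda>x y. x \<otimes>\<^sub>t (y \<otimes>\<^sub>t (c *\<^sub>t z))) X =
      c *\<^sub>t fps_tensor_lift (\<lambda>x y. x \<otimes>\<^sub>t (y \<otimes>\<^sub>t z)) X"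
    for c and z :: "'c fps" and X :: "('a, 'b) tensor fps"
    by (rule tensor_fps_eqI[where X = X])
       (intro lift(1), intro fps_linear_fps_scale lift(1), simp only: lift(2), simp only: fps_tens_right(2))
  have "fps_linear (\<lambda>z :: 'c fps. fps_tensor_lift (\<lambda>x y. x \<otimes>\<^sub>t (y \<otimes>\<^sub>t z)) X)" for X :: "('a, 'b) tensor fps"
    unfolding fps_linear_def by (intro conjI allI add scale)
  then show ?thesis by (simp add: fps_bilinear_def lift(1))
qed

lemma fps_tensor_assoc_linear: "fps_linear fps_tensor_assoc"
  and fps_tensor_assoc_tens: "fps_tensor_assoc ((x \<otimes>\<^sub>t y) \<otimes>\<^sub>t z) = x \<otimes>\<^sub>t (y \<otimes>\<^sub>t z)"
  unfolding fps_tensor_assoc_def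
  by (simp_all add: fps_bilinear_lift[OF fps_tensor_assoc_bilinear]
      fps_tensor_lift_eval[OF fps_tensor_assoc_inner])

lemma fps_tensor_map_mult:
  fixes \<phi> :: "'a::complex_algebra_1 fps \<Rightarrow> 'b::complex_algebra_1 fps"
    and \<psi> :: "'c::complex_algebra_1 fps \<Rightarrow> 'd::complex_algebra_1 fps"
  assumes "fps_linear \<phi>" "fps_linear \<psi>" "\<And>x y. \<phi> (x * y) = \<phi> x * \<phi> y" "\<And>x y. \<psi> (x * y) = \<psi> x * \<psi> y"
  shows "fps_tensor_map \<phi> \<psi> (X * Y) = fps_tensor_map \<phi> \<psi> X * fps_tensor_map \<phi> \<psi> Y"
  by (rule tensor_fps_mult_eqI)
     (simp_all add: fps_tensor_map_linear fps_tensor_map_tens assms fps_tens_mult)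

lemma fps_tensor_assoc_mult:
  fixes X Y :: "(('a::complex_algebra_1, 'b::complex_algebra_1) tensor, 'c::complex_algebra_1) tensor fps"
  shows "fps_tensor_assoc (X * Y) = fps_tensor_assoc X * fps_tensor_assoc Y"
proof (rule tensor_fps_mult_eqI[OF fps_tensor_assoc_linear])
  fix A A' :: "('a, 'b) tensor fps" and z z' :: "'c fps"
  have eq: "fps_tensor_assoc (A \<otimes>\<^sub>t z) = fps_tensor_lift (\<lambda>x y. x \<otimes>\<^sub>t (y \<otimes>\<^sub>t z)) A" for A :: "('a, 'b) tensor fps" and z :: "'c fps"
    by (simp add: fps_tensor_assoc_def fps_bilinear_lift[OF fps_tensor_assoc_bilinear])
  note lin = fps_linear_comp[OF fps_tensor_assoc_linear] fps_tens_linear fps_linear_mult fps_linear_id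
  have 1: "fps_tensor_assoc (((x \<otimes>\<^sub>t y) * A') \<otimes>\<^sub>t (z * z'))
      = fps_tensor_assoc ((x \<otimes>\<^sub>t y) \<otimes>\<^sub>t z) * fps_tensor_assoc (A' \<otimes>\<^sub>t z')" for x y
    by (rule tensor_fps_eqI[where X = A' and \<phi> = "\<lambda>A'. fps_tensor_assoc (((x \<otimes>\<^sub>t y) * A') \<otimes>\<^sub>t (z * z'))"
          and \<psi> = "\<lambda>A'. fps_tensor_assoc ((x \<otimes>\<^sub>t y) \<otimes>\<^sub>t z) * fps_tensor_assoc (A' \<otimes>\<^sub>t z')"])
       (intro lin, intro lin, simp add: fps_tensor_assoc_tens fps_tens_mult)
  show "fps_tensor_assoc ((A * A') \<otimes>\<^sub>t (z * z')) = fps_tensor_assoc (A \<otimes>\<^sub>t z) * fps_tensor_assoc (A' \<otimes>\<^sub>t z')"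
    by (rule tensor_fps_eqI[where X = A and \<phi> = "\<lambda>A. fps_tensor_assoc ((A * A') \<otimes>\<^sub>t (z * z'))"
          and \<psi> = "\<lambda>A. fps_tensor_assoc (A \<otimes>\<^sub>t z) * fps_tensor_assoc (A' \<otimes>\<^sub>t z')"])
      (intro lin 1)+
qed

section \<open>Sums in the \<open>t\<close>-adic topology\<close>

text \<open>The defining series of the twist, of \<open>(1 - E t)\<^sup>a\<close> and of the stated formulas are all of the shape
\<open>fps_series\<close>; this continuity statement moves algebra maps, tensor factors and products inside.\<close>

lemma fps_linear_series:
  assumes "fps_linear \<phi>"
  shows "\<phi> (fps_series a) = fps_series (\<lambda>j. \<phi> (a j))"
proof (rule fps_ext)
  fix N
  have const_sum: "fps_const (\<Sum>j\<in>J. c j) = (\<Sum>j\<in>J. fps_const (c j))" for J :: "nat set" and c :: "nat \<Rightarrow> 'a"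
    by (induction J rule: infinite_finite_induct) (auto simp flip: fps_const_add)
  let ?g = "\<lambda>j k. \<phi> (fps_const (a j $ k)) $ (N - (j + k))"
  have "\<phi> (fps_series a) $ N = (\<Sum>i\<le>N. \<Sum>j\<le>i. ?g j (i - j))"
    by (subst fps_linear_nth[OF assms])
       (simp add: fps_series_def const_sum fps_linearD[OF assms] fps_sum_nth)
  also have "\<dots> = (\<Sum>j\<le>N. \<Sum>k\<le>N - j. ?g j k)" by (rule fps_sum_triangle)
  also have "\<dots> = fps_series (\<lambda>j. \<phi> (a j)) $ N"
    by (simp add: fps_series_def fps_linear_nth[OF assms, of "a _"])
  finally show "\<phi> (fps_series a) $ N = fps_series (\<lambda>j. \<phi> (a j)) $ N" .
qed

lemma fps_series_series:
  "fps_series (\<lambda>i. fps_series (c i)) = fps_series (\<lambda>n. \<Sum>i\<le>n. c i (n - i))"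
proof (rule fps_ext)
  fix N
  have "fps_series (\<lambda>i. fps_series (c i)) $ N = (\<Sum>i\<le>N. \<Sum>j\<le>N - i. c i j $ (N - (i + j)))"
    by (simp add: fps_series_def)
  also have "\<dots> = (\<Sum>n\<le>N. \<Sum>i\<le>n. c i (n - i) $ (N - (i + (n - i))))"
    by (rule fps_sum_triangle[symmetric])
  also have "\<dots> = fps_series (\<lambda>n. \<Sum>i\<le>n. c i (n - i)) $ N"
    by (simp add: fps_series_def fps_sum_nth)
  finally show "fps_series (\<lambda>i. fps_series (c i)) $ N = fps_series (\<lambda>n. \<Sum>i\<le>n. c i (n - i)) $ N" .
qed

lemma fps_series_mult_right: "fps_series a * y = fps_series (\<lambda>j. a j * y)"
  and fps_series_mult_left: "y * fps_series a = fps_series (\<lambda>j. y * a j)"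
  for y :: "'a::complex_algebra_1 fps"
  using fps_linear_series[OF fps_linear_mult(1)[OF fps_linear_id(2)]]
    fps_linear_series[OF fps_linear_mult(2)[OF fps_linear_id(2)]] by auto

lemma fps_series_mult:
  fixes a c :: "nat \<Rightarrow> 'a::complex_algebra_1 fps"
  shows "fps_series a * fps_series c = fps_series (\<lambda>n. \<Sum>i\<le>n. a i * c (n - i))"
  unfolding fps_series_mult_right unfolding fps_series_mult_left fps_series_series ..

lemma fps_series_nth_mult_X: "(a * fps_X ^ k) $ N = (if N < k then 0 else a $ (N - k))"
  for a :: "'a::ring_1 fps"
proof (induction k arbitrary: N)
  case (Suc k)
  have "a * fps_X ^ Suc k = a * fps_X ^ k * fps_X" by (simp add: mult.assoc power_commutes)
  then show ?case using Suc by (cases N) (auto simp del: power_Suc)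
qed auto

lemma fps_series_finite:
  fixes a :: "nat \<Rightarrow> 'a::ring_1 fps"
  assumes "\<And>j. j > n \<Longrightarrow> a j = 0"
  shows "fps_series a = (\<Sum>j\<le>n. a j * fps_X ^ j)"
proof (rule fps_ext)
  fix N
  let ?h = "\<lambda>j. if N < j then 0 else a j $ (N - j)"
  have "(\<Sum>j\<le>N. a j $ (N - j)) = (\<Sum>j\<le>max N n. ?h j)"
    by (rule sum.mono_neutral_cong_left) auto
  also have "\<dots> = (\<Sum>j\<le>n. ?h j)"
    by (rule sum.mono_neutral_cong_right) (auto simp: assms)
  finally show "fps_series a $ N = (\<Sum>j\<le>n. a j * fps_X ^ j) $ N"
    by (simp add: fps_series_def fps_sum_nth fps_series_nth_mult_X)
qed

lemma fps_mult_X: "x * fps_X = fps_X *\<^sub>t (x :: 'a::complex_algebra_1 fps)"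
proof (rule fps_ext)
  show "(x * fps_X) $ n = (fps_X *\<^sub>t x) $ n" for n
    by (cases n) (simp_all add: fps_X_scale_nth)
qed

lemma fps_tens_mult_X: "(x \<otimes>\<^sub>t y) * fps_X = x \<otimes>\<^sub>t (y * fps_X)"
  for x :: "'a::complex_algebra_1 fps" and y :: "'b::complex_algebra_1 fps"
  by (simp add: fps_mult_X fps_tens_right(2))

section \<open>Contraction with a counit\<close>

lemma fps_linear_fps_scale_left: "fps_linear (\<lambda>c. c *\<^sub>t (y :: 'a::complex_vector fps))"
proof -
  have "(c + e) *\<^sub>t y = c *\<^sub>t y + e *\<^sub>t y" for c e
    by (simp add: fps_eq_iff fps_scale_def scaleC_add_left sum.distrib)
  moreover have "c *\<^sub>t e = c * e" for c e :: "complex fps"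
    by (simp add: fps_eq_iff fps_scale_def fps_mult_nth scaleC_complex_def atLeast0AtMost)
  ultimately show ?thesis by (auto simp: fps_linear_def fps_scale_assoc)
qed

context
  fixes \<epsilon> :: "'a::complex_algebra_1 fps \<Rightarrow> complex fps"
  assumes lin: "fps_linear \<epsilon>"
begin

lemma fps_bilinear_counit:
  "fps_bilinear (\<lambda>x y. \<epsilon> x *\<^sub>t (y :: 'a fps))" "fps_bilinear (\<lambda>x y. \<epsilon> y *\<^sub>t (x :: 'a fps))"
  by (auto simp: fps_bilinear_def intro: fps_linear_comp[OF fps_linear_fps_scale_left lin]
      fps_linear_fps_scale fps_linear_id)

lemma counit_tensor_mult:
  assumes "\<And>x y. \<epsilon> (x * y) = \<epsilon> x * \<epsilon> y"
  shows "fps_tensor_lift (\<lambda>x y. \<epsilon> x *\<^sub>t y) (X * Y) =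
     fps_tensor_lift (\<lambda>x y. \<epsilon> x *\<^sub>t y) X * fps_tensor_lift (\<lambda>x y. \<epsilon> x *\<^sub>t y) Y"
  "fps_tensor_lift (\<lambda>x y. \<epsilon> y *\<^sub>t x) (X * Y) =
     fps_tensor_lift (\<lambda>x y. \<epsilon> y *\<^sub>t x) X * fps_tensor_lift (\<lambda>x y. \<epsilon> y *\<^sub>t x) Y"
  using fps_bilinear_lift[OF fps_bilinear_counit(1)] fps_bilinear_lift[OF fps_bilinear_counit(2)]
  by (auto intro!: tensor_fps_mult_eqI
      simp: assms fps_scale_mult_left fps_scale_mult_right fps_scale_assoc mult.commute)

end

section \<open>Twisting a Hopf algebra\<close>

text \<open>A Drinfeld twist: an invertible \<open>F\<close>, with inverse \<open>G\<close>, that satisfies the cocycle and counit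
conditions. Then \<open>F \<Delta> G\<close> is again a coproduct for the same product and counit.\<close>

locale hopf_twist = formal_hopf_algebra \<Delta> \<epsilon> S
  for \<Delta> :: "'a::complex_algebra_1 fps \<Rightarrow> ('a, 'a) tensor fps" and \<epsilon> S +
  fixes F G :: "('a, 'a) tensor fps"
  assumes antipode_mult: "S (x * y) = S y * S x"
    and FG: "F * G = 1" and GF: "G * F = 1"
    and cocycle: "fps_tensor_assoc (F \<otimes>\<^sub>t 1) * fps_tensor_assoc (fps_tensor_map \<Delta> id F) =
      (1 \<otimes>\<^sub>t F) * fps_tensor_map id \<Delta> F"
    and counital_left: "fps_tensor_lift (\<lambda>x y. \<epsilon> x *\<^sub>t y) F = 1"
    and counital_right: "fps_tensor_lift (\<lambda>x y. \<epsilon> y *\<^sub>t x) F = 1"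
begin

text \<open>With \<open>F = \<Sum> F\<^sub>1 \<otimes> F\<^sub>2\<close> and \<open>G = \<Sum> G\<^sub>1 \<otimes> G\<^sub>2\<close>, these are \<open>\<Sum> F\<^sub>1 S(F\<^sub>2)\<close> and
  \<open>\<Sum> S(G\<^sub>1) G\<^sub>2\<close>, the elements that conjugate the old antipode into the new one.\<close>

definition w where "w = fps_tensor_lift (\<lambda>x y. x * S y) F"
definition w' where "w' = fps_tensor_lift (\<lambda>x y. S x * y) G"

text \<open>For \<open>X = \<Sum> X\<^sub>1 \<otimes> X\<^sub>2\<close>, the map \<open>u \<mapsto> \<Sum> S(X\<^sub>1) u X\<^sub>2\<close> is a right action of the tensor square,
because \<open>S\<close> reverses products. The antipode axiom for the twisted structure is obtained by letting
the three factors of \<open>F \<Delta>(x) G\<close> act one after the other.\<close>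

lemma sandwich_left:
  "fps_tensor_lift (\<lambda>x y. S x * u * y) (X * Y) =
     fps_tensor_lift (\<lambda>x y. S x * fps_tensor_lift (\<lambda>x y. S x * u * y) X * y) Y"
proof -
  have bil: "fps_bilinear (\<lambda>x y. S x * u * y)" for u :: "'a fps"
    using fps_bilinear_mult[OF fps_linear_mult(1)[OF antipode_linear] fps_linear_id(2)] .
  note lift = fps_bilinear_lift[OF bil]
  have tens: "fps_tensor_lift (\<lambda>x y. S x * u * y) (X * (a \<otimes>\<^sub>t c)) =
      S a * fps_tensor_lift (\<lambda>x y. S x * u * y) X * c" for a c
  proof (rule tensor_fps_eqI[where X = X and \<phi> = "\<lambda>X. fps_tensor_lift (\<lambda>x y. S x * u * y) (X * (a \<otimes>\<^sub>t c))"])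
    show "fps_linear (\<lambda>X. fps_tensor_lift (\<lambda>x y. S x * u * y) (X * (a \<otimes>\<^sub>t c)))"
      by (intro fps_linear_comp[OF lift(1)] fps_linear_mult fps_linear_id)
    show "fps_linear (\<lambda>X. S a * fps_tensor_lift (\<lambda>x y. S x * u * y) X * c)"
      by (intro fps_linear_mult lift(1))
  qed (simp only: fps_tens_mult lift(2), simp add: antipode_mult mult.assoc)
  show ?thesis
  proof (rule tensor_fps_eqI[where X = Y and \<phi> = "\<lambda>Y. fps_tensor_lift (\<lambda>x y. S x * u * y) (X * Y)"])
    show "fps_linear (\<lambda>Y. fps_tensor_lift (\<lambda>x y. S x * u * y) (X * Y))"
      by (intro fps_linear_comp[OF lift(1)] fps_linear_mult fps_linear_id)
  qed (simp_all add: lift tens)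
qed

lemma sandwich_right:
  "fps_tensor_lift (\<lambda>x y. x * u * S y) (X * Y) =
     fps_tensor_lift (\<lambda>x y. x * fps_tensor_lift (\<lambda>x y. x * u * S y) Y * S y) X"
proof -
  have bil: "fps_bilinear (\<lambda>x y. x * u * S y)" for u :: "'a fps"
    using fps_bilinear_mult[OF fps_linear_mult(1)[OF fps_linear_id(2)] antipode_linear] .
  note lift = fps_bilinear_lift[OF bil]
  have tens: "fps_tensor_lift (\<lambda>x y. x * u * S y) ((a \<otimes>\<^sub>t c) * Y) =
      a * fps_tensor_lift (\<lambda>x y. x * u * S y) Y * S c" for a c
  proof (rule tensor_fps_eqI[where X = Y and \<phi> = "\<lambda>Y. fps_tensor_lift (\<lambda>x y. x * u * S y) ((a \<otimes>\<^sub>t c) * Y)"])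
    show "fps_linear (\<lambda>Y. fps_tensor_lift (\<lambda>x y. x * u * S y) ((a \<otimes>\<^sub>t c) * Y))"
      by (intro fps_linear_comp[OF lift(1)] fps_linear_mult fps_linear_id)
    show "fps_linear (\<lambda>Y. a * fps_tensor_lift (\<lambda>x y. x * u * S y) Y * S c)"
      by (intro fps_linear_mult lift(1))
  qed (simp only: fps_tens_mult lift(2), simp add: antipode_mult mult.assoc)
  show ?thesis
  proof (rule tensor_fps_eqI[where X = X and \<phi> = "\<lambda>X. fps_tensor_lift (\<lambda>x y. x * u * S y) (X * Y)"])
    show "fps_linear (\<lambda>X. fps_tensor_lift (\<lambda>x y. x * u * S y) (X * Y))"
      by (intro fps_linear_comp[OF lift(1)] fps_linear_mult fps_linear_id)
  qed (simp_all add: lift tens)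
qed

text \<open>Coassociativity: the two iterated coproducts of \<open>x\<close> are the conjugates of \<open>(\<Delta> \<otimes> id) \<Delta> x\<close> and
\<open>(id \<otimes> \<Delta>) \<Delta> x\<close> by the two sides of the cocycle identity. Left antipode axiom: \<open>F\<close> sends \<open>w'\<close>
to 1 since \<open>w'\<close> is the image of 1 under \<open>G\<close> and \<open>G F = 1\<close>; then \<open>\<Delta>(x)\<close> sends 1 to \<open>\<epsilon>(x)\<close>, and
\<open>G\<close> sends this to \<open>\<epsilon>(x) w'\<close>; the outer factor \<open>w\<close> cancels \<open>w'\<close>. The right axiom is symmetric.\<close>

theorem twisted_hopf_algebra:
  assumes ww: "w * w' = 1"
  shows "formal_hopf_algebra (\<lambda>x. F * \<Delta> x * G) \<epsilon> (\<lambda>x. w * S x * w')"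
proof
  show lin: "fps_linear (\<lambda>x. F * \<Delta> x * G)"
    by (intro fps_linear_mult comult_linear)
  show "F * \<Delta> (x * y) * G = (F * \<Delta> x * G) * (F * \<Delta> y * G)" for x y
  proof -
    have "(F * \<Delta> x * G) * (F * \<Delta> y * G) = F * \<Delta> x * (G * F) * \<Delta> y * G"
      by (simp only: mult.assoc)
    then show ?thesis by (simp add: GF comult_mult mult.assoc)
  qed
  show "F * \<Delta> 1 * G = 1" by (simp add: comult_one FG)
  show linS: "fps_linear (\<lambda>x. w * S x * w')"
    by (intro fps_linear_mult antipode_linear)
  show "fps_linear \<epsilon>" "\<epsilon> (x * y) = \<epsilon> x * \<epsilon> y" "\<epsilon> 1 = 1" for x y
    by (rule counit_linear counit_mult counit_one)+

  show "fps_tensor_assoc (fps_tensor_map (\<lambda>x. F * \<Delta> x * G) id (F * \<Delta> x * G))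
      = fps_tensor_map id (\<lambda>x. F * \<Delta> x * G) (F * \<Delta> x * G)" for x
  proof -
    let ?A = "\<lambda>X :: ('a, 'a) tensor fps. fps_tensor_assoc (fps_tensor_map \<Delta> id X)"
    let ?B = "\<lambda>X :: ('a, 'a) tensor fps. fps_tensor_map id \<Delta> X"
    let ?F12 = "fps_tensor_assoc (F \<otimes>\<^sub>t (1 :: 'a fps))" and ?G12 = "fps_tensor_assoc (G \<otimes>\<^sub>t (1 :: 'a fps))"
    let ?F23 = "(1 :: 'a fps) \<otimes>\<^sub>t F" and ?G23 = "(1 :: 'a fps) \<otimes>\<^sub>t G"
    have one: "fps_tensor_assoc 1 = (1 :: ('a, ('a, 'a) tensor) tensor fps)"
      using fps_tensor_assoc_tens[of "1 :: 'a fps" "1 :: 'a fps" "1 :: 'a fps"] by (simp add: fps_tens_one)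
    have Amult: "?A (X * Y) = ?A X * ?A Y" for X Y
      by (simp add: fps_tensor_assoc_mult fps_tensor_map_mult comult_linear comult_mult fps_linear_id)
    have Bmult: "?B (X * Y) = ?B X * ?B Y" for X Y
      by (simp add: fps_tensor_map_mult comult_linear comult_mult fps_linear_id)
    have Aone: "?A 1 = 1" and Bone: "?B 1 = 1"
      using fps_tensor_map_tens[OF comult_linear fps_linear_id(1), of 1 "1 :: 'a fps"]
        fps_tensor_map_tens[OF fps_linear_id(1) comult_linear, of "1 :: 'a fps" 1]
      by (simp_all add: one comult_one fps_tens_one)
    have A: "fps_tensor_assoc (fps_tensor_map (\<lambda>x. F * \<Delta> x * G) id X) = ?F12 * ?A X * ?G12"
      for X :: "('a, 'a) tensor fps"
    proof -
      have "fps_tensor_map (\<lambda>x. F * \<Delta> x * G) id X = (F \<otimes>\<^sub>t (1 :: 'a fps)) * fps_tensor_map \<Delta> id X * (G \<otimes>\<^sub>t 1)"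
      proof (rule tensor_fps_eqI[where X = X])
        show "fps_linear (fps_tensor_map (\<lambda>x. F * \<Delta> x * G) (id :: 'a fps \<Rightarrow> 'a fps))"
          "fps_linear (\<lambda>X. (F \<otimes>\<^sub>t (1 :: 'a fps)) * fps_tensor_map \<Delta> id X * (G \<otimes>\<^sub>t 1))"
          by (intro fps_linear_mult fps_tensor_map_linear lin comult_linear fps_linear_id)+
      qed (simp only: fps_tensor_map_tens[OF lin fps_linear_id(1)]
          fps_tensor_map_tens[OF comult_linear fps_linear_id(1)] fps_tens_mult, simp)
      then show ?thesis by (simp add: fps_tensor_assoc_mult)
    qed
    have B: "fps_tensor_map id (\<lambda>x. F * \<Delta> x * G) X = ?F23 * ?B X * ?G23"
      for X :: "('a, 'a) tensor fps"
    proof (rule tensor_fps_eqI[where X = X])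
      show "fps_linear (fps_tensor_map (id :: 'a fps \<Rightarrow> 'a fps) (\<lambda>x. F * \<Delta> x * G))"
        "fps_linear (\<lambda>X. ?F23 * ?B X * ?G23)"
        by (intro fps_linear_mult fps_tensor_map_linear lin comult_linear fps_linear_id)+
    qed (simp only: fps_tensor_map_tens[OF fps_linear_id(1) lin]
        fps_tensor_map_tens[OF fps_linear_id(1) comult_linear] fps_tens_mult, simp)
    have inv12: "?G12 * ?F12 = 1"
      by (simp only: fps_tensor_assoc_mult[symmetric] fps_tens_mult GF mult_1_right fps_tens_one one)
    have inv23: "?F23 * ?G23 = 1"
      by (simp only: fps_tens_mult FG mult_1_right fps_tens_one)
    \<comment> \<open>\<open>?A G * ?G12\<close> and \<open>?B G * ?G23\<close> are a left and a right inverse of the same cocycle element.\<close>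
    have left: "(?A G * ?G12) * (?F12 * ?A F) = 1"
    proof -
      have "(?A G * ?G12) * (?F12 * ?A F) = ?A G * (?G12 * ?F12) * ?A F" by (simp only: mult.assoc)
      also have "\<dots> = ?A (G * F)" by (simp only: inv12 mult_1_right Amult)
      finally show ?thesis by (simp only: GF Aone)
    qed
    have right: "(?F12 * ?A F) * (?B G * ?G23) = 1"
    proof -
      have "(?F12 * ?A F) * (?B G * ?G23) = ?F23 * (?B F * ?B G) * ?G23"
        unfolding cocycle by (simp only: mult.assoc)
      also have "\<dots> = ?F23 * ?B (F * G) * ?G23" by (simp only: Bmult)
      finally show ?thesis by (simp only: FG Bone mult_1_right inv23)
    qed
    have "?A G * ?G12 = (?A G * ?G12) * ((?F12 * ?A F) * (?B G * ?G23))"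
      by (simp only: right mult_1_right)
    also have "\<dots> = ((?A G * ?G12) * (?F12 * ?A F)) * (?B G * ?G23)"
      by (simp only: mult.assoc)
    finally have G: "?A G * ?G12 = ?B G * ?G23"
      by (simp only: left mult_1_left)
    have "?F12 * ?A (F * \<Delta> x * G) * ?G12 = (?F12 * ?A F) * ?A (\<Delta> x) * (?A G * ?G12)"
      by (simp only: Amult mult.assoc)
    also have "\<dots> = (?F23 * ?B F) * ?B (\<Delta> x) * (?B G * ?G23)"
      by (simp only: cocycle coassoc G)
    also have "\<dots> = ?F23 * ?B (F * \<Delta> x * G) * ?G23"
      by (simp only: Bmult mult.assoc)
    finally show ?thesis by (simp only: A B)
  qed

  show "fps_tensor_lift (\<lambda>x y. \<epsilon> x *\<^sub>t y) (F * \<Delta> x * G) = x" for x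
  proof -
    have "fps_tensor_lift (\<lambda>x y. \<epsilon> x *\<^sub>t y) (F * G) = fps_tensor_lift (\<lambda>x y. \<epsilon> x *\<^sub>t y) G"
      by (simp add: counit_tensor_mult[OF counit_linear counit_mult] counital_left)
    moreover have "fps_tensor_lift (\<lambda>x y. \<epsilon> x *\<^sub>t y) (F * G) = 1"
      using counit_left[of 1] by (simp add: FG comult_one)
    ultimately show ?thesis by (simp add: counit_tensor_mult[OF counit_linear counit_mult] counital_left counit_left)
  qed
  show "fps_tensor_lift (\<lambda>x y. \<epsilon> y *\<^sub>t x) (F * \<Delta> x * G) = x" for x
  proof -
    have "fps_tensor_lift (\<lambda>x y. \<epsilon> y *\<^sub>t x) (F * G) = fps_tensor_lift (\<lambda>x y. \<epsilon> y *\<^sub>t x) G"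
      by (simp add: counit_tensor_mult[OF counit_linear counit_mult] counital_right)
    moreover have "fps_tensor_lift (\<lambda>x y. \<epsilon> y *\<^sub>t x) (F * G) = 1"
      using counit_right[of 1] by (simp add: FG comult_one)
    ultimately show ?thesis by (simp add: counit_tensor_mult[OF counit_linear counit_mult] counital_right counit_right)
  qed

  have bilS: "fps_bilinear (\<lambda>x y. S x * u * y)" "fps_bilinear (\<lambda>x y. x * u * S y)" for u :: "'a fps"
    by (intro fps_bilinear_mult fps_linear_mult antipode_linear fps_linear_id)+
  have sandwich_scale:
    "fps_tensor_lift (\<lambda>x y. S x * (c *\<^sub>t 1) * y) X = c *\<^sub>t fps_tensor_lift (\<lambda>x y. S x * 1 * y) X"
    "fps_tensor_lift (\<lambda>x y. x * (c *\<^sub>t 1) * S y) X = c *\<^sub>t fps_tensor_lift (\<lambda>x y. x * 1 * S y) X" for c X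
    by (rule tensor_fps_eqI[where X = X],
        (intro fps_tensor_lift_linear bilS fps_linear_fps_scale)+,
        simp only: fps_tensor_lift_eval[OF bilS(1)] fps_tensor_lift_eval[OF bilS(2)],
        simp only: fps_scale_mult_right fps_scale_mult_left)+

  show "fps_tensor_lift (\<lambda>x y. w * S x * w' * y) (F * \<Delta> x * G) = \<epsilon> x *\<^sub>t 1" for x
  proof -
    have out: "fps_tensor_lift (\<lambda>x y. w * S x * w' * y) X = w * fps_tensor_lift (\<lambda>x y. S x * w' * y) X" for X
    proof (rule tensor_fps_eqI[where X = X])
      have bil: "fps_bilinear (\<lambda>x y. w * S x * w' * y)"
        by (intro fps_bilinear_mult fps_linear_mult antipode_linear fps_linear_id)
      then show "fps_linear (fps_tensor_lift (\<lambda>x y. w * S x * w' * y))"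
        by (rule fps_tensor_lift_linear)
      show "fps_linear (\<lambda>X. w * fps_tensor_lift (\<lambda>x y. S x * w' * y) X)"
        by (intro fps_linear_mult fps_tensor_lift_linear bilS)
      show "fps_tensor_lift (\<lambda>x y. w * S x * w' * y) (x \<otimes>\<^sub>t y) =
          w * fps_tensor_lift (\<lambda>x y. S x * w' * y) (x \<otimes>\<^sub>t y)" for x y
        unfolding fps_tensor_lift_eval[OF bil] fps_tensor_lift_eval[OF bilS(1)] by (simp only: mult.assoc)
    qed
    have "fps_tensor_lift (\<lambda>x y. S x * 1 * y) 1 = 1"
      using antipode_left[of 1] by (simp add: comult_one counit_one fps_one_scale)
    then have F: "fps_tensor_lift (\<lambda>x y. S x * w' * y) F = 1"
      using sandwich_left[of 1 G F] by (simp add: GF w'_def)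
    have "fps_tensor_lift (\<lambda>x y. S x * w' * y) (F * \<Delta> x * G) = \<epsilon> x *\<^sub>t w'"
      unfolding mult.assoc[of F] sandwich_left[of w' F] F sandwich_left[of 1 "\<Delta> x"]
      using antipode_left[of x] sandwich_scale(1)[of _ G] by (simp add: w'_def)
    then show ?thesis by (simp only: out fps_scale_mult_right ww)
  qed

  show "fps_tensor_lift (\<lambda>x y. x * (w * S y * w')) (F * \<Delta> x * G) = \<epsilon> x *\<^sub>t 1" for x
  proof -
    have out: "fps_tensor_lift (\<lambda>x y. x * (w * S y * w')) X = fps_tensor_lift (\<lambda>x y. x * w * S y) X * w'" for X
    proof (rule tensor_fps_eqI[where X = X])
      have bil: "fps_bilinear (\<lambda>x y. x * (w * S y * w'))"
        by (intro fps_bilinear_mult fps_linear_mult antipode_linear fps_linear_id)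
      then show "fps_linear (fps_tensor_lift (\<lambda>x y. x * (w * S y * w')))"
        by (rule fps_tensor_lift_linear)
      show "fps_linear (\<lambda>X. fps_tensor_lift (\<lambda>x y. x * w * S y) X * w')"
        by (intro fps_linear_mult fps_tensor_lift_linear bilS)
      show "fps_tensor_lift (\<lambda>x y. x * (w * S y * w')) (x \<otimes>\<^sub>t y) =
          fps_tensor_lift (\<lambda>x y. x * w * S y) (x \<otimes>\<^sub>t y) * w'" for x y
        unfolding fps_tensor_lift_eval[OF bil] fps_tensor_lift_eval[OF bilS(2)] by (simp only: mult.assoc)
    qed
    have "fps_tensor_lift (\<lambda>x y. x * 1 * S y) 1 = 1"
      using antipode_right[of 1] by (simp add: comult_one counit_one fps_one_scale)
    then have G: "fps_tensor_lift (\<lambda>x y. x * w * S y) G = 1"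
      using sandwich_right[of 1 G F] by (simp add: GF w_def)
    have "fps_tensor_lift (\<lambda>x y. x * w * S y) (F * \<Delta> x * G) = \<epsilon> x *\<^sub>t w"
      unfolding sandwich_right[of w _ G] G sandwich_right[of 1 F]
      using antipode_right[of x] sandwich_scale(2)[of _ F] by (simp add: w_def)
    then show ?thesis by (simp only: out fps_scale_mult_left ww)
  qed
qed

end

section \<open>The standard Hopf structure of an enveloping algebra\<close>

text \<open>The universal property in its linear form: a function of words that is multilinear and
  respects brackets induces a linear map on the enveloping algebra. Algebra homomorphisms,
  antihomomorphisms (for the antipode) and the action on a module are all instances, with words
  multiplied out from left to right, from right to left, or applied to a vector.\<close>

definition uea_lift :: "('l::complex_lie_algebra list \<Rightarrow> 'v::complex_vector) \<Rightarrow> 'l uea \<Rightarrow> 'v" where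
  "uea_lift H X = lin_ext H (rep_uea X)"

definition respects_uea :: "('l::complex_lie_algebra list \<Rightarrow> 'v::complex_vector) \<Rightarrow> bool" where
  "respects_uea H \<longleftrightarrow> (\<forall>u v x y. H (u @ [x + y] @ v) = H (u @ [x] @ v) + H (u @ [y] @ v))
     \<and> (\<forall>u v c x. H (u @ [c *\<^sub>C x] @ v) = c *\<^sub>C H (u @ [x] @ v))
     \<and> (\<forall>u v x y. H (u @ [x, y] @ v) = H (u @ [y, x] @ v) + H (u @ [lie x y] @ v))"

lemma uea_lift_abs:
  assumes "respects_uea H"
  shows "uea_lift H (abs_uea p) = lin_ext H p"
proof -
  have monomial: "lin_ext H (gen u * r * gen v) = 0" if "r \<in> uea_relators" for u v r
  proof -
    have H: "H (u @ [x + y] @ v) = H (u @ [x] @ v) + H (u @ [y] @ v)"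
      "H (u @ [c *\<^sub>C x] @ v) = c *\<^sub>C H (u @ [x] @ v)"
      "H (u @ [x, y] @ v) = H (u @ [y, x] @ v) + H (u @ [lie x y] @ v)" for x y c
      using assms unfolding respects_uea_def by blast+
    note lin = gen_mult plus_list_def lin_ext_diff lin_ext_gen lin_ext_scaleC right_diff_distrib
      left_diff_distrib free_mult_scaleC_left free_mult_scaleC_right append_assoc append_Cons append_Nil
    from that consider x y where "r = gen [x + y] - gen [x] - gen [y]"
      | c x where "r = gen [c *\<^sub>C x] - c *\<^sub>C gen [x]"
      | x y where "r = gen [x] * gen [y] - gen [y] * gen [x] - gen [lie x y]"
      unfolding uea_relators_def by blast
    then show ?thesis
    proof cases
      case (3 x y)
      then show ?thesis by (simp only: lin) (simp add: H(3)[of x y, simplified])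
    qed (simp_all only: lin, simp_all add: H(1,2)[simplified])
  qed
  have left: "lin_ext H (p * r * gen v) = 0" if "r \<in> uea_relators" for p v r
    by (induction p rule: free_induct)
       (simp_all add: monomial[OF that] distrib_right lin_ext_add lin_ext_scaleC free_mult_scaleC_left)
  have relator: "lin_ext H (p * r * p') = 0" if "r \<in> uea_relators" for p p' r
    by (induction p' rule: free_induct)
       (simp_all add: left[OF that] distrib_left lin_ext_add lin_ext_scaleC free_mult_scaleC_right)
  have "uea_rel (rep_uea (abs_uea p)) p"
    by (meson Quotient_rep_abs Quotient_uea uea.abs_eq_iff equivp_reflp uea_equivp)
  then have "rep_uea (abs_uea p) - p \<in> uea_null" by (simp add: uea_rel_def)
  then have "lin_ext H (rep_uea (abs_uea p) - p) = 0"
    unfolding uea_null_def by (rule lin_ext_vanish) (use relator in auto)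
  then show ?thesis by (simp add: uea_lift_def lin_ext_diff)
qed

definition uea_word :: "'l::complex_lie_algebra list \<Rightarrow> 'l uea" where
  "uea_word u = abs_uea (gen u)"

lemma uea_lift_word: "respects_uea H \<Longrightarrow> uea_lift H (uea_word u) = H u"
  by (simp add: uea_word_def uea_lift_abs)

lemma uea_lift_linear: "respects_uea H \<Longrightarrow> linearC (uea_lift H)"
proof
  fix X Y :: "'a uea" and c
  assume H: "respects_uea H"
  show "uea_lift H (X + Y) = uea_lift H X + uea_lift H Y"
    by (induct X rule: uea.abs_induct, induct Y rule: uea.abs_induct)
       (simp add: plus_uea.abs_eq uea_lift_abs[OF H] lin_ext_add)
  show "uea_lift H (c *\<^sub>C X) = c *\<^sub>C uea_lift H X"
    by (induct X rule: uea.abs_induct) (simp add: scaleC_uea.abs_eq uea_lift_abs[OF H] lin_ext_scaleC)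
qed

lemma uea_word_append: "uea_word (u @ v) = uea_word u * uea_word v"
  by (simp add: uea_word_def times_uea.abs_eq gen_mult plus_list_def)

lemma uea_word_Nil: "uea_word [] = 1"
  unfolding uea_word_def one_uea_def by (simp only: zero_list_def[symmetric] single_one)

lemma uea_word_Cons: "uea_word (x # u) = uea_of x * uea_word u"
  using uea_word_append[of "[x]" u] by (simp add: uea_word_def uea_of.abs_eq)

lemma uea_induct [case_names zero word add scale]:
  assumes "P 0" "\<And>u. P (uea_word u)" "\<And>X Y. P X \<Longrightarrow> P Y \<Longrightarrow> P (X + Y)" "\<And>c X. P X \<Longrightarrow> P (c *\<^sub>C X)"
  shows "P X"
proof (induct X rule: uea.abs_induct)
  case (1 p)
  show ?case
    by (induction p rule: free_induct)
       (use assms in \<open>simp_all add: zero_uea_def uea_word_def flip: plus_uea.abs_eq scaleC_uea.abs_eq\<close>)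
qed

lemma uea_of_add: "uea_of (x + y) = uea_of x + uea_of y"
  and uea_of_scaleC: "uea_of (c *\<^sub>C x) = c *\<^sub>C uea_of x"
  and uea_of_lie: "uea_of x * uea_of y = uea_of y * uea_of x + uea_of (lie x y)"
proof -
  have rel: "r \<in> uea_null" if "r \<in> uea_relators" for r :: "'a list \<Rightarrow>\<^sub>0 complex"
  proof -
    have "1 * r * 1 \<in> uea_null" unfolding uea_null_def
      by (rule cvec.span_base, rule CollectI, intro exI conjI, rule refl, rule that)
    then show ?thesis by simp
  qed
  have "gen [x + y] - gen [x] - gen [y] \<in> uea_null" "gen [c *\<^sub>C x] - c *\<^sub>C gen [x] \<in> uea_null"
    "gen [x] * gen [y] - gen [y] * gen [x] - gen [lie x y] \<in> uea_null"
    by (rule rel, unfold uea_relators_def, blast)+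
  then show "uea_of (x + y) = uea_of x + uea_of y" "uea_of (c *\<^sub>C x) = c *\<^sub>C uea_of x"
    "uea_of x * uea_of y = uea_of y * uea_of x + uea_of (lie x y)"
    by (simp_all add: uea_of.abs_eq plus_uea.abs_eq scaleC_uea.abs_eq times_uea.abs_eq
        uea.abs_eq_iff uea_rel_def diff_diff_eq)
qed

lemma iota_add: "\<iota> (x + y) = \<iota> x + \<iota> y"
  and iota_scaleC: "\<iota> (c *\<^sub>C x) = c *\<^sub>C \<iota> x"
  and iota_lie: "\<iota> x * \<iota> y = \<iota> y * \<iota> x + \<iota> (lie x y)"
  by (simp_all add: emb_def uea_of_add uea_of_scaleC fps_const_scaleC fps_const_scale)
     (simp add: uea_of_lie[of x y])

lemma iota_zero: "\<iota> 0 = 0"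
  using iota_scaleC[of 0 0] by simp

lemma iota_minus: "\<iota> (- x) = - \<iota> x"
  using iota_add[of x "- x"] by (simp add: iota_zero eq_neg_iff_add_eq_0 add.commute)

lemma uea_fps_word_eqI:
  fixes \<phi> \<psi> :: "'l::complex_lie_algebra uea fps \<Rightarrow> 'v::complex_vector fps"
  assumes "fps_linear \<phi>" "fps_linear \<psi>" "\<And>u. \<phi> (fps_const (uea_word u)) = \<psi> (fps_const (uea_word u))"
  shows "\<phi> X = \<psi> X"
proof (rule fps_linear_eqI[OF assms(1,2)])
  fix A
  have const_scale: "fps_const (c *\<^sub>C X) = c *\<^sub>C fps_const X" for c and X :: "'l uea"
    by (simp add: fps_eq_iff fps_scaleC_nth)
  note \<phi> = fps_linearD[OF assms(1)] and \<psi> = fps_linearD[OF assms(2)]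
  show "\<phi> (fps_const A) = \<psi> (fps_const A)"
    by (induction A rule: uea_induct) (simp_all add: \<phi> \<psi> const_scale assms(3) flip: fps_const_add)
qed

lemma fps_const_uea_word_Cons: "fps_const (uea_word (x # u)) = \<iota> x * fps_const (uea_word u)"
  by (simp add: uea_word_Cons emb_def)

text \<open>Induction over products of Lie algebra elements: the antipode axioms are not multiplicative in
\<open>X\<close>, but they pass from \<open>X\<close> to \<open>x X\<close>.\<close>

lemma uea_fps_linear_eqI:
  fixes \<phi> \<psi> :: "'l::complex_lie_algebra uea fps \<Rightarrow> 'v::complex_vector fps"
  assumes "fps_linear \<phi>" "fps_linear \<psi>" "\<phi> 1 = \<psi> 1"
    "\<And>x X. \<phi> X = \<psi> X \<Longrightarrow> \<phi> (\<iota> x * X) = \<psi> (\<iota> x * X)"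
  shows "\<phi> X = \<psi> X"
proof (rule uea_fps_word_eqI[OF assms(1,2)])
  show "\<phi> (fps_const (uea_word u)) = \<psi> (fps_const (uea_word u))" for u
  proof (induction u)
    case Nil
    then show ?case using assms(3) by (simp add: uea_word_Nil)
  next
    case (Cons x u)
    then show ?case using assms(4)[OF Cons, of x] by (simp add: fps_const_uea_word_Cons)
  qed
qed

lemma uea_fps_lift:
  assumes H: "respects_uea H"
  shows "fps_linear (fps_extend (uea_lift H))"
    and "fps_extend (uea_lift H) (fps_const (uea_word u)) = H u"
  using fps_extend_linear[OF uea_lift_linear[OF H]] fps_extend_const[OF uea_lift_linear[OF H]]
  by (simp_all add: uea_lift_word[OF H])

definition uea_hom :: "('l::complex_lie_algebra \<Rightarrow> 'a::complex_algebra_1 fps) \<Rightarrow> 'l uea fps \<Rightarrow> 'a fps" where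
  "uea_hom \<rho> = fps_extend (uea_lift (\<lambda>u. prod_list (map \<rho> u)))"

definition uea_antihom :: "('l::complex_lie_algebra \<Rightarrow> 'a::complex_algebra_1 fps) \<Rightarrow> 'l uea fps \<Rightarrow> 'a fps" where
  "uea_antihom \<rho> = fps_extend (uea_lift (\<lambda>u. prod_list (map \<rho> (rev u))))"

lemma
  fixes \<rho> :: "'l::complex_lie_algebra \<Rightarrow> 'a::complex_algebra_1 fps"
  assumes "linearC \<rho>" and bracket: "\<And>x y. \<rho> x * \<rho> y = \<rho> y * \<rho> x + \<rho> (lie x y)"
  shows uea_hom_linear: "fps_linear (uea_hom \<rho>)"
    and uea_hom_one: "uea_hom \<rho> 1 = 1"
    and uea_hom_iota: "uea_hom \<rho> (\<iota> x) = \<rho> x"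
    and uea_hom_mult: "uea_hom \<rho> (X * Y) = uea_hom \<rho> X * uea_hom \<rho> Y"
proof -
  interpret linearC \<rho> by fact
  have bracket': "\<rho> x * (\<rho> y * v) = \<rho> y * (\<rho> x * v) + \<rho> (lie x y) * v" for x y v
    using bracket[of x y] by (simp add: distrib_right flip: mult.assoc)
  have H: "respects_uea (\<lambda>u. prod_list (map \<rho> u))"
    unfolding respects_uea_def
  proof (intro conjI allI)
    fix u v x y
    show "prod_list (map \<rho> (u @ [x, y] @ v)) =
        prod_list (map \<rho> (u @ [y, x] @ v)) + prod_list (map \<rho> (u @ [lie x y] @ v))"
      by (simp add: bracket'[of x y] distrib_left)
  qed (simp_all add: add scale distrib_left distrib_right mult_scaleC_left mult_scaleC_right)
  note lift = uea_fps_lift[OF H, folded uea_hom_def]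
  show lin: "fps_linear (uea_hom \<rho>)" by (rule lift(1))
  show one: "uea_hom \<rho> 1 = 1" using lift(2)[of "[]"] by (simp add: uea_word_Nil)
  show "uea_hom \<rho> (\<iota> x) = \<rho> x"
    using lift(2)[of "[x]"] by (simp add: emb_def uea_word_def uea_of.abs_eq)
  have step: "uea_hom \<rho> (\<iota> x * X) = \<rho> x * uea_hom \<rho> X" for x X
    by (rule uea_fps_word_eqI[where X = X and \<phi> = "\<lambda>X. uea_hom \<rho> (\<iota> x * X)"])
       (intro fps_linear_comp[OF lin] fps_linear_mult fps_linear_id lin,
        intro fps_linear_mult lin, simp only: fps_const_uea_word_Cons[symmetric] lift(2), simp)
  show "uea_hom \<rho> (X * Y) = uea_hom \<rho> X * uea_hom \<rho> Y"
    by (rule uea_fps_linear_eqI[where X = X and \<phi> = "\<lambda>X. uea_hom \<rho> (X * Y)"])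
       (intro fps_linear_comp[OF lin] fps_linear_mult fps_linear_id lin,
        intro fps_linear_mult lin, simp_all add: one step mult.assoc)
qed

lemma
  fixes \<rho> :: "'l::complex_lie_algebra \<Rightarrow> 'a::complex_algebra_1 fps"
  assumes "linearC \<rho>" and bracket: "\<And>x y. \<rho> y * \<rho> x = \<rho> x * \<rho> y + \<rho> (lie x y)"
  shows uea_antihom_linear: "fps_linear (uea_antihom \<rho>)"
    and uea_antihom_one: "uea_antihom \<rho> 1 = 1"
    and uea_antihom_iota: "uea_antihom \<rho> (\<iota> x) = \<rho> x"
    and uea_antihom_mult: "uea_antihom \<rho> (X * Y) = uea_antihom \<rho> Y * uea_antihom \<rho> X"
proof -
  interpret linearC \<rho> by fact
  have bracket': "\<rho> y * (\<rho> x * v) = \<rho> x * (\<rho> y * v) + \<rho> (lie x y) * v" for x y v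
    using bracket[of y x] by (simp add: distrib_right flip: mult.assoc)
  have H: "respects_uea (\<lambda>u. prod_list (map \<rho> (rev u)))"
    unfolding respects_uea_def
  proof (intro conjI allI)
    fix u v x y
    show "prod_list (map \<rho> (rev (u @ [x, y] @ v))) =
        prod_list (map \<rho> (rev (u @ [y, x] @ v))) + prod_list (map \<rho> (rev (u @ [lie x y] @ v)))"
      by (simp add: bracket'[of y x] distrib_left mult.assoc)
  qed (simp_all add: add scale distrib_left distrib_right mult_scaleC_left mult_scaleC_right)
  note lift = uea_fps_lift[OF H, folded uea_antihom_def]
  show lin: "fps_linear (uea_antihom \<rho>)" by (rule lift(1))
  show one: "uea_antihom \<rho> 1 = 1" using lift(2)[of "[]"] by (simp add: uea_word_Nil)
  show "uea_antihom \<rho> (\<iota> x) = \<rho> x"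
    using lift(2)[of "[x]"] by (simp add: emb_def uea_word_def uea_of.abs_eq)
  have step: "uea_antihom \<rho> (\<iota> x * X) = uea_antihom \<rho> X * \<rho> x" for x X
    by (rule uea_fps_word_eqI[where X = X and \<phi> = "\<lambda>X. uea_antihom \<rho> (\<iota> x * X)"])
       (intro fps_linear_comp[OF lin] fps_linear_mult fps_linear_id lin,
        intro fps_linear_mult lin, simp only: fps_const_uea_word_Cons[symmetric] lift(2), simp)
  show "uea_antihom \<rho> (X * Y) = uea_antihom \<rho> Y * uea_antihom \<rho> X"
    by (rule uea_fps_linear_eqI[where X = X and \<phi> = "\<lambda>X. uea_antihom \<rho> (X * Y)"])
       (intro fps_linear_comp[OF lin] fps_linear_mult fps_linear_id lin,
        intro fps_linear_mult lin, simp_all add: one step mult.assoc)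
qed

definition uea_comult :: "'l::complex_lie_algebra uea fps \<Rightarrow> ('l uea, 'l uea) tensor fps" where
  "uea_comult = uea_hom (\<lambda>x. \<iota> x \<otimes>\<^sub>t 1 + 1 \<otimes>\<^sub>t \<iota> x)"

definition uea_antipode :: "'l::complex_lie_algebra uea fps \<Rightarrow> 'l uea fps" where
  "uea_antipode = uea_antihom (\<lambda>x. - \<iota> x)"

lemma uea_comult_linearC: "linearC (\<lambda>x. \<iota> x \<otimes>\<^sub>t 1 + 1 \<otimes>\<^sub>t \<iota> x)"
  by unfold_locales (simp_all add: iota_add iota_scaleC fps_tens_left fps_tens_right scaleC_add_right)

lemma uea_comult_bracket:
  "(\<iota> x \<otimes>\<^sub>t 1 + 1 \<otimes>\<^sub>t \<iota> x) * (\<iota> y \<otimes>\<^sub>t 1 + 1 \<otimes>\<^sub>t \<iota> y) =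
    (\<iota> y \<otimes>\<^sub>t 1 + 1 \<otimes>\<^sub>t \<iota> y) * (\<iota> x \<otimes>\<^sub>t 1 + 1 \<otimes>\<^sub>t \<iota> x) + (\<iota> (lie x y) \<otimes>\<^sub>t 1 + 1 \<otimes>\<^sub>t \<iota> (lie x y))"
  by (simp add: distrib_left distrib_right fps_tens_mult iota_lie[of x y] fps_tens_left(1) fps_tens_right(1))

lemma uea_antipode_linearC: "linearC (\<lambda>x. - \<iota> x)"
  by unfold_locales (simp_all add: iota_add iota_scaleC)

lemma uea_antipode_bracket: "- \<iota> y * - \<iota> x = - \<iota> x * - \<iota> y + - \<iota> (lie x y)"
  using iota_lie[of x y] by simp

lemmas uea_comult_linear = uea_hom_linear[OF uea_comult_linearC uea_comult_bracket, folded uea_comult_def]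
  and uea_comult_one = uea_hom_one[OF uea_comult_linearC uea_comult_bracket, folded uea_comult_def]
  and uea_comult_iota = uea_hom_iota[OF uea_comult_linearC uea_comult_bracket, folded uea_comult_def]
  and uea_comult_mult = uea_hom_mult[OF uea_comult_linearC uea_comult_bracket, folded uea_comult_def]

lemmas uea_antipode_linear = uea_antihom_linear[OF uea_antipode_linearC uea_antipode_bracket, folded uea_antipode_def]
  and uea_antipode_one = uea_antihom_one[OF uea_antipode_linearC uea_antipode_bracket, folded uea_antipode_def]
  and uea_antipode_iota = uea_antihom_iota[OF uea_antipode_linearC uea_antipode_bracket, folded uea_antipode_def]
  and uea_antipode_mult = uea_antihom_mult[OF uea_antipode_linearC uea_antipode_bracket, folded uea_antipode_def]

lemma uea_counit_zero: "uea_counit 0 = 0"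
  using uea_counit_simps(5)[of 0 0] by simp

lemma uea_counit_sum: "uea_counit (\<Sum>i\<in>I. X i) = (\<Sum>i\<in>I. uea_counit (X i))"
  by (induction I rule: infinite_finite_induct) (auto simp: uea_counit_zero uea_counit_simps)

lemma uea_counit_fps:
  shows uea_counit_fps_linear: "fps_linear uea_counit_fps"
    and uea_counit_fps_one: "uea_counit_fps 1 = 1"
    and uea_counit_fps_iota: "uea_counit_fps (\<iota> x) = 0"
    and uea_counit_fps_mult: "uea_counit_fps (X * Y) = uea_counit_fps X * uea_counit_fps Y"
  by (auto simp: fps_linear_def fps_eq_iff uea_counit_fps_def emb_def uea_counit_simps uea_counit_zero
      uea_counit_sum fps_mult_nth fps_scale_def scaleC_complex_def)

lemma fps_scale_zero_left: "0 *\<^sub>t x = 0"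
  by (simp add: fps_eq_iff fps_scale_def)

text \<open>Coassociativity and the counit axioms are identities between algebra maps, so it suffices to look
at Lie algebra elements. For the antipode axioms, multiplication by \<open>x \<otimes> 1 + 1 \<otimes> x\<close> followed by
the contraction \<open>\<Sum> S(X\<^sub>1) X\<^sub>2\<close> gives 0, and followed by \<open>\<Sum> X\<^sub>1 S(X\<^sub>2)\<close> it gives a commutator
with \<open>x\<close>, which vanishes on the scalars provided by the induction hypothesis.\<close>

theorem uea_hopf_algebra: "formal_hopf_algebra uea_comult uea_counit_fps uea_antipode"
proof
  show "fps_linear uea_comult" "uea_comult (x * y) = uea_comult x * uea_comult y" "uea_comult 1 = 1"
    "fps_linear uea_counit_fps" "uea_counit_fps (x * y) = uea_counit_fps x * uea_counit_fps y"
    "uea_counit_fps 1 = 1" "fps_linear uea_antipode" for x y :: "'a uea fps"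
    by (rule uea_comult_linear uea_comult_mult uea_comult_one uea_antipode_linear uea_counit_fps)+
  let ?A = "\<lambda>X :: ('a uea, 'a uea) tensor fps. fps_tensor_assoc (fps_tensor_map uea_comult (id :: 'a uea fps \<Rightarrow> _) X)"
  let ?B = "\<lambda>X :: ('a uea, 'a uea) tensor fps. fps_tensor_map (id :: 'a uea fps \<Rightarrow> _) uea_comult X"
  note Atens = fps_tensor_map_tens[OF uea_comult_linear fps_linear_id(1)]
  note Btens = fps_tensor_map_tens[OF fps_linear_id(1) uea_comult_linear]
  have Alin: "fps_linear ?A" and Blin: "fps_linear ?B"
    by (intro fps_linear_comp[OF fps_tensor_assoc_linear] fps_tensor_map_linear uea_comult_linear fps_linear_id)+
  have mult: "?A (X * Y) = ?A X * ?A Y" "?B (X * Y) = ?B X * ?B Y" for X Y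
    by (simp_all add: fps_tensor_assoc_mult fps_tensor_map_mult uea_comult_linear uea_comult_mult fps_linear_id)
  have one: "?A 1 = 1" "?B 1 = 1"
    using Atens[of "1 :: 'a uea fps" "1 :: 'a uea fps"] Btens[of "1 :: 'a uea fps" "1 :: 'a uea fps"]
      fps_tensor_assoc_tens[of "1 :: 'a uea fps" "1 :: 'a uea fps" "1 :: 'a uea fps"]
    by (simp_all add: fps_tens_one uea_comult_one)
  have gen: "?A (uea_comult (\<iota> x)) = ?B (uea_comult (\<iota> x))" for x
    by (simp add: uea_comult_iota fps_linearD(1)[OF Alin] fps_linearD(1)[OF Blin] Atens Btens
        uea_comult_one fps_tens_left(1) fps_tens_right(1) fps_linearD(1)[OF fps_tensor_assoc_linear]
        fps_tensor_assoc_tens add_ac flip: fps_tens_one)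
  show "?A (uea_comult x) = ?B (uea_comult x)" for x
    by (rule uea_fps_linear_eqI[where X = x and \<phi> = "\<lambda>x. ?A (uea_comult x)"])
       (rule fps_linear_comp[OF Alin uea_comult_linear], rule fps_linear_comp[OF Blin uea_comult_linear],
        simp_all only: uea_comult_one one uea_comult_mult mult gen)

  note counit_bil = fps_bilinear_counit[OF uea_counit_fps_linear]
  note L = fps_bilinear_lift[OF counit_bil(1)] and R = fps_bilinear_lift[OF counit_bil(2)]
  note counit_mult = counit_tensor_mult[OF uea_counit_fps_linear uea_counit_fps_mult]
  have unit: "fps_tensor_lift (\<lambda>x y. uea_counit_fps x *\<^sub>t y) (1 :: ('a uea, 'a uea) tensor fps) = (1 :: 'a uea fps)"
    "fps_tensor_lift (\<lambda>x y. uea_counit_fps y *\<^sub>t x) (1 :: ('a uea, 'a uea) tensor fps) = (1 :: 'a uea fps)"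
    unfolding fps_tens_one[symmetric] L(2) R(2) by (simp_all only: uea_counit_fps_one fps_one_scale)
  have gen: "fps_tensor_lift (\<lambda>x y. uea_counit_fps x *\<^sub>t y) (uea_comult (\<iota> x)) = \<iota> x"
    "fps_tensor_lift (\<lambda>x y. uea_counit_fps y *\<^sub>t x) (uea_comult (\<iota> x)) = \<iota> x" for x :: 'a
    unfolding uea_comult_iota fps_linearD(1)[OF L(1)] fps_linearD(1)[OF R(1)] L(2) R(2)
    by (simp_all add: uea_counit_fps_one uea_counit_fps_iota fps_one_scale fps_scale_zero_left)
  show "fps_tensor_lift (\<lambda>x y. uea_counit_fps x *\<^sub>t y) (uea_comult x) = x" for x :: "'a uea fps"
    by (rule uea_fps_linear_eqI[where X = x
          and \<phi> = "\<lambda>x. fps_tensor_lift (\<lambda>x y. uea_counit_fps x *\<^sub>t y) (uea_comult x)" and \<psi> = "\<lambda>x. x"])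
       (rule fps_linear_comp[OF L(1) uea_comult_linear], rule fps_linear_id,
        simp_all only: uea_comult_one unit uea_comult_mult counit_mult gen)
  show "fps_tensor_lift (\<lambda>x y. uea_counit_fps y *\<^sub>t x) (uea_comult x) = x" for x :: "'a uea fps"
    by (rule uea_fps_linear_eqI[where X = x
          and \<phi> = "\<lambda>x. fps_tensor_lift (\<lambda>x y. uea_counit_fps y *\<^sub>t x) (uea_comult x)" and \<psi> = "\<lambda>x. x"])
       (rule fps_linear_comp[OF R(1) uea_comult_linear], rule fps_linear_id,
        simp_all only: uea_comult_one unit uea_comult_mult counit_mult gen)

  have antipode_bil: "fps_bilinear (\<lambda>x y. uea_antipode x * (y :: 'a uea fps))"
    "fps_bilinear (\<lambda>x y. (x :: 'a uea fps) * uea_antipode y)"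
    by (intro fps_bilinear_mult uea_antipode_linear fps_linear_id)+
  note M = fps_bilinear_lift[OF antipode_bil(1)] and N = fps_bilinear_lift[OF antipode_bil(2)]
  have counit_lin: "fps_linear (\<lambda>x :: 'a uea fps. uea_counit_fps x *\<^sub>t (1 :: 'a uea fps))"
    by (rule fps_linear_comp[OF fps_linear_fps_scale_left uea_counit_fps_linear])
  have unit: "fps_tensor_lift (\<lambda>x y. uea_antipode x * y) 1 = (1 :: 'a uea fps)"
    "fps_tensor_lift (\<lambda>x y. x * uea_antipode y) 1 = (1 :: 'a uea fps)"
    unfolding fps_tens_one[symmetric] M(2) N(2) by (simp_all add: uea_antipode_one)
  have left: "fps_tensor_lift (\<lambda>x y. uea_antipode x * y) ((\<iota> x \<otimes>\<^sub>t 1 + 1 \<otimes>\<^sub>t \<iota> x) * Z) = 0"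
    for x :: 'a and Z
  proof (rule tensor_fps_eqI[where X = Z and \<psi> = "\<lambda>Z. 0"
        and \<phi> = "\<lambda>Z. fps_tensor_lift (\<lambda>x y. uea_antipode x * y) ((\<iota> x \<otimes>\<^sub>t 1 + 1 \<otimes>\<^sub>t \<iota> x) * Z)"])
    show "fps_linear (\<lambda>Z. fps_tensor_lift (\<lambda>x y. uea_antipode x * y) ((\<iota> x \<otimes>\<^sub>t 1 + 1 \<otimes>\<^sub>t \<iota> x) * Z))"
      by (intro fps_linear_comp[OF M(1)] fps_linear_mult fps_linear_id)
    show "fps_linear (\<lambda>Z :: ('a uea, 'a uea) tensor fps. 0 :: 'a uea fps)"
      by (simp add: fps_linear_def) (simp add: fps_eq_iff fps_scale_def)
    fix a c :: "'a uea fps"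
    show "fps_tensor_lift (\<lambda>x y. uea_antipode x * y) ((\<iota> x \<otimes>\<^sub>t 1 + 1 \<otimes>\<^sub>t \<iota> x) * (a \<otimes>\<^sub>t c)) = 0"
      unfolding distrib_right fps_tens_mult fps_linearD(1)[OF M(1)] M(2)
      by (simp add: uea_antipode_mult uea_antipode_iota mult.assoc)
  qed
  have right: "fps_tensor_lift (\<lambda>x y. x * uea_antipode y) ((\<iota> x \<otimes>\<^sub>t 1 + 1 \<otimes>\<^sub>t \<iota> x) * Z) =
      \<iota> x * fps_tensor_lift (\<lambda>x y. x * uea_antipode y) Z - fps_tensor_lift (\<lambda>x y. x * uea_antipode y) Z * \<iota> x"
    for x :: 'a and Z
  proof (rule tensor_fps_eqI[where X = Z
        and \<phi> = "\<lambda>Z. fps_tensor_lift (\<lambda>x y. x * uea_antipode y) ((\<iota> x \<otimes>\<^sub>t 1 + 1 \<otimes>\<^sub>t \<iota> x) * Z)"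
        and \<psi> = "\<lambda>Z. \<iota> x * fps_tensor_lift (\<lambda>x y. x * uea_antipode y) Z
          - fps_tensor_lift (\<lambda>x y. x * uea_antipode y) Z * \<iota> x"])
    show "fps_linear (\<lambda>Z. fps_tensor_lift (\<lambda>x y. x * uea_antipode y) ((\<iota> x \<otimes>\<^sub>t 1 + 1 \<otimes>\<^sub>t \<iota> x) * Z))"
      by (intro fps_linear_comp[OF N(1)] fps_linear_mult fps_linear_id)
    have "fps_linear (\<lambda>Z. \<iota> x * fps_tensor_lift (\<lambda>x y. x * uea_antipode y) Z
        + fps_tensor_lift (\<lambda>x y. x * uea_antipode y) Z * (- \<iota> x))"
      by (intro fps_linear_plus fps_linear_mult N(1))
    then show "fps_linear (\<lambda>Z. \<iota> x * fps_tensor_lift (\<lambda>x y. x * uea_antipode y) Z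
        - fps_tensor_lift (\<lambda>x y. x * uea_antipode y) Z * \<iota> x)" by simp
    fix a c :: "'a uea fps"
    show "fps_tensor_lift (\<lambda>x y. x * uea_antipode y) ((\<iota> x \<otimes>\<^sub>t 1 + 1 \<otimes>\<^sub>t \<iota> x) * (a \<otimes>\<^sub>t c)) =
      \<iota> x * fps_tensor_lift (\<lambda>x y. x * uea_antipode y) (a \<otimes>\<^sub>t c)
        - fps_tensor_lift (\<lambda>x y. x * uea_antipode y) (a \<otimes>\<^sub>t c) * \<iota> x"
      unfolding distrib_right fps_tens_mult fps_linearD(1)[OF N(1)] N(2)
      by (simp add: uea_antipode_mult uea_antipode_iota mult.assoc)
  qed
  show "fps_tensor_lift (\<lambda>x y. uea_antipode x * y) (uea_comult x) = uea_counit_fps x *\<^sub>t 1" for x :: "'a uea fps"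
    by (rule uea_fps_linear_eqI[where X = x
          and \<phi> = "\<lambda>x. fps_tensor_lift (\<lambda>x y. uea_antipode x * y) (uea_comult x)"
          and \<psi> = "\<lambda>x. uea_counit_fps x *\<^sub>t 1", OF fps_linear_comp[OF M(1) uea_comult_linear] counit_lin])
       (simp_all only: uea_comult_one unit uea_comult_mult uea_comult_iota left uea_counit_fps_one
         fps_one_scale uea_counit_fps_mult uea_counit_fps_iota mult_zero_left fps_scale_zero_left)
  show "fps_tensor_lift (\<lambda>x y. x * uea_antipode y) (uea_comult x) = uea_counit_fps x *\<^sub>t 1" for x :: "'a uea fps"
    by (rule uea_fps_linear_eqI[where X = x
          and \<phi> = "\<lambda>x. fps_tensor_lift (\<lambda>x y. x * uea_antipode y) (uea_comult x)"
          and \<psi> = "\<lambda>x. uea_counit_fps x *\<^sub>t 1", OF fps_linear_comp[OF N(1) uea_comult_linear] counit_lin])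
       (simp_all only: uea_comult_one unit uea_comult_mult uea_comult_iota right uea_counit_fps_one
         fps_one_scale uea_counit_fps_mult uea_counit_fps_iota mult_zero_left fps_scale_zero_left
         fps_scale_mult_left fps_scale_mult_right mult_1_left mult_1_right diff_self)
qed

section \<open>Divided rising powers and powers of \<open>1 - e t\<close>\<close>

lemma of_nat_scaleC: "of_nat n *\<^sub>C (1 :: 'a::complex_algebra_1) = of_nat n"
  by (induction n) (simp_all add: scaleC_add_left scaleC_one)

lemma rising_shift: "rising (x + c *\<^sub>C 1) a j = rising x (a + c) j"
  by (induction j) (simp_all add: scaleC_add_left add_ac)

lemma rising_split: "rising x a (i + j) = rising x a i * rising x (a + of_nat i) j"
  by (induction j) (simp_all add: mult.assoc add_ac)

text \<open>The only commutation principle used for rising powers: commutation, shifts by eigenvectors of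
\<open>ad T\<close> and shifts by \<open>E\<close> are the cases \<open>y = x\<close>, \<open>y = x + r\<close> and \<open>y = x \<plusminus> 1\<close>.\<close>

lemma rising_intertwine:
  assumes "x * z = z * y"
  shows "rising x a j * z = z * rising y a j"
proof (induction j)
  case (Suc j)
  have "(x + (a + of_nat j) *\<^sub>C 1) * z = z * (y + (a + of_nat j) *\<^sub>C 1)"
    by (simp add: distrib_left distrib_right mult_scaleC_left mult_scaleC_right assms)
  then have "rising x a (Suc j) * z = (rising x a j * z) * (y + (a + of_nat j) *\<^sub>C 1)"
    by (simp add: mult.assoc)
  then show ?case by (simp add: Suc mult.assoc)
qed simp

lemma rising_zero: "rising 0 0 (Suc j) = 0"
  by (induction j) simp_all

text \<open>\<open>x(x + 1)\<cdots>(x + j - 1) / j!\<close>, that is \<open>(-1)\<^sup>j\<close> times the binomial coefficient of \<open>- x\<close> over \<open>j\<close>;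
  written \<open>D\<^sub>j(x)\<close> in what follows. In this normalization, moving past elements with \<open>x z = z (x + c)\<close> only shifts the argument.\<close>

definition divrising :: "'a::complex_algebra_1 \<Rightarrow> nat \<Rightarrow> 'a" where
  "divrising x j = (1 / fact j) *\<^sub>C rising x 0 j"

lemma divrising_0 [simp]: "divrising x 0 = 1"
  by (simp add: divrising_def scaleC_one)

lemma divrising_intertwine: "x * z = z * y \<Longrightarrow> divrising x j * z = z * divrising y j"
  by (simp add: divrising_def mult_scaleC_left mult_scaleC_right rising_intertwine)

lemma divrising_commute: "x * z = z * x \<Longrightarrow> divrising x j * z = z * divrising x j"
  by (rule divrising_intertwine)

lemma divrising_zero: "divrising 0 j = (if j = 0 then 1 else 0)"
  by (cases j) (simp_all add: divrising_def rising_zero scaleC_one del: rising.simps(2))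

lemma divrising_Suc: "of_nat (Suc j) *\<^sub>C divrising x (Suc j) = divrising x j * (x + of_nat j)"
proof -
  have "of_nat (Suc j) * (1 / fact (Suc j)) = (1 / fact j :: complex)"
    by (simp add: divide_simps del: of_nat_Suc)
  then show ?thesis
    by (simp add: divrising_def scaleC_scaleC mult_scaleC_left of_nat_scaleC del: of_nat_Suc fact_Suc)
qed

lemma divrising_split:
  "of_nat (i + j choose i) *\<^sub>C divrising x (i + j) = divrising x i * divrising (x + of_nat i) j"
proof -
  have "rising (x + of_nat i) 0 j = rising x (of_nat i) j"
    using rising_shift[of x "of_nat i" 0 j] by (simp add: of_nat_scaleC)
  moreover have "of_nat (i + j choose i) * (1 / fact (i + j)) = (1 / fact i * (1 / fact j) :: complex)"
    by (simp add: binomial_fact divide_simps)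
  ultimately show ?thesis
    by (simp add: divrising_def scaleC_scaleC mult_scaleC_left mult_scaleC_right rising_split mult.commute)
qed

text \<open>The Chu--Vandermonde identity for commuting elements. The recursion
\<open>(n + 1) D\<^sub>n\<^sub>+\<^sub>1 = D\<^sub>n (x + n)\<close> is applied to both factors of each summand of \<open>n + 1 = i + (n + 1 - i)\<close>.\<close>

lemma divrising_add:
  assumes "x * y = y * x"
  shows "divrising (x + y) n = (\<Sum>i\<le>n. divrising x i * divrising y (n - i))"
proof (induction n)
  case (Suc n)
  let ?D = "\<lambda>i. divrising x i" and ?E = "\<lambda>i. divrising y i"
  have comm: "?E i * x = x * ?E i" for i
    using assms by (intro divrising_commute) simp
  have "of_nat (Suc n) *\<^sub>C (\<Sum>i\<le>Suc n. ?D i * ?E (Suc n - i)) =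
      (\<Sum>i\<le>Suc n. (of_nat i *\<^sub>C ?D i) * ?E (Suc n - i)) +
      (\<Sum>i\<le>Suc n. ?D i * (of_nat (Suc n - i) *\<^sub>C ?E (Suc n - i)))"
    unfolding cvec.scale_sum_right sum.distrib[symmetric]
  proof (rule sum.cong)
    fix i assume "i \<in> {..Suc n}"
    then have "(of_nat (Suc n) :: complex) = of_nat i + of_nat (Suc n - i)"
      by (simp flip: of_nat_add del: of_nat_Suc)
    then show "of_nat (Suc n) *\<^sub>C (?D i * ?E (Suc n - i)) =
        (of_nat i *\<^sub>C ?D i) * ?E (Suc n - i) + ?D i * (of_nat (Suc n - i) *\<^sub>C ?E (Suc n - i))"
      by (simp add: mult_scaleC_left mult_scaleC_right scaleC_add_left del: of_nat_Suc)
  qed simp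
  also have "(\<Sum>i\<le>Suc n. (of_nat i *\<^sub>C ?D i) * ?E (Suc n - i)) = (\<Sum>i\<le>n. ?D i * (x + of_nat i) * ?E (n - i))"
    by (simp add: sum.atMost_Suc_shift divrising_Suc del: of_nat_Suc sum.atMost_Suc)
  also have "(\<Sum>i\<le>Suc n. ?D i * (of_nat (Suc n - i) *\<^sub>C ?E (Suc n - i))) =
      (\<Sum>i\<le>n. ?D i * (?E (n - i) * (y + of_nat (n - i))))"
    by (simp add: Suc_diff_le divrising_Suc del: of_nat_Suc of_nat_diff)
  also have "(\<Sum>i\<le>n. ?D i * (x + of_nat i) * ?E (n - i)) + \<dots> =
      (\<Sum>i\<le>n. ?D i * ?E (n - i)) * (x + y + of_nat n)"
    unfolding sum_distrib_right sum.distrib[symmetric]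
  proof (rule sum.cong)
    fix i assume "i \<in> {..n}"
    then have n: "(of_nat n :: 'a) = of_nat i + of_nat (n - i)" by (simp flip: of_nat_add)
    have swap: "(x + of_nat i) * ?E (n - i) = ?E (n - i) * (x + of_nat i)"
      by (simp add: distrib_left distrib_right comm mult_of_nat_commute)
    then show "?D i * (x + of_nat i) * ?E (n - i) + ?D i * (?E (n - i) * (y + of_nat (n - i))) =
        ?D i * ?E (n - i) * (x + y + of_nat n)"
      unfolding n by (simp only: mult.assoc swap) (simp only: distrib_left add_ac)
  qed simp
  also have "\<dots> = of_nat (Suc n) *\<^sub>C divrising (x + y) (Suc n)"
    by (simp only: Suc.IH divrising_Suc)
  finally show ?case
    by (metis cvec.scale_left_imp_eq of_nat_eq_0_iff old.nat.distinct(2))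
qed simp

text \<open>\<open>(1 - e t)\<^sup>-\<^sup>a\<close>, where \<open>a\<close> may be an element of the algebra; the coefficients stand to the left of
  the powers of \<open>e\<close>, which matters when \<open>a\<close> and \<open>e\<close> do not commute.\<close>

definition neg_power :: "'a::complex_algebra_1 fps \<Rightarrow> 'a fps \<Rightarrow> 'a fps" where
  "neg_power e a = fps_series (\<lambda>k. divrising a k * e ^ k)"

lemma fps_series_delta: "fps_series (\<lambda>k. if k = 0 then x else 0) = x"
proof (rule fps_ext)
  fix N
  have "(\<Sum>j\<le>N. (if j = 0 then x else 0) $ (N - j)) = (\<Sum>j\<le>N. if j = 0 then x $ N else 0)"
    by (rule sum.cong) auto
  then show "fps_series (\<lambda>k. if k = 0 then x else 0) $ N = x $ N" by (simp add: fps_series_def)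
qed

lemma neg_power_zero: "neg_power e 0 = 1"
proof -
  have "(\<lambda>k. divrising 0 k * e ^ k) = (\<lambda>k. if k = 0 then 1 else 0)"
    by (auto simp: divrising_zero)
  then show ?thesis by (simp add: neg_power_def fps_series_delta)
qed

lemma neg_power_intertwine:
  assumes "a * z = z * c" "e * z = z * e"
  shows "neg_power e a * z = z * neg_power e c"
proof -
  have "divrising a k * e ^ k * z = z * (divrising c k * e ^ k)" for k
    unfolding mult.assoc power_commuting_commutes[OF assms(2)]
    unfolding mult.assoc[symmetric] divrising_intertwine[OF assms(1)] ..
  then show ?thesis
    by (simp only: neg_power_def fps_series_mult_right fps_series_mult_left)
qed

text \<open>As the second exponent commutes with the base, the powers of \<open>e\<close> of the first factor can be
moved past the coefficients of the second; what remains is the Chu--Vandermonde identity.\<close>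

lemma neg_power_add:
  assumes "e * c = c * e" "a * c = c * a"
  shows "neg_power e a * neg_power e c = neg_power e (a + c)"
proof -
  have "divrising a i * e ^ i * (divrising c (n - i) * e ^ (n - i)) =
      divrising a i * divrising c (n - i) * e ^ n" if "i \<le> n" for i n
  proof -
    have "e ^ i * divrising c (n - i) = divrising c (n - i) * e ^ i"
      using divrising_commute[of c "e ^ i"] power_commuting_commutes[OF assms(1)] by simp
    then have "divrising a i * (e ^ i * divrising c (n - i)) * e ^ (n - i) =
        divrising a i * (divrising c (n - i) * e ^ i) * e ^ (n - i)" by (simp only:)
    then have "divrising a i * e ^ i * (divrising c (n - i) * e ^ (n - i)) =
        divrising a i * divrising c (n - i) * (e ^ i * e ^ (n - i))"
      by (simp only: mult.assoc)
    then show ?thesis using that by (simp flip: power_add)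
  qed
  then show ?thesis
    by (simp add: neg_power_def fps_series_mult divrising_add[OF assms(2)] sum_distrib_right)
qed

lemma hom_divrising:
  fixes \<phi> :: "'a::complex_algebra_1 fps \<Rightarrow> 'b::complex_algebra_1 fps"
  assumes "fps_linear \<phi>" "\<phi> 1 = 1" "\<And>x y. \<phi> (x * y) = \<phi> x * \<phi> y"
  shows "\<phi> (divrising a k) = divrising (\<phi> a) k"
proof -
  have "\<phi> (rising a 0 k) = rising (\<phi> a) 0 k"
    by (induction k) (simp_all add: assms fps_linearD[OF assms(1)])
  then show ?thesis by (simp add: divrising_def fps_linearD[OF assms(1)])
qed

lemma hom_neg_power:
  fixes \<phi> :: "'a::complex_algebra_1 fps \<Rightarrow> 'b::complex_algebra_1 fps"
  assumes "fps_linear \<phi>" "\<phi> 1 = 1" "\<And>x y. \<phi> (x * y) = \<phi> x * \<phi> y"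
  shows "\<phi> (neg_power e a) = neg_power (\<phi> e) (\<phi> a)"
proof -
  have "\<phi> (e ^ k) = \<phi> e ^ k" for k by (induction k) (simp_all add: assms)
  then show ?thesis
    by (simp add: neg_power_def fps_linear_series[OF assms(1)] assms(3) hom_divrising[OF assms])
qed

text \<open>\<open>y \<mapsto> y f\<close> is the difference of the commuting operators \<open>y \<mapsto> e y\<close> and the shift of the sequence,
so its powers follow the binomial theorem. The case \<open>f = e\<close>, with \<open>y\<^sub>j = (ad e)\<^sup>j y\<close>, moves \<open>y\<close> past a
power of \<open>e\<close>.\<close>

lemma commute_past_power:
  fixes e f :: "'a::complex_algebra_1"
  assumes "\<And>j. y j * f = e * y j - y (Suc j)"
  shows "y 0 * f ^ k = (\<Sum>j\<le>k. ((- 1) ^ j * of_nat (k choose j)) *\<^sub>C (e ^ (k - j) * y j))"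
  using assms
proof (induction k arbitrary: y)
  case (Suc k)
  let ?c = "\<lambda>k j. (- 1) ^ j * of_nat (k choose j) :: complex"
  have "y 0 * f ^ Suc k = e * (y 0 * f ^ k) - y 1 * f ^ k"
    using Suc.prems[of 0] by (simp add: left_diff_distrib mult.assoc flip: mult.assoc[of "y 0" f])
  also have "y 0 * f ^ k = (\<Sum>j\<le>k. ?c k j *\<^sub>C (e ^ (k - j) * y j))"
    by (rule Suc.IH) (rule Suc.prems)
  also have "y 1 * f ^ k = (\<Sum>j\<le>k. ?c k j *\<^sub>C (e ^ (k - j) * y (Suc j)))"
    using Suc.IH[of "\<lambda>j. y (Suc j)"] Suc.prems by simp
  also have "e * (\<Sum>j\<le>k. ?c k j *\<^sub>C (e ^ (k - j) * y j)) = (\<Sum>j\<le>Suc k. ?c k j *\<^sub>C (e ^ (Suc k - j) * y j))"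
    by (simp add: sum_distrib_left mult_scaleC_right Suc_diff_le mult.assoc)
  also have "\<dots> = e ^ Suc k * y 0 + (\<Sum>j\<le>k. ?c k (Suc j) *\<^sub>C (e ^ (k - j) * y (Suc j)))"
    by (simp add: sum.atMost_Suc_shift scaleC_one del: sum.atMost_Suc power_Suc)
  finally show ?case
    by (simp add: sum.atMost_Suc_shift scaleC_one del: sum.atMost_Suc power_Suc)
       (simp add: algebra_simps scaleC_add_left sum.distrib sum_negf sum_subtractf)
qed (simp add: scaleC_one)

text \<open>The previous lemma with \<open>e = y\<close>, \<open>f = x + y\<close> and the sequence \<open>(- x)\<^sup>j\<close>.\<close>

lemma binomial_commuting:
  fixes x y :: "'a::complex_algebra_1"
  assumes "x * y = y * x"
  shows "(x + y) ^ n = (\<Sum>i\<le>n. of_nat (n choose i) *\<^sub>C (y ^ (n - i) * x ^ i))"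
proof -
  have xy: "(- x) ^ j * y = y * (- x) ^ j" for j
    by (rule power_commuting_commutes) (simp add: assms)
  have "(- x) ^ j * (x + y) = y * (- x) ^ j - (- x) ^ Suc j" for j
    by (simp add: distrib_left xy power_Suc2 del: power_Suc)
  then have "(- x) ^ 0 * (x + y) ^ n = (\<Sum>j\<le>n. ((- 1) ^ j * of_nat (n choose j)) *\<^sub>C (y ^ (n - j) * (- x) ^ j))"
    by (rule commute_past_power[where y = "\<lambda>j. (- x) ^ j"])
  moreover have "((- 1) ^ j * of_nat (n choose j)) *\<^sub>C (y ^ (n - j) * (- x) ^ j) =
      of_nat (n choose j) *\<^sub>C (y ^ (n - j) * x ^ j)" for j
    by (cases "even j") simp_all
  ultimately show ?thesis by simp
qed

text \<open>Expansion of \<open>(1 - (x + y) t)\<^sup>-\<^sup>a\<close> in powers of \<open>x\<close>; a whole power of \<open>1 - y t\<close> appears as the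
coefficient because \<open>D\<^sub>i\<^sub>+\<^sub>k(a) (i + k choose i) = D\<^sub>i(a) D\<^sub>k(a + i)\<close>.\<close>

lemma neg_power_plus:
  assumes "x * y = y * x" "x * a = a * x" "y * a = a * y"
  shows "neg_power (x + y) a = fps_series (\<lambda>i. divrising a i * neg_power y (a + of_nat i) * x ^ i)"
proof -
  have yx: "y ^ k * x ^ i = x ^ i * y ^ k" for i k
    using assms(1) by (metis power_commuting_commutes)
  have binom: "(x + y) ^ n = (\<Sum>i\<le>n. of_nat (n choose i) *\<^sub>C (x ^ i * y ^ (n - i)))" for n
    using binomial_commuting[OF assms(1), of n] by (simp only: yx)
  have "divrising a i * neg_power y (a + of_nat i) * x ^ i =
      fps_series (\<lambda>k. of_nat (i + k choose i) *\<^sub>C (divrising a (i + k) * (x ^ i * y ^ k)))" for i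
  proof -
    have "divrising a i * (divrising (a + of_nat i) k * y ^ k) * x ^ i =
        of_nat (i + k choose i) *\<^sub>C (divrising a (i + k) * (x ^ i * y ^ k))" for k
    proof -
      have "divrising a i * (divrising (a + of_nat i) k * y ^ k) * x ^ i =
          (divrising a i * divrising (a + of_nat i) k) * (x ^ i * y ^ k)"
        by (simp only: mult.assoc yx)
      then show ?thesis by (simp only: divrising_split[symmetric] mult_scaleC_left)
    qed
    then show ?thesis
      by (simp add: neg_power_def fps_series_mult_left fps_series_mult_right)
  qed
  then show ?thesis
    by (simp add: fps_series_series neg_power_def binom sum_distrib_left mult_scaleC_right)
qed

text \<open>The cocycle identity in coordinates: \<open>a = T \<otimes> 1 \<otimes> 1\<close>, \<open>c = 1 \<otimes> T \<otimes> 1\<close>, \<open>x = 1 \<otimes> E \<otimes> 1\<close> and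
\<open>y = 1 \<otimes> 1 \<otimes> E\<close>. Conceptually, conjugation by \<open>(1 - y t)\<^sup>c\<close> sends \<open>x + y\<close> to \<open>x (1 - y t) + y\<close>, and
\<open>1 - (x (1 - y t) + y) t = (1 - x t)(1 - y t)\<close>. The proof compares the coefficients of \<open>x\<^sup>i\<close> on
both sides, which are the same power of \<open>1 - y t\<close>.\<close>

lemma neg_power_cocycle:
  assumes ax: "a * x = x * a" and ay: "a * y = y * a" and ac: "a * c = c * a"
    and yx: "y * x = x * y" and yc: "y * c = c * y"
    and cx: "c * x = x * (c + 1)"
  shows "neg_power x (- a) * neg_power y (- (a + c)) = neg_power y (- c) * neg_power (x + y) (- a)"
proof -
  have shift: "x ^ i * neg_power y (- (a + c)) = neg_power y (- (a + c) + of_nat i) * x ^ i" for i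
  proof (induction i)
    case (Suc i)
    have "(- (a + c) + of_nat (Suc i)) * x = x * (- (a + c) + of_nat i)"
      by (simp add: distrib_left distrib_right ax cx left_diff_distrib right_diff_distrib mult_of_nat_commute)
    then have "neg_power y (- (a + c) + of_nat (Suc i)) * x = x * neg_power y (- (a + c) + of_nat i)"
      by (rule neg_power_intertwine) (rule yx)
    then show ?case
      using Suc.IH by (simp only: power_Suc mult.assoc) (simp only: mult.assoc[symmetric])
  qed simp
  have "neg_power x (- a) * neg_power y (- (a + c)) =
      fps_series (\<lambda>i. divrising (- a) i * neg_power y (- (a + c) + of_nat i) * x ^ i)"
    unfolding neg_power_def[of x] fps_series_mult_right by (simp only: mult.assoc shift)
  also have "\<dots> = neg_power y (- c) *
      fps_series (\<lambda>i. divrising (- a) i * neg_power y (- a + of_nat i) * x ^ i)"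
    unfolding fps_series_mult_left
  proof (intro arg_cong[where f = fps_series] ext)
    fix i
    have "(- a) * (- c) = (- c) * (- a)" "(- a) * y = y * (- a)" using ac ay by simp_all
    note comm = this[THEN divrising_commute]
    have 1: "neg_power y (- c) * divrising (- a) i = divrising (- a) i * neg_power y (- c)"
      by (rule neg_power_intertwine) (simp_all only: comm)
    have 2: "neg_power y (- c) * neg_power y (- a + of_nat i) = neg_power y (- (a + c) + of_nat i)"
    proof -
      have "- c + (- a + of_nat i) = - (a + c) + of_nat i" by simp
      then show ?thesis
        by (subst neg_power_add) (simp_all only:,
          simp_all add: ay ac yc distrib_left distrib_right mult_of_nat_commute left_diff_distrib right_diff_distrib)
    qed
    show "divrising (- a) i * neg_power y (- (a + c) + of_nat i) * x ^ i =
        neg_power y (- c) * (divrising (- a) i * neg_power y (- a + of_nat i) * x ^ i)"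
      unfolding 2[symmetric] by (simp only: mult.assoc[symmetric] 1)
  qed
  also have "\<dots> = neg_power y (- c) * neg_power (x + y) (- a)"
    by (subst neg_power_plus) (simp_all add: ax ay yx)
  finally show ?thesis .
qed

text \<open>The common first step for the coproduct and the antipode: \<open>y\<close> is moved to the right of
\<open>(1 - e t)\<^sup>-\<^sup>a\<close>, its iterated commutators with \<open>e\<close> appearing on the way. The factor \<open>D\<^sub>l\<^sub>+\<^sub>j(s)\<close> is left
unsplit because the two applications split it at different places.\<close>

lemma mult_neg_power:
  assumes ade: "\<And>j. y j * e = e * y j - y (Suc j)" and "y 0 * a = s * y 0"
  shows "y 0 * neg_power e a =
    fps_series (\<lambda>j. fps_series (\<lambda>l. ((- 1) ^ j * of_nat (l + j choose l)) *\<^sub>C (divrising s (l + j) * e ^ l * y j)))"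
proof -
  have "y 0 * (divrising a n * e ^ n) =
      (\<Sum>j\<le>n. ((- 1) ^ j * of_nat (n - j + j choose (n - j))) *\<^sub>C (divrising s (n - j + j) * e ^ (n - j) * y j))" for n
  proof -
    have "y 0 * divrising a n = divrising s n * y 0"
      using divrising_intertwine[of s "y 0" a] assms(2) by simp
    then have "y 0 * (divrising a n * e ^ n) = divrising s n * (y 0 * e ^ n)"
      by (simp only: mult.assoc[symmetric])
    also have "\<dots> = (\<Sum>j\<le>n. ((- 1) ^ j * of_nat (n choose j)) *\<^sub>C (divrising s n * (e ^ (n - j) * y j)))"
      by (simp add: commute_past_power[where y = y, OF ade] sum_distrib_left mult_scaleC_right)
    also have "\<dots> = (\<Sum>j\<le>n. ((- 1) ^ j * of_nat (n - j + j choose (n - j))) *\<^sub>C (divrising s (n - j + j) * e ^ (n - j) * y j))"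
      by (rule sum.cong) (simp_all add: mult.assoc binomial_symmetric[symmetric])
    finally show ?thesis .
  qed
  then show ?thesis
    by (simp add: neg_power_def fps_series_mult_left fps_series_series)
qed

lemma power_intertwine:
  assumes "e * s = (s + 1) * (e :: 'a::complex_algebra_1)"
  shows "e ^ i * divrising s j = divrising (s + of_nat i) j * e ^ i"
proof -
  have "(s + of_nat i) * e ^ i = e ^ i * s"
  proof (induction i)
    case (Suc i)
    have "(s + of_nat (Suc i)) * e ^ Suc i = ((s + of_nat i) * e ^ i + e ^ i) * e"
      by (simp only: power_Suc2 of_nat_Suc) (simp add: distrib_right mult.assoc add_ac)
    also have "\<dots> = e ^ i * ((s + 1) * e)"
      by (simp only: Suc.IH) (simp add: distrib_left distrib_right mult.assoc)
    also have "\<dots> = e ^ Suc i * s" by (simp only: assms[symmetric] power_Suc2 mult.assoc)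
    finally show ?case .
  qed simp
  from divrising_intertwine[OF this] show ?thesis by simp
qed

text \<open>Gives \<open>w w' = 1\<close>. As \<open>s\<close> does not commute with \<open>e\<close>, this is not a
case of adding exponents; after collecting the powers of \<open>e\<close>, the coefficient of \<open>e\<^sup>n\<close> is an
alternating sum of binomial coefficients.\<close>

lemma neg_power_alternating:
  assumes "e * s = (s + 1) * e"
  shows "neg_power (- e) s * neg_power e s = 1"
proof -
  have "(\<Sum>i\<le>n. divrising s i * (- e) ^ i * (divrising s (n - i) * e ^ (n - i))) = (if n = 0 then 1 else 0)" for n
  proof -
    have "divrising s i * (- e) ^ i * (divrising s (n - i) * e ^ (n - i)) =
        ((- 1) ^ i * of_nat (n choose i)) *\<^sub>C (divrising s n * e ^ n)" if "i \<le> n" for i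
    proof -
      have minus: "(- e) ^ i = (- 1) ^ i *\<^sub>C e ^ i" by (cases "even i") (simp_all add: scaleC_one)
      have "divrising s i * e ^ i * (divrising s (n - i) * e ^ (n - i)) =
          divrising s i * divrising (s + of_nat i) (n - i) * (e ^ i * e ^ (n - i))"
        by (simp only: mult.assoc) (simp only: mult.assoc[symmetric] power_intertwine[OF assms])
      also have "\<dots> = of_nat (n choose i) *\<^sub>C (divrising s n * e ^ n)"
        by (simp only: divrising_split[symmetric] power_add[symmetric] le_add_diff_inverse[OF that] mult_scaleC_left)
      finally show ?thesis
        by (simp only: minus mult_scaleC_left mult_scaleC_right scaleC_scaleC)
    qed
    then have "(\<Sum>i\<le>n. divrising s i * (- e) ^ i * (divrising s (n - i) * e ^ (n - i))) =
        (\<Sum>i\<le>n. (- 1) ^ i * of_nat (n choose i)) *\<^sub>C (divrising s n * e ^ n)"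
      by (simp add: cvec.scale_sum_left)
    then show ?thesis by (cases "n = 0") (simp_all add: choose_alternating_sum scaleC_one)
  qed
  then show ?thesis by (simp only: neg_power_def fps_series_mult fps_series_delta)
qed

lemma neg_power_base_zero: "neg_power 0 a = 1"
proof -
  have "(\<lambda>k. divrising a k * 0 ^ k) = (\<lambda>k. if k = 0 then 1 else 0)" by (auto simp: fun_eq_iff zero_power)
  then show ?thesis by (simp add: neg_power_def fps_series_delta)
qed

text \<open>The factors of \<open>(t + 1)\<cdots>(t + j)\<close> read backwards, with all signs changed.\<close>

lemma rising_reflect:
  fixes t :: "'a::complex_algebra_1"
  shows "(- 1) ^ j *\<^sub>C rising (- t - of_nat j) 0 j = rising t 1 j"
proof (induction j)
  case (Suc j)
  have "rising (- t - of_nat (Suc j)) 1 j = rising (- t - of_nat (Suc j) + 1 *\<^sub>C 1) 0 j"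
    by (simp only: rising_shift add_0)
  then have shift: "rising (- t - of_nat (Suc j)) 1 j = rising (- t - of_nat j) 0 j"
    by (simp add: scaleC_one)
  have "rising (- t - of_nat (Suc j)) 0 (Suc j) = (- t - of_nat (Suc j)) * rising (- t - of_nat j) 0 j"
  proof -
    have "rising x 0 1 = x" for x :: 'a by simp
    then show ?thesis
      using rising_split[of "- t - of_nat (Suc j)" 0 1 j]
      by (simp only: plus_1_eq_Suc add_0 of_nat_1 shift)
  qed
  then have "(- 1) ^ Suc j *\<^sub>C rising (- t - of_nat (Suc j)) 0 (Suc j) = (t + of_nat (Suc j)) * rising t 1 j"
    by (simp only: Suc.IH[symmetric]) (simp add: mult_scaleC_right algebra_simps cvec.scale_right_diff_distrib scaleC_add_right)
  also have "\<dots> = rising t 1 j * (t + of_nat (Suc j))"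
    by (rule rising_intertwine[symmetric]) (simp add: distrib_left distrib_right mult_of_nat_commute)
  also have "t + of_nat (Suc j) = t + (1 + of_nat j) *\<^sub>C 1"
    by (simp add: scaleC_add_left scaleC_one of_nat_scaleC)
  finally show ?case by simp
qed (simp add: scaleC_one)

text \<open>The source of the formula for the coproduct: here \<open>a = T \<otimes> 1\<close> commutes with \<open>e = 1 \<otimes> E\<close> and
\<open>y\<^sub>j = 1 \<otimes> (ad E)\<^sup>j y\<close>, so that \<open>(1 - e t)\<^sup>a\<close> absorbs all of the power \<open>(1 - e t)\<^sup>-\<^sup>a\<^sup>-\<^sup>j\<close> except \<open>(1 - e t)\<^sup>-\<^sup>j\<close>.\<close>

lemma conjugate_by_neg_power:
  assumes ade: "\<And>j. y j * e = e * y j - y (Suc j)" and ay: "y 0 * a = a * y 0" and ae: "e * a = a * e"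
  shows "neg_power e (- a) * y 0 * neg_power e a =
    fps_series (\<lambda>j. (- 1) ^ j *\<^sub>C (divrising a j * (neg_power e (of_nat j) * y j)))"
proof -
  have ea: "e * - a = - a * e" using ae by simp
  have "y 0 * neg_power e a =
      fps_series (\<lambda>j. (- 1) ^ j *\<^sub>C (divrising a j * (neg_power e (a + of_nat j) * y j)))"
  proof -
    have "((- 1) ^ j * of_nat (l + j choose l)) *\<^sub>C (divrising a (l + j) * e ^ l * y j) =
        (- 1) ^ j *\<^sub>C (divrising a j * (divrising (a + of_nat j) l * e ^ l * y j))" for l j
    proof -
      have "of_nat (l + j choose l) *\<^sub>C divrising a (l + j) = divrising a j * divrising (a + of_nat j) l"
        using divrising_split[of j l a] binomial_symmetric[of j "j + l"] by (simp add: add.commute)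
      then show ?thesis
        by (simp only: scaleC_scaleC[symmetric] mult_scaleC_left[symmetric] mult.assoc)
    qed
    then show ?thesis
      unfolding mult_neg_power[where y = y, OF ade ay]
      by (simp add: neg_power_def fps_linear_series[OF fps_linear_scaleC_fun] fps_series_mult_left
          fps_series_mult_right mult.assoc)
  qed
  moreover have "neg_power e (- a) * (divrising a j * (neg_power e (a + of_nat j) * y j)) =
      divrising a j * (neg_power e (of_nat j) * y j)" for j
  proof -
    have "neg_power e (- a) * divrising a j = divrising a j * neg_power e (- a)"
      using divrising_commute[of a "- a" j] divrising_commute[of a e j] ae
      by (intro neg_power_intertwine) simp_all
    moreover have "neg_power e (- a) * neg_power e (a + of_nat j) = neg_power e (of_nat j)"
      by (subst neg_power_add) (simp_all add: ae distrib_left distrib_right mult_of_nat_commute)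
    ultimately show ?thesis by (simp only: mult.assoc[symmetric]) (simp only: mult.assoc)
  qed
  ultimately show ?thesis
    by (simp add: mult.assoc fps_series_mult_left mult_scaleC_right)
qed

lemma mult_of_nat_scaleC: "y * of_nat n = of_nat n *\<^sub>C (y :: 'a::complex_algebra_1)"
  using mult_scaleC_right[of y "of_nat n" 1] by (simp add: of_nat_scaleC)

text \<open>The source of the formula for the antipode. Now \<open>a = - t\<close> lies in the same algebra as \<open>e\<close> and
\<open>y\<close>; moving \<open>y\<close> past \<open>- t\<close> produces \<open>s = r - t\<close>, and the coefficient \<open>D\<^sub>j(s)\<close> moved to the right of
\<open>y\<^sub>j\<close> becomes \<open>D\<^sub>j(- t - j)\<close>, which is \<open>\<plusminus> (t + 1)\<cdots>(t + j) / j!\<close>.\<close>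

lemma move_past_neg_power:
  assumes ade: "\<And>j. y j * e = e * y j - y (Suc j)"
    and ty: "\<And>j. t * y j = y j * (t + (r + of_nat j) *\<^sub>C 1)"
    and te: "t * e = e * (t + 1)"
  shows "y 0 * neg_power e (- t) = neg_power e (- t) *
    fps_series (\<lambda>j. (1 / fact j) *\<^sub>C (neg_power e (r *\<^sub>C 1) * y j * rising t 1 j))"
proof -
  define s where "s = - t + r *\<^sub>C 1"
  have 0: "y 0 * (- t) = s * y 0"
    using ty[of 0] by (simp add: s_def distrib_left left_diff_distrib mult_scaleC_left mult_scaleC_right)
  have es: "e * s = (s + 1) * e"
    using te by (simp add: s_def distrib_left distrib_right left_diff_distrib right_diff_distrib
        mult_scaleC_left mult_scaleC_right)
  define z where "z j = (1 / fact j) *\<^sub>C (y j * rising t 1 j)" for j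
  have sy: "divrising s j * y j = y j * divrising (- t - of_nat j) j" for j
    using ty[of j]
    by (intro divrising_intertwine)
       (simp add: s_def distrib_left left_diff_distrib right_diff_distrib mult_scaleC_left mult_scaleC_right
         scaleC_add_left mult_of_nat_scaleC)
  have summand: "((- 1) ^ j * of_nat (l + j choose l)) *\<^sub>C (divrising s (l + j) * e ^ l * y j) =
      divrising s l * e ^ l * z j" for l j
  proof -
    have "of_nat (l + j choose l) *\<^sub>C (divrising s (l + j) * e ^ l * y j) =
        divrising s l * divrising (s + of_nat l) j * e ^ l * y j"
      by (simp only: divrising_split[symmetric] mult_scaleC_left)
    also have "\<dots> = divrising s l * e ^ l * (divrising s j * y j)"
      by (simp only: mult.assoc) (simp only: mult.assoc[symmetric] power_intertwine[OF es])
    also have "\<dots> = divrising s l * e ^ l * (y j * divrising (- t - of_nat j) j)"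
      by (simp only: sy)
    finally have "((- 1) ^ j * of_nat (l + j choose l)) *\<^sub>C (divrising s (l + j) * e ^ l * y j) =
        divrising s l * e ^ l * (y j * ((- 1) ^ j *\<^sub>C divrising (- t - of_nat j) j))"
      by (simp only: scaleC_scaleC[symmetric] mult_scaleC_right)
    also have "(- 1) ^ j *\<^sub>C divrising (- t - of_nat j) j = (1 / fact j) *\<^sub>C rising t 1 j"
      unfolding rising_reflect[symmetric] divrising_def by (simp add: scaleC_scaleC mult.commute)
    finally show ?thesis by (simp add: z_def mult_scaleC_right)
  qed
  have "y 0 * neg_power e (- t) = neg_power e s * fps_series z"
    unfolding mult_neg_power[where y = y, OF ade 0] summand
    by (simp only: neg_power_def fps_series_mult_left fps_series_mult_right)
  also have "neg_power e s = neg_power e (- t) * neg_power e (r *\<^sub>C 1)"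
    unfolding s_def by (rule neg_power_add[symmetric]) (simp_all add: mult_scaleC_left mult_scaleC_right)
  finally show ?thesis
    by (simp add: mult.assoc fps_series_mult_left z_def mult_scaleC_right)
qed

lemma one_minus_t_pow_eq: "one_minus_t_pow E a = neg_power (fps_const E) (- (a *\<^sub>C 1))"
proof (rule fps_ext)
  fix N
  have rising: "rising (- (a *\<^sub>C 1 :: 'a fps)) 0 k = pochhammer (- a) k *\<^sub>C 1" for k
  proof (induction k)
    case (Suc k)
    have "- (a *\<^sub>C 1 :: 'a fps) + (0 + of_nat k) *\<^sub>C 1 = (- a + of_nat k) *\<^sub>C 1"
      by (simp add: cvec.scale_left_diff_distrib)
    then show ?case
      by (simp only: rising.simps Suc.IH mult_scaleC_left mult_1_left scaleC_scaleC pochhammer_Suc)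
  qed (simp add: scaleC_one)
  have summand: "divrising (- (a *\<^sub>C 1)) k * fps_const E ^ k = fps_const (((- 1) ^ k * (a gchoose k)) *\<^sub>C E ^ k)" for k
    by (simp add: divrising_def rising scaleC_scaleC mult_scaleC_left gbinomial_pochhammer
        fps_const_scaleC fps_const_scale fps_const_power)
  have "(\<Sum>j\<le>N. fps_const (((- 1) ^ j * (a gchoose j)) *\<^sub>C E ^ j) $ (N - j)) =
      (\<Sum>j\<le>N. if j = N then ((- 1) ^ N * (a gchoose N)) *\<^sub>C E ^ N else 0)"
    by (rule sum.cong) auto
  then show "one_minus_t_pow E a $ N = neg_power (fps_const E) (- (a *\<^sub>C 1)) $ N"
    by (simp only: one_minus_t_pow_def neg_power_def summand) (simp add: fps_series_def)
qed

section \<open>The twist attached to \<open>[T, E] = E\<close>\<close>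

lemma lie_antisym: "lie x y = - lie y (x :: 'l::complex_lie_algebra)"
proof -
  have "lie x y + lie y x = lie (x + y) (x + y) - lie x x - lie y y"
    by (simp only: lie_add_left lie_add_right) simp
  then show ?thesis by (simp add: lie_self eq_neg_iff_add_eq_0)
qed

lemma lie_zero_right: "lie x 0 = (0 :: 'l::complex_lie_algebra)"
  using lie_scaleC_right[of x 0 0] by simp

lemma lie_minus_right: "lie x (- y) = - lie x (y :: 'l::complex_lie_algebra)"
  using lie_scaleC_right[of x "- 1" y] by (simp add: scaleC_one)

text \<open>The input of the construction is a two-dimensional nonabelian subalgebra.\<close>

locale jordanian_pair =
  fixes T E :: "'l::complex_lie_algebra"
  assumes TE: "lie T E = E" and E_nonzero: "E \<noteq> 0"
begin

abbreviation "t \<equiv> \<iota> T"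
abbreviation "e \<equiv> \<iota> E"

text \<open>\<open>F = (1 - (1 \<otimes> E) t)\<^sup>a\<close> with \<open>a = T \<otimes> 1\<close>, and its inverse.\<close>

definition F :: "('l uea, 'l uea) tensor fps" where "F = neg_power (1 \<otimes>\<^sub>t e) (- (t \<otimes>\<^sub>t 1))"
definition G :: "('l uea, 'l uea) tensor fps" where "G = neg_power (1 \<otimes>\<^sub>t e) (t \<otimes>\<^sub>t 1)"

lemma te: "t * e = e * (t + 1)"
  using iota_lie[of T E] by (simp add: TE distrib_left)

lemma FG: "F * G = 1" and GF: "G * F = 1"
  by (simp_all add: F_def G_def neg_power_add fps_tens_mult neg_power_zero)

lemma hom_left: "fps_linear (\<lambda>x. x \<otimes>\<^sub>t (1 :: 'l uea fps))" "(1 :: 'l uea fps) \<otimes>\<^sub>t (1 :: 'l uea fps) = 1"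
  "(x * y) \<otimes>\<^sub>t (1 :: 'l uea fps) = (x \<otimes>\<^sub>t 1) * (y \<otimes>\<^sub>t 1)"
  for x y :: "'a::complex_algebra_1 fps"
  by (simp_all add: fps_tens_linear_left fps_tens_one fps_tens_mult)

lemma hom_right: "fps_linear (\<lambda>x. (1 :: 'l uea fps) \<otimes>\<^sub>t x)"
  "(1 :: 'l uea fps) \<otimes>\<^sub>t (x * y) = (1 \<otimes>\<^sub>t x) * (1 \<otimes>\<^sub>t y)"
  for x y :: "'a::complex_algebra_1 fps"
  by (simp_all add: fps_tens_linear_right fps_tens_mult)

lemma divrising_tens: "divrising (x \<otimes>\<^sub>t (1 :: 'l uea fps)) k = divrising x k \<otimes>\<^sub>t 1" for x :: "'l uea fps"
  by (rule hom_divrising[OF hom_left(1) fps_tens_one hom_left(3), symmetric])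

lemma power_tens: "((1 :: 'l uea fps) \<otimes>\<^sub>t x) ^ k = 1 \<otimes>\<^sub>t (x ^ k)" for x :: "'l uea fps"
  by (induction k) (simp_all add: fps_tens_one fps_tens_mult)

lemma F_series: "F = fps_series (\<lambda>k. divrising (- t) k \<otimes>\<^sub>t e ^ k)"
  and G_series: "G = fps_series (\<lambda>k. divrising t k \<otimes>\<^sub>t e ^ k)"
  by (simp_all add: F_def G_def neg_power_def power_tens divrising_tens fps_tens_mult
      flip: fps_tens_left(5))

lemma antipode_divrising: "uea_antipode (divrising t k) = divrising (- t) k"
proof -
  have "uea_antipode (rising t 0 k) = rising (- t) 0 k"
  proof (induction k)
    case (Suc k)
    have "(- t + (0 + of_nat k) *\<^sub>C 1) * rising (- t) 0 k = rising (- t) 0 k * (- t + (0 + of_nat k) *\<^sub>C 1)"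
      by (rule rising_intertwine[symmetric])
         (simp add: right_diff_distrib left_diff_distrib mult_scaleC_left mult_scaleC_right)
    then show ?case
      by (simp add: uea_antipode_mult Suc fps_linearD[OF uea_antipode_linear] uea_antipode_iota uea_antipode_one)
  qed (simp add: uea_antipode_one)
  then show ?thesis by (simp add: divrising_def fps_linearD[OF uea_antipode_linear])
qed

lemma antipode_power: "uea_antipode (e ^ k) = (- e) ^ k"
proof (induction k)
  case (Suc k)
  have "uea_antipode (e ^ k * e) = (- e) ^ Suc k"
    by (simp only: uea_antipode_mult uea_antipode_iota Suc power_Suc)
  then show ?case by (simp only: power_Suc2)
qed (simp add: uea_antipode_one)

sublocale twist: hopf_twist uea_comult uea_counit_fps uea_antipode F G
proof -
  interpret formal_hopf_algebra "uea_comult :: 'l uea fps \<Rightarrow> _" uea_counit_fps uea_antipode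
    by (rule uea_hopf_algebra)
  show "hopf_twist uea_comult uea_counit_fps uea_antipode F G"
  proof
    show "uea_antipode (x * y) = uea_antipode y * uea_antipode x" for x y :: "'l uea fps"
      by (rule uea_antipode_mult)
    show "F * G = 1" "G * F = 1" by (rule FG GF)+
    let ?a = "t \<otimes>\<^sub>t ((1 :: 'l uea fps) \<otimes>\<^sub>t (1 :: 'l uea fps))"
    let ?c = "(1 :: 'l uea fps) \<otimes>\<^sub>t (t \<otimes>\<^sub>t (1 :: 'l uea fps))"
    let ?x = "(1 :: 'l uea fps) \<otimes>\<^sub>t (e \<otimes>\<^sub>t (1 :: 'l uea fps))"
    let ?y = "(1 :: 'l uea fps) \<otimes>\<^sub>t ((1 :: 'l uea fps) \<otimes>\<^sub>t e)"
    note assoc_one = fps_tensor_assoc_tens[of "1 :: 'l uea fps" "1 :: 'l uea fps" "1 :: 'l uea fps",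
        unfolded fps_tens_one]
    have F12: "fps_tensor_assoc (F \<otimes>\<^sub>t (1 :: 'l uea fps)) = neg_power ?x (- ?a)"
    proof -
      have lin: "fps_linear (\<lambda>X :: ('l uea, 'l uea) tensor fps. fps_tensor_assoc (X \<otimes>\<^sub>t (1 :: 'l uea fps)))"
        by (rule fps_linear_comp[OF fps_tensor_assoc_linear fps_tens_linear_left])
      show ?thesis
        unfolding F_def
        by (subst hom_neg_power[OF lin])
           (simp_all add: fps_tens_one assoc_one hom_left(3) fps_tensor_assoc_mult fps_linearD[OF lin]
             fps_tensor_assoc_tens)
    qed
    have A: "fps_tensor_assoc (fps_tensor_map uea_comult (id :: 'l uea fps \<Rightarrow> _) F) = neg_power ?y (- (?a + ?c))"
    proof -
      let ?A = "\<lambda>X. fps_tensor_assoc (fps_tensor_map uea_comult (id :: 'l uea fps \<Rightarrow> _) X) :: ('l uea, ('l uea, 'l uea) tensor) tensor fps"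
      note tens = fps_tensor_map_tens[OF uea_comult_linear fps_linear_id(1)]
      have lin: "fps_linear ?A"
        by (intro fps_linear_comp[OF fps_tensor_assoc_linear] fps_tensor_map_linear uea_comult_linear fps_linear_id)
      have one: "?A 1 = 1"
        using tens[of "1 :: 'l uea fps" "1 :: 'l uea fps"]
        by (simp add: uea_comult_one fps_tens_one assoc_one)
      have mult: "?A (X * Y) = ?A X * ?A Y" for X Y
        by (simp add: fps_tensor_assoc_mult fps_tensor_map_mult uea_comult_linear uea_comult_mult fps_linear_id)
      have "?A (1 \<otimes>\<^sub>t e) = ?y" "?A (t \<otimes>\<^sub>t 1) = ?a + ?c"
        unfolding tens
        by (simp_all add: uea_comult_one uea_comult_iota fps_tens_left(1) fps_linearD(1)[OF fps_tensor_assoc_linear]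
            fps_tensor_assoc_tens flip: fps_tens_one)
      then show ?thesis
        unfolding F_def hom_neg_power[where \<phi> = ?A, OF lin one mult] by (simp add: fps_linearD[OF lin])
    qed
    have F23: "(1 :: 'l uea fps) \<otimes>\<^sub>t F = neg_power ?y (- ?c)"
      unfolding F_def
      by (subst hom_neg_power[OF hom_right(1)])
         (simp_all add: fps_tens_one hom_right(2) fps_tens_right)
    have B: "fps_tensor_map (id :: 'l uea fps \<Rightarrow> _) uea_comult F = neg_power (?x + ?y) (- ?a)"
    proof -
      let ?B = "fps_tensor_map (id :: 'l uea fps \<Rightarrow> _) uea_comult :: _ \<Rightarrow> ('l uea, ('l uea, 'l uea) tensor) tensor fps"
      note tens = fps_tensor_map_tens[OF fps_linear_id(1) uea_comult_linear]
      have lin: "fps_linear ?B"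
        by (intro fps_tensor_map_linear uea_comult_linear fps_linear_id)
      have one: "?B 1 = 1"
        using tens[of "1 :: 'l uea fps" "1 :: 'l uea fps"]
        by (simp add: uea_comult_one fps_tens_one)
      have mult: "?B (X * Y) = ?B X * ?B Y" for X Y
        by (simp add: fps_tensor_map_mult uea_comult_linear uea_comult_mult fps_linear_id)
      have "?B (1 \<otimes>\<^sub>t e) = ?x + ?y" "?B (t \<otimes>\<^sub>t 1) = ?a"
        unfolding tens
        by (simp_all add: uea_comult_one uea_comult_iota fps_tens_right(1) fps_tens_one)
      then show ?thesis
        unfolding F_def hom_neg_power[where \<phi> = ?B, OF lin one mult] by (simp add: fps_linearD[OF lin])
    qed
    show "fps_tensor_assoc (F \<otimes>\<^sub>t 1) * fps_tensor_assoc (fps_tensor_map uea_comult id F) =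
        (1 \<otimes>\<^sub>t F) * fps_tensor_map id uea_comult F"
      unfolding F12 A F23 B
      by (rule neg_power_cocycle) (simp_all add: fps_tens_mult te distrib_left fps_tens_left(1) fps_tens_right(1))
    \<comment> \<open>One contraction kills the exponent of \<open>F\<close> and the other its base.\<close>
    note L = fps_bilinear_lift[OF fps_bilinear_counit(1)[OF counit_linear]]
    note R = fps_bilinear_lift[OF fps_bilinear_counit(2)[OF counit_linear]]
    note mult = counit_tensor_mult[OF counit_linear counit_mult]
    have one: "fps_tensor_lift (\<lambda>x y. uea_counit_fps x *\<^sub>t y) (1 :: ('l uea, 'l uea) tensor fps) = 1"
      "fps_tensor_lift (\<lambda>x y. uea_counit_fps y *\<^sub>t x) (1 :: ('l uea, 'l uea) tensor fps) = 1"
      using counit_left[of 1] counit_right[of 1] by (simp_all add: comult_one)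
    show "fps_tensor_lift (\<lambda>x y. uea_counit_fps x *\<^sub>t y) F = 1"
      unfolding F_def hom_neg_power[where \<phi> = "fps_tensor_lift (\<lambda>x y. uea_counit_fps x *\<^sub>t y)", OF L(1) one(1) mult(1)]
        fps_linearD(5)[OF L(1)] L(2)
      by (simp add: uea_counit_fps_iota fps_scale_zero_left neg_power_zero)
    show "fps_tensor_lift (\<lambda>x y. uea_counit_fps y *\<^sub>t x) F = 1"
      unfolding F_def hom_neg_power[where \<phi> = "fps_tensor_lift (\<lambda>x y. uea_counit_fps y *\<^sub>t x)", OF R(1) one(2) mult(2)]
        fps_linearD(5)[OF R(1)] R(2)
      by (simp add: uea_counit_fps_iota fps_scale_zero_left neg_power_base_zero)
  qed
qed

lemma w_eq: "twist.w = neg_power (- e) (- t)"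
proof -
  have bil: "fps_bilinear (\<lambda>x y. (x :: 'l uea fps) * uea_antipode y)"
    by (intro fps_bilinear_mult uea_antipode_linear fps_linear_id)
  show ?thesis
    unfolding twist.w_def unfolding F_series
    by (simp add: fps_linear_series[OF fps_bilinear_lift(1)[OF bil]]
        fps_bilinear_lift(2)[OF bil] antipode_power neg_power_def)
qed

lemma w'_eq: "twist.w' = neg_power e (- t)"
proof -
  have bil: "fps_bilinear (\<lambda>x y. uea_antipode (x :: 'l uea fps) * y)"
    by (intro fps_bilinear_mult uea_antipode_linear fps_linear_id)
  show ?thesis
    unfolding twist.w'_def unfolding G_series
    by (simp add: fps_linear_series[OF fps_bilinear_lift(1)[OF bil]]
        fps_bilinear_lift(2)[OF bil] antipode_divrising neg_power_def)
qed

lemma ww': "twist.w * twist.w' = 1"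
  unfolding w_eq w'_eq
  by (rule neg_power_alternating) (simp add: te distrib_left left_diff_distrib)

definition comult :: "'l uea fps \<Rightarrow> ('l uea, 'l uea) tensor fps" where
  "comult x = F * uea_comult x * G"

definition antipode :: "'l uea fps \<Rightarrow> 'l uea fps" where
  "antipode x = twist.w * uea_antipode x * twist.w'"

theorem twisted: "formal_hopf_algebra comult uea_counit_fps antipode"
  using twist.twisted_hopf_algebra[OF ww'] by (simp add: comult_def[abs_def] antipode_def[abs_def])

abbreviation v :: "complex \<Rightarrow> 'l uea fps" where "v \<equiv> one_minus_t_pow (uea_of E)"

lemma v_eq: "v a = neg_power e (- (a *\<^sub>C 1))"
  by (simp add: one_minus_t_pow_eq emb_def)

definition ad :: "nat \<Rightarrow> 'l \<Rightarrow> 'l" where "ad j y = (lie E ^^ j) y"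

lemma ad_commute: "\<iota> (ad j y) * e = e * \<iota> (ad j y) - \<iota> (ad (Suc j) y)"
  using iota_lie[of E "ad j y"] by (simp add: ad_def)

text \<open>\<open>E\<close> has weight 1, so each application of \<open>ad E\<close> raises the \<open>T\<close>-weight by 1.\<close>

lemma ad_weight:
  assumes "lie T y = r *\<^sub>C y"
  shows "lie T (ad j y) = (r + of_nat j) *\<^sub>C ad j y"
proof (induction j)
  case (Suc j)
  let ?z = "ad j y"
  have "lie T (lie E ?z) = - lie E (lie ?z T) - lie ?z (lie T E)"
    using lie_jacobi[of T E ?z] by (simp add: eq_neg_iff_add_eq_0 algebra_simps)
  also have "lie ?z T = - ((r + of_nat j) *\<^sub>C ?z)"
    by (simp only: lie_antisym[of ?z T] Suc)
  also have "lie E (- ((r + of_nat j) *\<^sub>C ?z)) = (- (r + of_nat j)) *\<^sub>C lie E ?z"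
    by (simp only: lie_scaleC_right cvec.scale_minus_left[symmetric])
  also have "lie ?z (lie T E) = - lie E ?z"
    by (simp add: TE lie_antisym[of ?z E])
  finally show ?case
    by (simp add: ad_def scaleC_add_left scaleC_one cvec.scale_left_diff_distrib)
qed (simp add: ad_def assms)

text \<open>\<open>F\<close> moved past \<open>y \<otimes> 1\<close> changes its exponent from \<open>T\<close> to \<open>T + r\<close>, which leaves the factor \<open>(1 - E t)\<^sup>r\<close>
in the second tensor slot; the conjugate of \<open>1 \<otimes> y\<close> is the series.\<close>

theorem comult_formula:
  assumes "lie T y = r *\<^sub>C y"
  shows "comult (\<iota> y) = \<iota> y \<otimes>\<^sub>t v r +
    fps_series (\<lambda>j. ((- 1) ^ j / fact j) *\<^sub>C (rising t 0 j \<otimes>\<^sub>t (v (- of_nat j) * \<iota> (ad j y))))"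
proof -
  have ty: "t * \<iota> y = \<iota> y * t + r *\<^sub>C \<iota> y"
    using iota_lie[of T y] by (simp add: assms iota_scaleC)
  have tens_v: "(1 :: 'l uea fps) \<otimes>\<^sub>t v a = neg_power (1 \<otimes>\<^sub>t e) (- (a *\<^sub>C 1))" for a
    unfolding v_eq hom_neg_power[where \<phi> = "\<lambda>x. (1 :: 'l uea fps) \<otimes>\<^sub>t x", OF hom_right(1) fps_tens_one hom_right(2)]
    by (simp add: fps_tens_right fps_tens_one)
  have "F * (\<iota> y \<otimes>\<^sub>t 1) = (\<iota> y \<otimes>\<^sub>t 1) * neg_power (1 \<otimes>\<^sub>t e) (- (r *\<^sub>C 1) + - (t \<otimes>\<^sub>t 1))"
    unfolding F_def
    by (rule neg_power_intertwine)
       (simp_all add: fps_tens_mult ty fps_tens_left distrib_left right_diff_distrib mult_scaleC_right)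
  also have "neg_power (1 \<otimes>\<^sub>t e) (- (r *\<^sub>C 1) + - (t \<otimes>\<^sub>t 1)) = (1 \<otimes>\<^sub>t v r) * F"
    unfolding F_def tens_v
    by (rule neg_power_add[symmetric]) (simp_all add: fps_tens_mult mult_scaleC_left mult_scaleC_right)
  finally have "F * (\<iota> y \<otimes>\<^sub>t 1) * G = (\<iota> y \<otimes>\<^sub>t 1) * (1 \<otimes>\<^sub>t v r) * (F * G)"
    by (simp only: mult.assoc)
  then have first: "F * (\<iota> y \<otimes>\<^sub>t 1) * G = \<iota> y \<otimes>\<^sub>t v r"
    by (simp add: FG fps_tens_mult)
  have "F * (1 \<otimes>\<^sub>t \<iota> (ad 0 y)) * G = fps_series (\<lambda>j. (- 1) ^ j *\<^sub>C
      (divrising (t \<otimes>\<^sub>t 1) j * (neg_power (1 \<otimes>\<^sub>t e) (of_nat j) * (1 \<otimes>\<^sub>t \<iota> (ad j y)))))"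
    unfolding F_def G_def
    by (rule conjugate_by_neg_power[where y = "\<lambda>j. 1 \<otimes>\<^sub>t \<iota> (ad j y)"])
       (simp_all add: fps_tens_mult ad_commute fps_tens_right)
  also have "\<dots> = fps_series (\<lambda>j. ((- 1) ^ j / fact j) *\<^sub>C (rising t 0 j \<otimes>\<^sub>t (v (- of_nat j) * \<iota> (ad j y))))"
  proof -
    have "neg_power ((1 :: 'l uea fps) \<otimes>\<^sub>t e) (of_nat j) = 1 \<otimes>\<^sub>t v (- of_nat j)" for j
      by (simp add: tens_v of_nat_scaleC)
    then show ?thesis
      by (simp add: divrising_tens fps_tens_mult) (simp add: divrising_def fps_tens_left scaleC_scaleC)
  qed
  finally have "F * (1 \<otimes>\<^sub>t \<iota> y) * G =
      fps_series (\<lambda>j. ((- 1) ^ j / fact j) *\<^sub>C (rising t 0 j \<otimes>\<^sub>t (v (- of_nat j) * \<iota> (ad j y))))"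
    by (simp add: ad_def)
  with first show ?thesis
    by (simp add: comult_def uea_comult_iota distrib_left distrib_right)
qed

text \<open>\<open>y w' = w' z\<close> where \<open>- z\<close> is the right-hand side, and \<open>w w' = 1\<close>, so \<open>S y = w (- y) w' = - z\<close>.\<close>

theorem antipode_formula:
  assumes "lie T y = r *\<^sub>C y"
  shows "antipode (\<iota> y) =
    fps_series (\<lambda>j. (- 1 / fact j) *\<^sub>C (v (- r) * \<iota> (ad j y) * rising t 1 j))"
proof -
  have "\<iota> (ad 0 y) * twist.w' = twist.w' *
      fps_series (\<lambda>j. (1 / fact j) *\<^sub>C (neg_power e (r *\<^sub>C 1) * \<iota> (ad j y) * rising t 1 j))"
    unfolding w'_eq
  proof (rule move_past_neg_power[where y = "\<lambda>j. \<iota> (ad j y)"])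
    show "t * \<iota> (ad j y) = \<iota> (ad j y) * (t + (r + of_nat j) *\<^sub>C 1)" for j
      using iota_lie[of T "ad j y"]
      by (simp add: ad_weight[OF assms] iota_scaleC distrib_left mult_scaleC_right)
  qed (simp_all add: ad_commute te)
  then have "\<iota> y * twist.w' = twist.w' *
      fps_series (\<lambda>j. (1 / fact j) *\<^sub>C (v (- r) * \<iota> (ad j y) * rising t 1 j))"
    by (simp add: ad_def v_eq)
  then have "antipode (\<iota> y) = - (twist.w * (twist.w' *
      fps_series (\<lambda>j. (1 / fact j) *\<^sub>C (v (- r) * \<iota> (ad j y) * rising t 1 j))))"
    by (simp add: antipode_def uea_antipode_iota mult.assoc)
  also have "\<dots> = - fps_series (\<lambda>j. (1 / fact j) *\<^sub>C (v (- r) * \<iota> (ad j y) * rising t 1 j))"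
    by (simp only: mult.assoc[symmetric] ww' mult_1_left)
  finally show ?thesis
    by (simp add: fps_eq_iff fps_series_def sum_negf)
qed

lemma v_zero: "v 0 = 1"
  by (simp add: v_eq neg_power_zero)

lemma v_add: "v a * v c = v (a + c)"
proof -
  have "v a * v c = neg_power e (- (a *\<^sub>C 1) + - (c *\<^sub>C 1))"
    unfolding v_eq by (rule neg_power_add) (simp_all add: mult_scaleC_left mult_scaleC_right)
  then show ?thesis by (simp add: v_eq scaleC_add_left)
qed

lemma v_one: "v 1 = 1 - e * fps_X"
proof (rule fps_ext)
  fix k
  have "(1 :: complex) gchoose k = of_nat (1 choose k)"
    using binomial_gbinomial[of 1 k, where 'a = complex] by simp
  then show "v 1 $ k = (1 - e * fps_X) $ k"
    by (cases k; cases "k - 1") (auto simp: one_minus_t_pow_def emb_def scaleC_one)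
qed

lemma v_minus_one: "v (- 1) * e * fps_X = v (- 1) - 1"
proof -
  have "v (- 1) * v 1 = 1" by (simp add: v_add v_zero)
  then show ?thesis by (simp add: v_one right_diff_distrib mult.assoc diff_eq_eq eq_diff_eq add.commute)
qed

lemma
  assumes weight: "lie T y = r *\<^sub>C y" and nilpotent: "lie E (lie E (lie E y)) = 0"
  shows comult_nilpotent: "comult (\<iota> y) = \<iota> y \<otimes>\<^sub>t v r + 1 \<otimes>\<^sub>t \<iota> y
      - (t \<otimes>\<^sub>t (v (- 1) * \<iota> (lie E y))) * fps_X
      + (1 / 2) *\<^sub>C (rising t 0 2 \<otimes>\<^sub>t (v (- 2) * \<iota> (lie E (lie E y)))) * fps_X ^ 2" (is ?C)
    and antipode_nilpotent: "antipode (\<iota> y) = - (v (- r) * \<iota> y)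
      - (v (- r) * \<iota> (lie E y) * rising t 1 1) * fps_X
      - (1 / 2) *\<^sub>C (v (- r) * \<iota> (lie E (lie E y)) * rising t 1 2) * fps_X ^ 2" (is ?S)
proof -
  have lie_zero: "lie E 0 = 0" using lie_scaleC_right[of E 0 0] by simp
  have "ad (3 + j) y = 0" for j
    by (induction j) (simp_all add: ad_def numeral_3_eq_3 nilpotent lie_zero)
  then have ad_zero: "ad j y = 0" if "j > 2" for j
    using that le_add_diff_inverse[of 3 j] by (metis One_nat_def Suc_leI eval_nat_numeral(3) numeral_2_eq_2)
  have ads: "ad 0 y = y" "ad (Suc 0) y = lie E y" "ad 2 y = lie E (lie E y)"
    by (simp_all add: ad_def numeral_2_eq_2)
  have upto: "(\<Sum>j\<le>2. f j) = f 0 + f 1 + f 2" for f :: "nat \<Rightarrow> 'b::comm_monoid_add"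
    by (simp add: numeral_2_eq_2)
  show ?C
    unfolding comult_formula[OF weight]
    by (subst fps_series_finite[where n = 2])
       (simp_all add: ad_zero iota_zero fps_tens_right upto ads v_zero scaleC_one fps_tens_left)
  show ?S
    unfolding antipode_formula[OF weight]
    by (subst fps_series_finite[where n = 2])
       (simp_all add: ad_zero iota_zero upto ads scaleC_one)
qed

text \<open>The degree derivations: the factor \<open>(1 - E t)\<^sup>-\<^sup>1 E t = (1 - E t)\<^sup>-\<^sup>1 - 1\<close> gives the two terms in \<open>T\<close>, and
\<open>E (T + 1) = T E\<close> gives the form of the antipode.\<close>

lemma
  assumes "lie T D = 0" "lie E D = - (c *\<^sub>C E)"
  shows comult_derivation: "comult (\<iota> D) = \<iota> D \<otimes>\<^sub>t 1 + 1 \<otimes>\<^sub>t \<iota> D - c *\<^sub>C (t \<otimes>\<^sub>t 1) + c *\<^sub>C (t \<otimes>\<^sub>t v (- 1))"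
    and antipode_derivation: "antipode (\<iota> D) = - \<iota> D + c *\<^sub>C (t * e * fps_X)"
proof -
  have weight: "lie T D = 0 *\<^sub>C D" by (simp add: assms)
  have zero: "lie E (lie E D) = 0" by (simp add: assms lie_minus_right lie_scaleC_right lie_self)
  note formulas = comult_nilpotent[OF weight] antipode_nilpotent[OF weight]
  have "comult (\<iota> D) = \<iota> D \<otimes>\<^sub>t 1 + 1 \<otimes>\<^sub>t \<iota> D + c *\<^sub>C (t \<otimes>\<^sub>t (v (- 1) * e * fps_X))"
    unfolding formulas(1)[unfolded zero, OF lie_zero_right]
    by (simp add: assms iota_zero iota_minus iota_scaleC v_zero fps_tens_right mult_scaleC_left mult_scaleC_right
        fps_tens_mult_X)
  then show "comult (\<iota> D) = \<iota> D \<otimes>\<^sub>t 1 + 1 \<otimes>\<^sub>t \<iota> D - c *\<^sub>C (t \<otimes>\<^sub>t 1) + c *\<^sub>C (t \<otimes>\<^sub>t v (- 1))"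
    by (simp add: v_minus_one fps_tens_right cvec.scale_right_diff_distrib)
  show "antipode (\<iota> D) = - \<iota> D + c *\<^sub>C (t * e * fps_X)"
    unfolding formulas(2)[unfolded zero, OF lie_zero_right]
    by (simp add: assms iota_zero iota_minus iota_scaleC v_zero mult_scaleC_left mult_scaleC_right te scaleC_one)
qed

text \<open>The adjoint action of the enveloping algebra on a fixed vector \<open>z\<close>. It detects that \<open>T\<close> and \<open>E\<close>
  stay linearly independent in the enveloping algebra, without the
  Poincare--Birkhoff--Witt theorem.\<close>

definition act :: "'l \<Rightarrow> 'l uea \<Rightarrow> 'l" where
  "act z = uea_lift (\<lambda>u. foldr lie u z)"

lemma act_respects:
  fixes z :: 'l
  shows "respects_uea (\<lambda>u. foldr lie u z)"
proof -
  have bracket: "lie x (lie y u) = lie y (lie x u) + lie (lie x y) u" for x y u :: 'l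
  proof -
    have "lie u (lie x y) = - lie (lie x y) u" by (rule lie_antisym)
    moreover have "lie y (lie u x) = - lie y (lie x u)"
      using lie_antisym[of u x] lie_scaleC_right[of y "-1" "lie x u"] by (simp add: scaleC_one)
    ultimately show ?thesis using lie_jacobi[of x y u] by (simp add: algebra_simps)
  qed
  have add: "foldr lie u (x + y) = foldr lie u x + foldr lie u y" for u and x y :: 'l
    by (induction u) (simp_all add: lie_add_right)
  have scale: "foldr lie u (c *\<^sub>C x) = c *\<^sub>C foldr lie u x" for u c and x :: 'l
    by (induction u) (simp_all add: lie_scaleC_right)
  show ?thesis
    unfolding respects_uea_def
  proof (intro conjI allI)
    fix u v x y
    show "foldr lie (u @ [x, y] @ v) z = foldr lie (u @ [y, x] @ v) z + foldr lie (u @ [lie x y] @ v) z"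
      by (simp add: bracket[of x y] add)
  qed (simp_all add: add scale lie_add_left lie_scaleC_left)
qed

lemma act_uea_of: "act z (uea_of x) = lie x z"
  using uea_lift_word[OF act_respects, of z "[x]"] by (simp add: act_def uea_word_def uea_of.abs_eq)

lemma uea_of_E_nonzero: "uea_of E \<noteq> 0"
proof
  assume "uea_of E = 0"
  then have "lie E T = 0"
    using act_uea_of[of T E] linearC.zero[OF uea_lift_linear[OF act_respects[of T]]] by (simp add: act_def)
  then show False using TE lie_antisym[of T E] E_nonzero by simp
qed

text \<open>Acting on \<open>E\<close>, the element \<open>T\<close> gives \<open>E\<close> and \<open>E\<close> gives 0; acting on \<open>T\<close>, the element \<open>E\<close> gives \<open>- E\<close> and
\<open>T\<close> gives 0. A functional with value 1 at \<open>E\<close> turns the two actions into functionals on the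
enveloping algebra whose tensor product separates \<open>T \<otimes> E\<close> from \<open>E \<otimes> T\<close>.\<close>

lemma tens_not_symmetric: "uea_of T \<otimes> uea_of E \<noteq> uea_of E \<otimes> uea_of T"
proof
  assume eq: "uea_of T \<otimes> uea_of E = uea_of E \<otimes> uea_of T"
  obtain \<phi> :: "'l \<Rightarrow> complex" where \<phi>: "Vector_Spaces.linear scaleC scaleC \<phi>" "\<phi> E = 1"
    using exists_functional[OF E_nonzero] .
  interpret \<phi>: Vector_Spaces.linear scaleC scaleC \<phi> by fact
  interpret a: linearC "act z" for z
    unfolding act_def by (rule uea_lift_linear[OF act_respects])
  let ?\<beta> = "\<lambda>x y. \<phi> (act E x) * \<phi> (act T y)"
  have bil: "bilinearC ?\<beta>"
    by (auto simp: bilinearC_def a.add a.scale \<phi>.add \<phi>.scale scaleC_complex_def algebra_simps)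
  have "tensor_lift ?\<beta> (uea_of T \<otimes> uea_of E) = - 1"
    by (simp add: tensor_lift_tens[OF bil] act_uea_of TE \<phi> lie_antisym[of E T] \<phi>.neg)
  moreover have "tensor_lift ?\<beta> (uea_of E \<otimes> uea_of T) = 0"
    by (simp add: tensor_lift_tens[OF bil] act_uea_of lie_self \<phi>.zero)
  ultimately show False using eq by simp
qed

lemma flip:
  shows flip_linear: "fps_linear fps_tensor_flip"
    and flip_tens: "fps_tensor_flip (x \<otimes>\<^sub>t y) = y \<otimes>\<^sub>t x"
proof -
  have "fps_bilinear (\<lambda>x y. y \<otimes>\<^sub>t x)"
    by (auto simp: fps_bilinear_def intro!: fps_tens_linear fps_linear_id)
  from fps_bilinear_lift[OF this]
  show "fps_linear fps_tensor_flip" "fps_tensor_flip (x \<otimes>\<^sub>t y) = y \<otimes>\<^sub>t x"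
    by (simp_all add: fps_tensor_flip_def)
qed

text \<open>\<open>\<Delta> T = T \<otimes> (1 - E t)\<^sup>-\<^sup>1 + 1 \<otimes> T\<close> has the coefficient \<open>T \<otimes> E\<close> at \<open>t\<close>, which is not symmetric.
(\<open>\<Delta> E\<close> would not help: its coefficient at \<open>t\<close> is \<open>- E \<otimes> E\<close>.)\<close>

theorem twisted_noncommutative_noncocommutative: "noncommutative_noncocommutative comult"
proof -
  have "t * e \<noteq> e * t"
  proof
    assume "t * e = e * t"
    then have "e = 0" by (simp add: te distrib_left)
    then have "uea_of E = 0" by (simp add: emb_def)
    then show False using uea_of_E_nonzero by simp
  qed
  moreover have "fps_tensor_flip (comult t) \<noteq> comult t"
  proof
    assume symmetric: "fps_tensor_flip (comult t) = comult t"
    let ?P = "t \<otimes>\<^sub>t (v (- 1) * e)" and ?Q = "(v (- 1) * e) \<otimes>\<^sub>t t"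
    have ET: "lie E T = - E" using TE lie_antisym[of E T] by simp
    have EE: "lie E (- E) = 0" using lie_scaleC_right[of E "- 1" E] by (simp add: lie_self scaleC_one)
    have "lie E 0 = 0" using lie_scaleC_right[of E 0 0] by simp
    then have "comult t = t \<otimes>\<^sub>t 1 + 1 \<otimes>\<^sub>t t + fps_X *\<^sub>t ?P"
      using comult_nilpotent[of T 0]
      by (simp add: lie_self ET EE v_zero iota_zero iota_minus fps_tens_right) (simp add: fps_mult_X)
    moreover from this have "fps_tensor_flip (comult t) = 1 \<otimes>\<^sub>t t + t \<otimes>\<^sub>t 1 + fps_X *\<^sub>t ?Q"
      by (simp add: fps_linearD[OF flip_linear] flip_tens)
    ultimately have "fps_X *\<^sub>t ?Q = fps_X *\<^sub>t ?P"
      using symmetric by (simp add: add.commute)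
    then have "(fps_X *\<^sub>t ?Q) $ Suc 0 = (fps_X *\<^sub>t ?P) $ Suc 0" by simp
    then have "?Q $ 0 = ?P $ 0" by (simp only: fps_X_scale_nth)
    moreover have "v (- 1) $ 0 = 1" by (simp add: one_minus_t_pow_def scaleC_one)
    ultimately have "uea_of E \<otimes> uea_of T = uea_of T \<otimes> uea_of E"
      by (simp add: fps_tens_def emb_def)
    then show False using tens_not_symmetric by simp
  qed
  ultimately show ?thesis
    unfolding noncommutative_noncocommutative_def by blast
qed

end

section \<open>The three twists of \<open>sl\<^sub>2(\<complex>\<^sub>q)\<close>\<close>

context sl2_quantum_torus begin

lemma root_nonzero:
  assumes "y \<in> {\<gg>, \<hh>} \<longrightarrow> m \<noteq> 0"
  shows "b y m \<noteq> 0"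
proof
  let ?v = "\<lambda>i. case i of Root y m \<Rightarrow> b y m | Cartan \<Rightarrow> d | Deg1 \<Rightarrow> d1 | Deg2 \<Rightarrow> d2"
  assume "b y m = 0"
  then have "?v (Root y m) = 0" by simp
  moreover have "Root y m \<in> sl2_indices" using assms unfolding sl2_indices_def by blast
  ultimately have "0 \<in> ?v ` sl2_indices" by (metis image_eqI)
  then show False
    using basis cvec.dependent_zero by (auto simp: basis_family_def)
qed

lemma lie_degree:
  "lie (x1 *\<^sub>C d1 + x2 *\<^sub>C d2) (b y m) = (x1 * of_int (fst m) + x2 * of_int (snd m)) *\<^sub>C b y m"
  "lie (x1 *\<^sub>C d1 + x2 *\<^sub>C d2) d = 0"
  "lie (x1 *\<^sub>C d1 + x2 *\<^sub>C d2) d1 = 0"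
  "lie (x1 *\<^sub>C d1 + x2 *\<^sub>C d2) d2 = 0"
  by (simp_all add: lie_add_left lie_scaleC_left d1_root d2_root scaleC_scaleC scaleC_add_left
      lie_antisym[of d1 d] lie_antisym[of d2 d] lie_antisym[of d2 d1] d_d1 d_d2 d1_d2 lie_self)

lemma lie_root_derivation:
  "lie (b y m) d1 = - (of_int (fst m) *\<^sub>C b y m)"
  "lie (b y m) d2 = - (of_int (snd m) *\<^sub>C b y m)"
  by (simp_all add: lie_antisym[of "b y m"] d1_root d2_root)

text \<open>The structure constants of \<open>ad g\<^sub>n\<close> are the factors of \<open>\<gamma>\<close> up to the sign. The formula includes the
degrees where the result is \<open>g\<^sub>0\<close>: there the last factor is \<open>q\<^sup>k - q\<^sup>k = 0\<close>, in accordance with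
\<open>[g\<^sub>n, g\<^sub>-\<^sub>n] = 0\<close>.\<close>

lemma ad_g:
  assumes "n \<noteq> 0"
  shows "(lie (b \<gg> n) ^^ j) (b y m) = ((- 1) ^ j * gamma q n y j m) *\<^sub>C b y (m + nmult j n)"
proof (induction j)
  case 0
  show ?case by (cases n; cases m; cases y) (simp_all add: nmult_def scaleC_one flip: zero_prod_def)
next
  case (Suc j)
  obtain n1 n2 m1 m2 where nm: "n = (n1, n2)" "m = (m1, m2)" by fastforce
  let ?k = "m + nmult j n"
  have k: "n + ?k = m + nmult (Suc j) n" "fst ?k = m1 + int j * n1" "snd ?k = m2 + int j * n2"
    by (simp_all add: nm nmult_def algebra_simps)
  have gg: "lie (b \<gg> n) (b \<gg> k) = (q powi (snd n * fst k) - q powi (snd k * fst n)) *\<^sub>C b \<gg> (n + k)" for k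
  proof (cases "k = 0 \<or> n + k = 0")
    case True
    then show ?thesis using g_g_zero[of n k] by (auto simp: g_zero lie_zero_right)
  qed (use g_g[OF assms] in auto)
  have "lie (b \<gg> n) (((- 1) ^ j * gamma q n y j m) *\<^sub>C b y ?k) =
      ((- 1) ^ Suc j * gamma q n y (Suc j) m) *\<^sub>C b y (n + ?k)"
  proof (cases y)
    case \<ee>
    have "gamma q n \<ee> (Suc j) m = - (gamma q n \<ee> j m * q powi (snd n * fst ?k))"
      by (simp add: nm nmult_def)
    with \<ee> show ?thesis by (simp add: lie_scaleC_right g_e[OF assms, of ?k] scaleC_scaleC)
  next
    case \<ff>
    have "gamma q n \<ff> (Suc j) m = gamma q n \<ff> j m * q powi (fst n * snd ?k)"
      by (simp add: nm nmult_def)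
    with \<ff> show ?thesis by (simp add: lie_scaleC_right lie_minus_right g_f[OF assms, of ?k] scaleC_scaleC)
  next
    case \<gg>
    have "gamma q n \<gg> (Suc j) m = - (gamma q n \<gg> j m * (q powi (snd n * fst ?k) - q powi (snd ?k * fst n)))"
      by (simp add: nm nmult_def mult.commute[of n1])
    with \<gg> show ?thesis by (simp add: lie_scaleC_right gg[of ?k] scaleC_scaleC)
  next
    case \<hh>
    then show ?thesis by (cases j) (simp_all add: nm lie_scaleC_right lie_zero_right g_h)
  qed
  then show ?case by (simp only: funpow.simps comp_apply Suc.IH k)
qed

end

text \<open>The twists with \<open>E = g\<^sub>n\<close>, which is nonzero exactly if \<open>n \<noteq> 0\<close>.\<close>

locale sl2_g_twist = sl2_quantum_torus q b d d1 d2 + jordanian_pair T "b \<gg> n"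
  for q b and d d1 d2 :: "'l::complex_lie_algebra" and T n
begin

lemma n_nonzero: "n \<noteq> 0"
  using E_nonzero g_zero by auto

lemma
  assumes "lie T (b y m) = r *\<^sub>C b y m"
  shows comult_root: "comult (\<iota> (b y m)) = \<iota> (b y m) \<otimes>\<^sub>t v r +
        fps_series (\<lambda>j. (gamma q n y j m / fact j) *\<^sub>C
          (rising (\<iota> T) 0 j \<otimes>\<^sub>t (v (- of_nat j) * \<iota> (b y (m + nmult j n)))))"
    and antipode_root: "antipode (\<iota> (b y m)) =
        fps_series (\<lambda>j. ((- 1) ^ (j + 1) * gamma q n y j m / fact j) *\<^sub>C
          (v (- r) * \<iota> (b y (m + nmult j n)) * rising (\<iota> T) 1 j))"
proof -
  have sign: "(- 1) ^ j * ((- 1) ^ j * x) = (x :: complex)" for j x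
    by (cases "even j") simp_all
  show "comult (\<iota> (b y m)) = \<iota> (b y m) \<otimes>\<^sub>t v r +
        fps_series (\<lambda>j. (gamma q n y j m / fact j) *\<^sub>C
          (rising (\<iota> T) 0 j \<otimes>\<^sub>t (v (- of_nat j) * \<iota> (b y (m + nmult j n)))))"
    unfolding comult_formula[OF assms] ad_def ad_g[OF n_nonzero]
    by (simp add: iota_scaleC mult_scaleC_right fps_tens_right scaleC_scaleC sign)
  show "antipode (\<iota> (b y m)) =
        fps_series (\<lambda>j. ((- 1) ^ (j + 1) * gamma q n y j m / fact j) *\<^sub>C
          (v (- r) * \<iota> (b y (m + nmult j n)) * rising (\<iota> T) 1 j))"
    unfolding antipode_formula[OF assms] ad_def ad_g[OF n_nonzero]
    by (simp add: iota_scaleC mult_scaleC_right mult_scaleC_left scaleC_scaleC)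
qed

lemma
  assumes "lie T d = 0"
  shows comult_cartan: "comult (\<iota> d) = \<iota> d \<otimes>\<^sub>t 1 + 1 \<otimes>\<^sub>t \<iota> d"
    and antipode_cartan: "antipode (\<iota> d) = - \<iota> d"
  using comult_derivation[of d 0] antipode_derivation[of d 0] assms
  by (simp_all add: lie_antisym[of _ d] d_g)

end

text \<open>The twists with \<open>E = e\<^sub>n\<close>, for any \<open>T\<close>. Here \<open>(ad E)\<^sup>3 = 0\<close> on all basis elements, so the series stop at
\<open>t\<^sup>2\<close>. The choices \<open>T = x\<^sub>1 d\<^sub>1 + x\<^sub>2 d\<^sub>2\<close> and \<open>T = d / 2\<close> differ only in the weights \<open>r\<close>.\<close>

locale sl2_e_twist = sl2_quantum_torus q b d d1 d2 + jordanian_pair T "b \<ee> n"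
  for q b and d d1 d2 :: "'l::complex_lie_algebra" and T n
begin

lemma lie_e_root:
  assumes "y \<noteq> \<ff>" "y \<in> {\<gg>, \<hh>} \<longrightarrow> m \<noteq> 0"
  shows "lie (b \<ee> n) (b y m) = - (alpha q n y m *\<^sub>C b \<ee> (m + n))"
  using assms
  by (cases y; cases n; cases m)
     (simp_all add: e_e lie_antisym[of "b \<ee> _" "b \<gg> _"] lie_antisym[of "b \<ee> _" "b \<hh> _"] g_e h_e)

lemma
  assumes "lie T (b y m) = r *\<^sub>C b y m" "y \<noteq> \<ff>" "y \<in> {\<gg>, \<hh>} \<longrightarrow> m \<noteq> 0"
  shows comult_root: "comult (\<iota> (b y m)) = \<iota> (b y m) \<otimes>\<^sub>t v r + 1 \<otimes>\<^sub>t \<iota> (b y m)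
        + alpha q n y m *\<^sub>C (\<iota> T \<otimes>\<^sub>t (v (- 1) * \<iota> (b \<ee> (m + n)))) * fps_X"
    and antipode_root: "antipode (\<iota> (b y m)) = - (v (- r) * \<iota> (b y m))
        + alpha q n y m *\<^sub>C (v (- r) * \<iota> (b \<ee> (m + n)) * rising (\<iota> T) 1 1) * fps_X"
  using comult_nilpotent[OF assms(1)] antipode_nilpotent[OF assms(1)]
  by (simp_all add: lie_e_root[OF assms(2,3)] lie_minus_right lie_scaleC_right e_e lie_zero_right
      iota_zero iota_minus iota_scaleC fps_tens_right mult_scaleC_left mult_scaleC_right)

lemma lie_e_f: "m + n \<noteq> 0 \<Longrightarrow> lie (b \<ee> n) (b \<ff> m) =
    q powi (fst m * snd n) *\<^sub>C b \<gg> (m + n) - q powi (snd m * fst n) *\<^sub>C b \<hh> (m + n)"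
  using e_f[of n m] by (simp add: add.commute mult.commute)

text \<open>The two contributions, through \<open>g\<close> and through \<open>h\<close>, are both \<open>- s\<^sub>m e\<close>; the factor 2 cancels
the denominator of \<open>(ad E)\<^sup>2 / 2!\<close>.\<close>

lemma lie_e_e_f:
  assumes "m + n \<noteq> 0"
  shows "lie (b \<ee> n) (lie (b \<ee> n) (b \<ff> m)) = - ((2 * s_coeff q n m) *\<^sub>C b \<ee> (m + nmult 2 n))"
proof -
  obtain n1 n2 m1 m2 where nm: "n = (n1, n2)" "m = (m1, m2)" by fastforce
  have deg: "m + n + n = m + nmult 2 n" by (simp add: nm nmult_def)
  have diff: "lie x (y - z) = lie x y - lie x z" for x y z :: 'l
    using lie_add_right[of x "y - z" z] by simp
  have "lie (b \<ee> n) (b \<gg> (m + n)) = - (q powi ((m2 + n2) * n1) *\<^sub>C b \<ee> (m + nmult 2 n))"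
    "lie (b \<ee> n) (b \<hh> (m + n)) = q powi ((m1 + n1) * n2) *\<^sub>C b \<ee> (m + nmult 2 n)"
    using assms by (simp_all add: lie_antisym[of "b \<ee> n"] g_e h_e deg) (simp_all add: nm)
  moreover have "q powi (m1 * n2) * q powi ((m2 + n2) * n1) = s_coeff q n m"
    "q powi (m2 * n1) * q powi ((m1 + n1) * n2) = s_coeff q n m"
    using q_nonzero by (simp_all add: nm algebra_simps flip: power_int_add)
  moreover have "(2 * s) *\<^sub>C x = s *\<^sub>C x + s *\<^sub>C x" for s and x :: 'l
    by (simp only: mult_2 scaleC_add_left)
  ultimately show ?thesis
    unfolding lie_e_f[OF assms] diff lie_scaleC_right
    by (simp add: nm scaleC_scaleC)
qed

lemma
  assumes "lie T (b \<ff> m) = r *\<^sub>C b \<ff> m" "m + n \<noteq> 0"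
  shows comult_f: "comult (\<iota> (b \<ff> m)) = \<iota> (b \<ff> m) \<otimes>\<^sub>t v r + 1 \<otimes>\<^sub>t \<iota> (b \<ff> m)
        + q powi (snd m * fst n) *\<^sub>C (\<iota> T \<otimes>\<^sub>t (v (- 1) * \<iota> (b \<hh> (m + n)))) * fps_X
        - q powi (fst m * snd n) *\<^sub>C (\<iota> T \<otimes>\<^sub>t (v (- 1) * \<iota> (b \<gg> (m + n)))) * fps_X
        - s_coeff q n m *\<^sub>C (rising (\<iota> T) 0 2 \<otimes>\<^sub>t (v (- 2) * \<iota> (b \<ee> (m + nmult 2 n)))) * fps_X ^ 2"
    and antipode_f: "antipode (\<iota> (b \<ff> m)) =
          q powi (snd m * fst n) *\<^sub>C (v (- r) * \<iota> (b \<hh> (m + n)) * rising (\<iota> T) 1 1) * fps_X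
        - q powi (fst m * snd n) *\<^sub>C (v (- r) * \<iota> (b \<gg> (m + n)) * rising (\<iota> T) 1 1) * fps_X
        - v (- r) * \<iota> (b \<ff> m)
        + s_coeff q n m *\<^sub>C (v (- r) * \<iota> (b \<ee> (m + nmult 2 n)) * rising (\<iota> T) 1 2) * fps_X ^ 2"
proof -
  have iota_diff: "\<iota> (x - y) = \<iota> x - \<iota> y" for x y :: 'l
    using iota_add[of "x - y" y] by simp
  note formulas = comult_nilpotent[OF assms(1)] antipode_nilpotent[OF assms(1)]
  have nilpotent: "lie (b \<ee> n) (lie (b \<ee> n) (lie (b \<ee> n) (b \<ff> m))) = 0"
    by (simp add: lie_e_e_f[OF assms(2)] lie_minus_right lie_scaleC_right e_e)
  show "comult (\<iota> (b \<ff> m)) = \<iota> (b \<ff> m) \<otimes>\<^sub>t v r + 1 \<otimes>\<^sub>t \<iota> (b \<ff> m)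
        + q powi (snd m * fst n) *\<^sub>C (\<iota> T \<otimes>\<^sub>t (v (- 1) * \<iota> (b \<hh> (m + n)))) * fps_X
        - q powi (fst m * snd n) *\<^sub>C (\<iota> T \<otimes>\<^sub>t (v (- 1) * \<iota> (b \<gg> (m + n)))) * fps_X
        - s_coeff q n m *\<^sub>C (rising (\<iota> T) 0 2 \<otimes>\<^sub>t (v (- 2) * \<iota> (b \<ee> (m + nmult 2 n)))) * fps_X ^ 2"
    unfolding formulas(1)[OF nilpotent] lie_e_e_f[OF assms(2)] unfolding lie_e_f[OF assms(2)]
    by (simp add: iota_diff iota_minus iota_scaleC fps_tens_right mult_scaleC_left mult_scaleC_right
        scaleC_scaleC right_diff_distrib left_diff_distrib cvec.scale_minus_left)
  show "antipode (\<iota> (b \<ff> m)) =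
          q powi (snd m * fst n) *\<^sub>C (v (- r) * \<iota> (b \<hh> (m + n)) * rising (\<iota> T) 1 1) * fps_X
        - q powi (fst m * snd n) *\<^sub>C (v (- r) * \<iota> (b \<gg> (m + n)) * rising (\<iota> T) 1 1) * fps_X
        - v (- r) * \<iota> (b \<ff> m)
        + s_coeff q n m *\<^sub>C (v (- r) * \<iota> (b \<ee> (m + nmult 2 n)) * rising (\<iota> T) 1 2) * fps_X ^ 2"
    unfolding formulas(2)[OF nilpotent] lie_e_e_f[OF assms(2)] unfolding lie_e_f[OF assms(2)]
    by (simp add: iota_diff iota_minus iota_scaleC mult_scaleC_left mult_scaleC_right
        scaleC_scaleC right_diff_distrib left_diff_distrib)
qed

lemma lie_e_d: "lie (b \<ee> n) d = - (2 *\<^sub>C b \<ee> n)"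
  by (simp add: lie_antisym[of _ d] d_e)

lemma
  assumes "lie T (b \<ff> (- n)) = (- 1) *\<^sub>C b \<ff> (- n)"
  shows comult_f_opposite: "comult (\<iota> (b \<ff> (- n))) = \<iota> (b \<ff> (- n)) \<otimes>\<^sub>t v (- 1) + 1 \<otimes>\<^sub>t \<iota> (b \<ff> (- n))
        - q powi (- (fst n * snd n)) *\<^sub>C (\<iota> T \<otimes>\<^sub>t (v (- 1) * \<iota> d)) * fps_X
        - q powi (- (fst n * snd n)) *\<^sub>C (rising (\<iota> T) 0 2 \<otimes>\<^sub>t (v (- 2) * \<iota> (b \<ee> n))) * fps_X ^ 2"
    and antipode_f_opposite: "antipode (\<iota> (b \<ff> (- n))) =
          q powi (- (fst n * snd n)) *\<^sub>C (v 1 * \<iota> (b \<ee> n) * rising (\<iota> T) 1 2) * fps_X ^ 2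
        - v 1 * \<iota> (b \<ff> (- n))
        - q powi (- (fst n * snd n)) *\<^sub>C (v 1 * \<iota> d * rising (\<iota> T) 1 1) * fps_X"
proof -
  let ?c = "q powi (- (fst n * snd n))"
  have 1: "lie (b \<ee> n) (b \<ff> (- n)) = ?c *\<^sub>C d"
    using e_f_zero[of n "- n"] by (simp add: mult.commute)
  have 2: "lie (b \<ee> n) (?c *\<^sub>C d) = - ((2 * ?c) *\<^sub>C b \<ee> n)"
    by (simp add: lie_scaleC_right lie_e_d scaleC_scaleC mult.commute)
  have "lie (b \<ee> n) (lie (b \<ee> n) (lie (b \<ee> n) (b \<ff> (- n)))) = 0"
    unfolding 1 2 by (simp add: lie_minus_right lie_scaleC_right e_e)
  note formulas = comult_nilpotent[OF assms this, unfolded 1 2] antipode_nilpotent[OF assms this, unfolded 1 2]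
  show "comult (\<iota> (b \<ff> (- n))) = \<iota> (b \<ff> (- n)) \<otimes>\<^sub>t v (- 1) + 1 \<otimes>\<^sub>t \<iota> (b \<ff> (- n))
        - ?c *\<^sub>C (\<iota> T \<otimes>\<^sub>t (v (- 1) * \<iota> d)) * fps_X
        - ?c *\<^sub>C (rising (\<iota> T) 0 2 \<otimes>\<^sub>t (v (- 2) * \<iota> (b \<ee> n))) * fps_X ^ 2"
    unfolding formulas(1)
    by (simp add: iota_minus iota_scaleC fps_tens_right mult_scaleC_left mult_scaleC_right scaleC_scaleC)
  show "antipode (\<iota> (b \<ff> (- n))) = ?c *\<^sub>C (v 1 * \<iota> (b \<ee> n) * rising (\<iota> T) 1 2) * fps_X ^ 2
        - v 1 * \<iota> (b \<ff> (- n)) - ?c *\<^sub>C (v 1 * \<iota> d * rising (\<iota> T) 1 1) * fps_X"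
    unfolding formulas(2)
    by (simp add: iota_minus iota_scaleC mult_scaleC_left mult_scaleC_right scaleC_scaleC)
qed

lemma
  assumes "lie T d = 0"
  shows comult_cartan: "comult (\<iota> d) = \<iota> d \<otimes>\<^sub>t 1 + 1 \<otimes>\<^sub>t \<iota> d + 2 *\<^sub>C (\<iota> T \<otimes>\<^sub>t (v (- 1) * \<iota> (b \<ee> n))) * fps_X"
    and antipode_cartan: "antipode (\<iota> d) = - \<iota> d + 2 *\<^sub>C (\<iota> (b \<ee> n) * rising (\<iota> T) 1 1) * fps_X"
  using comult_nilpotent[of d 0] antipode_nilpotent[of d 0] assms
  by (simp_all add: lie_e_d lie_minus_right lie_scaleC_right e_e lie_zero_right v_zero
      iota_zero iota_minus iota_scaleC fps_tens_right mult_scaleC_left mult_scaleC_right)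

end

theorem theorem1p1:
  fixes q :: complex
    and b :: "sl2_kind \<Rightarrow> int \<times> int \<Rightarrow> 'l::complex_lie_algebra"
    and d d1 d2 :: 'l
    and n :: "int \<times> int"
  assumes "sl2_quantum_torus q b d d1 d2"
  shows
    "(\<forall>x1 x2. let T = x1 *\<^sub>C d1 + x2 *\<^sub>C d2; E = b \<gg> n; v = one_minus_t_pow (uea_of E) in
       n \<noteq> 0 \<and> lie T E = E \<longrightarrow>
       (\<exists>\<Delta> S. formal_hopf_algebra \<Delta> uea_counit_fps S \<and> noncommutative_noncocommutative \<Delta> \<and>
         (\<forall>y m1 m2. let m = (m1, m2); r = x1 * of_int m1 + x2 * of_int m2 in
            (y \<in> {\<gg>, \<hh>} \<longrightarrow> m \<noteq> 0) \<longrightarrow>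
            \<Delta> (\<iota> (b y m)) = \<iota> (b y m) \<otimes>\<^sub>t v r +
              fps_series (\<lambda>j. (gamma q n y j m / fact j) *\<^sub>C
                (rising (\<iota> T) 0 j \<otimes>\<^sub>t (v (- of_nat j) * \<iota> (b y (m + nmult j n))))) \<and>
            S (\<iota> (b y m)) =
              fps_series (\<lambda>j. ((- 1) ^ (j + 1) * gamma q n y j m / fact j) *\<^sub>C
                (v (- r) * \<iota> (b y (m + nmult j n)) * rising (\<iota> T) 1 j))) \<and>
         (\<forall>(di, ni) \<in> {(d1, fst n), (d2, snd n)}.
            \<Delta> (\<iota> di) = \<iota> di \<otimes>\<^sub>t 1 + 1 \<otimes>\<^sub>t \<iota> di - of_int ni *\<^sub>C (\<iota> T \<otimes>\<^sub>t 1) + of_int ni *\<^sub>C (\<iota> T \<otimes>\<^sub>t v (- 1)) \<and>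
            S (\<iota> di) = - \<iota> di + of_int ni *\<^sub>C (\<iota> T * \<iota> E * fps_X)) \<and>
         \<Delta> (\<iota> d) = \<iota> d \<otimes>\<^sub>t 1 + 1 \<otimes>\<^sub>t \<iota> d \<and>
         S (\<iota> d) = - \<iota> d))
     \<and>
     (\<forall>x1 x2. let T = x1 *\<^sub>C d1 + x2 *\<^sub>C d2; E = b \<ee> n; v = one_minus_t_pow (uea_of E) in
       lie T E = E \<longrightarrow>
       (\<exists>\<Delta> S. formal_hopf_algebra \<Delta> uea_counit_fps S \<and> noncommutative_noncocommutative \<Delta> \<and>
         (\<forall>y m1 m2. let m = (m1, m2); r = x1 * of_int m1 + x2 * of_int m2 in
            y \<noteq> \<ff> \<and> (y \<in> {\<gg>, \<hh>} \<longrightarrow> m \<noteq> 0) \<longrightarrow>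
            \<Delta> (\<iota> (b y m)) = \<iota> (b y m) \<otimes>\<^sub>t v r + 1 \<otimes>\<^sub>t \<iota> (b y m)
              + alpha q n y m *\<^sub>C (\<iota> T \<otimes>\<^sub>t (v (- 1) * \<iota> (b \<ee> (m + n)))) * fps_X \<and>
            S (\<iota> (b y m)) = - (v (- r) * \<iota> (b y m))
              + alpha q n y m *\<^sub>C (v (- r) * \<iota> (b \<ee> (m + n)) * rising (\<iota> T) 1 1) * fps_X) \<and>
         (\<forall>m1 m2. let m = (m1, m2); r = x1 * of_int m1 + x2 * of_int m2 in
            m + n \<noteq> 0 \<longrightarrow>
            \<Delta> (\<iota> (b \<ff> m)) = \<iota> (b \<ff> m) \<otimes>\<^sub>t v r + 1 \<otimes>\<^sub>t \<iota> (b \<ff> m)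
              + q powi (m2 * fst n) *\<^sub>C (\<iota> T \<otimes>\<^sub>t (v (- 1) * \<iota> (b \<hh> (m + n)))) * fps_X
              - q powi (m1 * snd n) *\<^sub>C (\<iota> T \<otimes>\<^sub>t (v (- 1) * \<iota> (b \<gg> (m + n)))) * fps_X
              - s_coeff q n m *\<^sub>C (rising (\<iota> T) 0 2 \<otimes>\<^sub>t (v (- 2) * \<iota> (b \<ee> (m + nmult 2 n)))) * fps_X ^ 2 \<and>
            S (\<iota> (b \<ff> m)) =
                q powi (m2 * fst n) *\<^sub>C (v (- r) * \<iota> (b \<hh> (m + n)) * rising (\<iota> T) 1 1) * fps_X
              - q powi (m1 * snd n) *\<^sub>C (v (- r) * \<iota> (b \<gg> (m + n)) * rising (\<iota> T) 1 1) * fps_X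
              - v (- r) * \<iota> (b \<ff> m)
              + s_coeff q n m *\<^sub>C (v (- r) * \<iota> (b \<ee> (m + nmult 2 n)) * rising (\<iota> T) 1 2) * fps_X ^ 2) \<and>
         \<Delta> (\<iota> (b \<ff> (- n))) = \<iota> (b \<ff> (- n)) \<otimes>\<^sub>t v (- 1) + 1 \<otimes>\<^sub>t \<iota> (b \<ff> (- n))
              - q powi (- (fst n * snd n)) *\<^sub>C (\<iota> T \<otimes>\<^sub>t (v (- 1) * \<iota> d)) * fps_X
              - q powi (- (fst n * snd n)) *\<^sub>C (rising (\<iota> T) 0 2 \<otimes>\<^sub>t (v (- 2) * \<iota> E)) * fps_X ^ 2 \<and>
         S (\<iota> (b \<ff> (- n))) =
                q powi (- (fst n * snd n)) *\<^sub>C (v 1 * \<iota> E * rising (\<iota> T) 1 2) * fps_X ^ 2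
              - v 1 * \<iota> (b \<ff> (- n))
              - q powi (- (fst n * snd n)) *\<^sub>C (v 1 * \<iota> d * rising (\<iota> T) 1 1) * fps_X \<and>
         \<Delta> (\<iota> d) = \<iota> d \<otimes>\<^sub>t 1 + 1 \<otimes>\<^sub>t \<iota> d + 2 *\<^sub>C (\<iota> T \<otimes>\<^sub>t (v (- 1) * \<iota> E)) * fps_X \<and>
         S (\<iota> d) = - \<iota> d + 2 *\<^sub>C (\<iota> E * rising (\<iota> T) 1 1) * fps_X \<and>
         (\<forall>(di, ni) \<in> {(d1, fst n), (d2, snd n)}.
            \<Delta> (\<iota> di) = \<iota> di \<otimes>\<^sub>t 1 + 1 \<otimes>\<^sub>t \<iota> di - of_int ni *\<^sub>C (\<iota> T \<otimes>\<^sub>t 1) + of_int ni *\<^sub>C (\<iota> T \<otimes>\<^sub>t v (- 1)) \<and>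
            S (\<iota> di) = - \<iota> di + of_int ni *\<^sub>C (\<iota> T * \<iota> E * fps_X))))
     \<and>
     (let T = (1 / 2) *\<^sub>C d; E = b \<ee> n; v = one_minus_t_pow (uea_of E) in
       (\<exists>\<Delta> S. formal_hopf_algebra \<Delta> uea_counit_fps S \<and> noncommutative_noncocommutative \<Delta> \<and>
         (\<forall>y m1 m2. let m = (m1, m2); \<delta> = (if y = \<ee> then 1 else 0) in
            y \<noteq> \<ff> \<and> (y \<in> {\<gg>, \<hh>} \<longrightarrow> m \<noteq> 0) \<longrightarrow>
            \<Delta> (\<iota> (b y m)) = \<iota> (b y m) \<otimes>\<^sub>t v \<delta> + 1 \<otimes>\<^sub>t \<iota> (b y m)
              + alpha q n y m *\<^sub>C (\<iota> T \<otimes>\<^sub>t (v (- 1) * \<iota> (b \<ee> (m + n)))) * fps_X \<and>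
            S (\<iota> (b y m)) = - (v (- \<delta>) * \<iota> (b y m))
              + alpha q n y m *\<^sub>C (\<iota> (b \<ee> (m + n)) * rising (\<iota> T) 1 1) * fps_X) \<and>
         (\<forall>m1 m2. let m = (m1, m2) in
            m + n \<noteq> 0 \<longrightarrow>
            \<Delta> (\<iota> (b \<ff> m)) = \<iota> (b \<ff> m) \<otimes>\<^sub>t v (- 1) + 1 \<otimes>\<^sub>t \<iota> (b \<ff> m)
              + q powi (m2 * fst n) *\<^sub>C (\<iota> T \<otimes>\<^sub>t (v (- 1) * \<iota> (b \<hh> (m + n)))) * fps_X
              - q powi (m1 * snd n) *\<^sub>C (\<iota> T \<otimes>\<^sub>t (v (- 1) * \<iota> (b \<gg> (m + n)))) * fps_X
              - s_coeff q n m *\<^sub>C (rising (\<iota> T) 0 2 \<otimes>\<^sub>t (v (- 2) * \<iota> (b \<ee> (m + nmult 2 n)))) * fps_X ^ 2 \<and>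
            S (\<iota> (b \<ff> m)) =
                q powi (m2 * fst n) *\<^sub>C (v 1 * \<iota> (b \<hh> (m + n)) * rising (\<iota> T) 1 1) * fps_X
              - q powi (m1 * snd n) *\<^sub>C (v 1 * rising (\<iota> T) 1 1 * \<iota> (b \<gg> (m + n))) * fps_X
              - v 1 * \<iota> (b \<ff> m)
              + s_coeff q n m *\<^sub>C (v 1 * \<iota> (b \<ee> (m + nmult 2 n)) * rising (\<iota> T) 1 2) * fps_X ^ 2) \<and>
         \<Delta> (\<iota> (b \<ff> (- n))) = \<iota> (b \<ff> (- n)) \<otimes>\<^sub>t v (- 1) + 1 \<otimes>\<^sub>t \<iota> (b \<ff> (- n))
              - q powi (- (fst n * snd n)) *\<^sub>C (\<iota> T \<otimes>\<^sub>t (v (- 1) * \<iota> d)) * fps_X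
              - q powi (- (fst n * snd n)) *\<^sub>C (rising (\<iota> T) 0 2 \<otimes>\<^sub>t (v (- 2) * \<iota> E)) * fps_X ^ 2 \<and>
         S (\<iota> (b \<ff> (- n))) =
                q powi (- (fst n * snd n)) *\<^sub>C (v 1 * \<iota> E * rising (\<iota> T) 1 2) * fps_X ^ 2
              - v 1 * \<iota> (b \<ff> (- n))
              - q powi (- (fst n * snd n)) *\<^sub>C (v 1 * \<iota> d * rising (\<iota> T) 1 1) * fps_X \<and>
         \<Delta> (\<iota> d) = \<iota> d \<otimes>\<^sub>t 1 + 1 \<otimes>\<^sub>t \<iota> d + 2 *\<^sub>C (\<iota> T \<otimes>\<^sub>t (v (- 1) * \<iota> E)) * fps_X \<and>
         S (\<iota> d) = - \<iota> d + 2 *\<^sub>C (\<iota> E * rising (\<iota> T) 1 1) * fps_X \<and>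
         (\<forall>(di, ni) \<in> {(d1, fst n), (d2, snd n)}.
            \<Delta> (\<iota> di) = \<iota> di \<otimes>\<^sub>t 1 + 1 \<otimes>\<^sub>t \<iota> di + of_int ni *\<^sub>C (\<iota> T \<otimes>\<^sub>t v (- 1)) - of_int ni *\<^sub>C (\<iota> T \<otimes>\<^sub>t 1) \<and>
            S (\<iota> di) = - \<iota> di + of_int ni *\<^sub>C (\<iota> T * \<iota> E * fps_X))))"
proof -
  interpret sl2_quantum_torus q b d d1 d2 by fact
  have weight: "lie (x1 *\<^sub>C d1 + x2 *\<^sub>C d2) (b y (m1, m2)) = (x1 * of_int m1 + x2 * of_int m2) *\<^sub>C b y (m1, m2)"
    for x1 x2 y m1 m2
    by (simp add: lie_degree)
  have cartan_weight: "lie ((1 / 2) *\<^sub>C d) (b \<ee> m) = 1 *\<^sub>C b \<ee> m" "lie ((1 / 2) *\<^sub>C d) (b \<ff> m) = (- 1) *\<^sub>C b \<ff> m"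
    "y \<in> {\<gg>, \<hh>} \<Longrightarrow> lie ((1 / 2) *\<^sub>C d) (b y m) = 0 *\<^sub>C b y m"
    "lie ((1 / 2) *\<^sub>C d) d = 0" "lie ((1 / 2) *\<^sub>C d) d1 = 0" "lie ((1 / 2) *\<^sub>C d) d2 = 0" for y m
    by (auto simp: lie_scaleC_left d_e d_f d_g d_h d_d1 d_d2 lie_self scaleC_scaleC scaleC_one)
  show ?thesis
    unfolding Let_def
  proof (intro conjI allI impI, goal_cases)
    case (1 x1 x2)
    then have "sl2_g_twist q b d d1 d2 (x1 *\<^sub>C d1 + x2 *\<^sub>C d2) n"
      using root_nonzero[of \<gg> n] by unfold_locales auto
    then interpret X: sl2_g_twist q b d d1 d2 "x1 *\<^sub>C d1 + x2 *\<^sub>C d2" n .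
    show ?case
    proof (rule exI[of _ X.comult], rule exI[of _ X.antipode], intro conjI allI impI, goal_cases)
      case 5
      show ?case
        using X.comult_derivation[OF lie_degree(3) lie_root_derivation(1)]
          X.comult_derivation[OF lie_degree(4) lie_root_derivation(2)]
          X.antipode_derivation[OF lie_degree(3) lie_root_derivation(1)]
          X.antipode_derivation[OF lie_degree(4) lie_root_derivation(2)]
        by simp
    qed (rule X.twisted X.twisted_noncommutative_noncocommutative X.comult_root[OF weight]
        X.antipode_root[OF weight] X.comult_cartan[OF lie_degree(2)] X.antipode_cartan[OF lie_degree(2)])+
  next
    case (2 x1 x2)
    then have "sl2_e_twist q b d d1 d2 (x1 *\<^sub>C d1 + x2 *\<^sub>C d2) n"
      using root_nonzero[of \<ee> n] by unfold_locales auto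
    then interpret X: sl2_e_twist q b d d1 d2 "x1 *\<^sub>C d1 + x2 *\<^sub>C d2" n .
    \<comment> \<open>\<open>[T, E] = E\<close> fixes the weight of \<open>e\<^sub>n\<close> as 1, hence that of \<open>f\<^sub>-\<^sub>n\<close> as \<open>- 1\<close>.\<close>
    have "(x1 * of_int (fst n) + x2 * of_int (snd n)) *\<^sub>C b \<ee> n = 1 *\<^sub>C b \<ee> n"
      using 2 by (simp add: lie_degree scaleC_one)
    then have "x1 * of_int (fst n) + x2 * of_int (snd n) = 1"
      using X.E_nonzero by (simp only: cvec.scale_cancel_right) simp
    then have "x1 * of_int (fst (- n)) + x2 * of_int (snd (- n)) = - 1"
      by (simp add: algebra_simps)
    then have opposite: "lie (x1 *\<^sub>C d1 + x2 *\<^sub>C d2) (b \<ff> (- n)) = (- 1) *\<^sub>C b \<ff> (- n)"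
      by (simp only: lie_degree)
    show ?case
    proof (rule exI[of _ X.comult], rule exI[of _ X.antipode], intro conjI allI impI, goal_cases)
      case 11
      show ?case
        using X.comult_derivation[OF lie_degree(3) lie_root_derivation(1)]
          X.comult_derivation[OF lie_degree(4) lie_root_derivation(2)]
          X.antipode_derivation[OF lie_degree(3) lie_root_derivation(1)]
          X.antipode_derivation[OF lie_degree(4) lie_root_derivation(2)]
        by simp
    next
      case (3 y m1 m2)
      then show ?case by (intro X.comult_root weight) auto
    next
      case (4 y m1 m2)
      then show ?case by (intro X.antipode_root weight) auto
    next
      case (5 m1 m2)
      then show ?case using X.comult_f[OF weight] by simp
    next
      case (6 m1 m2)
      then show ?case using X.antipode_f[OF weight] by simp
    qed (rule X.twisted X.twisted_noncommutative_noncocommutative X.comult_f_opposite[OF opposite]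
        X.antipode_f_opposite[OF opposite] X.comult_cartan[OF lie_degree(2)] X.antipode_cartan[OF lie_degree(2)])+
  next
    case 3
    have "sl2_e_twist q b d d1 d2 ((1 / 2) *\<^sub>C d) n"
      using root_nonzero[of \<ee> n] cartan_weight(1)[of n] by unfold_locales (auto simp: scaleC_one)
    then interpret X: sl2_e_twist q b d d1 d2 "(1 / 2) *\<^sub>C d" n .
    have root_weight: "lie ((1 / 2) *\<^sub>C d) (b y m) = (if y = \<ee> then 1 else 0) *\<^sub>C b y m"
      if "y \<noteq> \<ff>" for y m
      using that cartan_weight(1,3) by (cases y) auto
    show ?case
    proof (rule exI[of _ X.comult], rule exI[of _ X.antipode], intro conjI allI impI, goal_cases)
      case 11
      show ?case
        using X.comult_derivation[OF cartan_weight(5) lie_root_derivation(1)]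
          X.comult_derivation[OF cartan_weight(6) lie_root_derivation(2)]
          X.antipode_derivation[OF cartan_weight(5) lie_root_derivation(1)]
          X.antipode_derivation[OF cartan_weight(6) lie_root_derivation(2)]
        by (simp add: algebra_simps)
    next
      case (3 y m1 m2)
      then show ?case by (intro X.comult_root root_weight) auto
    next
      case (4 y m1 m2)
      \<comment> \<open>The second term carries no power of \<open>1 - E t\<close>: \<open>\<alpha>\<close> vanishes for \<open>e\<close>, the weight for \<open>g\<close> and \<open>h\<close>.\<close>
      then have "alpha q n y (m1, m2) = 0 \<or> (if y = \<ee> then 1 else 0) = (0 :: complex)"
        by (cases n) auto
      then show ?case
        using X.antipode_root[OF root_weight, of y "(m1, m2)"] 4 by (auto simp: X.v_zero)
    next
      case (5 m1 m2)
      then show ?case using X.comult_f[OF cartan_weight(2)] by simp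
    next
      case (6 m1 m2)
      \<comment> \<open>\<open>T + 1\<close> and \<open>g\<close> appear in the opposite order here; they commute because \<open>g\<close> has weight 0.\<close>
      have "\<iota> ((1 / 2) *\<^sub>C d) * \<iota> (b \<gg> m) = \<iota> (b \<gg> m) * \<iota> ((1 / 2) *\<^sub>C d)" for m
        using iota_lie[of "(1 / 2) *\<^sub>C d" "b \<gg> m"] cartan_weight(3)[of \<gg> m] by (simp add: iota_zero)
      then have "rising (\<iota> ((1 / 2) *\<^sub>C d)) 1 1 * \<iota> (b \<gg> m) = \<iota> (b \<gg> m) * rising (\<iota> ((1 / 2) *\<^sub>C d)) 1 1" for m
        by (rule rising_intertwine)
      then show ?case using X.antipode_f[OF cartan_weight(2) 6] by (simp add: mult.assoc)
    qed (rule X.twisted X.twisted_noncommutative_noncocommutative X.comult_f_opposite[OF cartan_weight(2)]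
        X.antipode_f_opposite[OF cartan_weight(2)] X.comult_cartan[OF cartan_weight(4)]
        X.antipode_cartan[OF cartan_weight(4)])+
  qed
qed

end
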